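(* Let $p$ be a prime and let $e_1,e_2,e_3,e_4$ be odd integers with $1<e_i<p$ for all $i$, $e_1+e_2\le p$, and $\sum_{i=1}^4 e_i=2p+2$. Then $$h_p(p;e_1\text{-}e_2,e_3,e_4)=\begin{cases}h(p;e_1\text{-}e_2,e_3,e_4)-(p+1-e_1-e_2) & \text{if } e_1\ne e_2,\\ h(p;e_1\text{-}e_2,e_3,e_4)-(p+1-e_1-e_2)/2 & \text{if } e_1=e_2.\end{cases}$$
   Context: A cover of ramification type $(d;C_1,\dots,C_r)$ over an algebraically closed field, with $C_i$ conjugacy classes of $S_d$ and ordered distinct branch points $Q_1,\dots,Q_r\in\mathbb{P}^1$, is a finite separable degree-$d$ morphism $f:\mathbb{P}^1\to\mathbb{P}^1$, étale away from the $Q_i$, such that the ramification indices of the points in $f^{-1}(Q_i)$ are the cycle lengths of $C_i$. Covers are counted up to isomorphism over the fixed target $\mathbb{P}^1$. Writing $C_i=e$ means the class of a single $e$-cycle, and $C_i=e_1\text{-}e_2$ means the class of a product of two disjoint cycles of lengths $e_1$ and $e_2$ (all other points over $Q_i$ are unramified). The Hurwitz number $h(d;C_1,\dots,C_r)$ is the number of covers $\mathbb{P}^1\to\mathbb{P}^1$ of this type over $\mathbb{C}$ (independent of the choice of the $Q_i$). For a prime $p$ dividing none of the ramification indices, the $p$-Hurwitz number $h_p(d;C_1,\dots,C_r)$ is the number of covers $\mathbb{P}^1\to\mathbb{P}^1$ of this type over an algebraically closed field of characteristic $p$ when the branch points are generic (for $r=3$ one may take them to be $0,1,\infty$). *)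

theory Defs
  imports "HOL-Computational_Algebra.Computational_Algebra"
begin

text \<open>
  Only closed points of the projective line over an algebraically closed field are needed: such a
  field is infinite and the line is reduced, so a morphism is determined by its map on closed points.
\<close>

datatype 'a proj_line = Fin 'a | Infty

text \<open>
  The map \<open>t \<mapsto> a(t) / b(t)\<close> for coprime \<open>a\<close> and \<open>b\<close>; in homogeneous coordinates it is given by the
  degree \<open>n\<close> homogenizations of \<open>a\<close> and \<open>b\<close>, whence the value at infinity.
\<close>

definition rat_degree :: "'a::field poly \<Rightarrow> 'a poly \<Rightarrow> nat" where
  "rat_degree a b = max (degree a) (degree b)"

fun rat_map :: "'a::field poly \<Rightarrow> 'a poly \<Rightarrow> 'a proj_line \<Rightarrow> 'a proj_line" where
  "rat_map a b (Fin x) = (if poly b x = 0 then Infty else Fin (poly a x / poly b x))"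
| "rat_map a b Infty =
     (let n = rat_degree a b
      in if coeff b n = 0 then Infty else Fin (coeff a n / coeff b n))"

definition line_morphism :: "('a::alg_closed_field proj_line \<Rightarrow> 'a proj_line) \<Rightarrow> bool" where
  "line_morphism f \<longleftrightarrow> (\<exists>a b. coprime a b \<and> f = rat_map a b)"

definition line_automorphism :: "('a::alg_closed_field proj_line \<Rightarrow> 'a proj_line) \<Rightarrow> bool" where
  "line_automorphism \<mu> \<longleftrightarrow>
     line_morphism \<mu> \<and> (\<exists>\<nu>. line_morphism \<nu> \<and> \<mu> \<circ> \<nu> = id \<and> \<nu> \<circ> \<mu> = id)"

text \<open>
  \<open>a - c b\<close> (respectively \<open>b\<close>), homogenized to degree \<open>rat_degree a b\<close>, cuts out the scheme-theoretic
  fibre over \<open>Fin c\<close> (respectively \<open>Infty\<close>). The ramification index at a point is the order of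
  vanishing there of the form of the fibre through it. In the coordinate \<open>s = 1 / t\<close> at infinity, a
  form of degree \<open>n\<close> with dehomogenization \<open>g\<close> becomes \<open>s ^ n * g (1 / s)\<close>, which has order
  \<open>n - degree g\<close> at \<open>s = 0\<close>.
\<close>

fun fibre_poly :: "'a::field poly \<Rightarrow> 'a poly \<Rightarrow> 'a proj_line \<Rightarrow> 'a poly" where
  "fibre_poly a b (Fin c) = a - smult c b"
| "fibre_poly a b Infty = b"

definition ram_index :: "'a::field poly \<Rightarrow> 'a poly \<Rightarrow> 'a proj_line \<Rightarrow> nat" where
  "ram_index a b P =
     (let g = fibre_poly a b (rat_map a b P)
      in case P of Fin x \<Rightarrow> order x g | Infty \<Rightarrow> rat_degree a b - degree g)"

text \<open>
  A conjugacy class of the symmetric group on \<open>d\<close> letters is given by the multiset of all its cycle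
  lengths, fixed points included. The condition on \<open>pderiv\<close> says that the derivative of \<open>a / b\<close> is
  not zero, that is, that \<open>f\<close> is separable. Nonconstant morphisms of the line are finite and flat,
  so \<open>f\<close> is etale at a point exactly if the ramification index there is 1.
\<close>

definition covers ::
  "nat \<Rightarrow> 'a::alg_closed_field proj_line list \<Rightarrow> nat multiset list \<Rightarrow>
     ('a proj_line \<Rightarrow> 'a proj_line) set" where
  "covers d Qs Cs =
     {f. \<exists>a b. coprime a b \<and> f = rat_map a b \<and> rat_degree a b = d \<and>
           pderiv a * b - a * pderiv b \<noteq> 0 \<and>
           (\<forall>P. f P \<notin> set Qs \<longrightarrow> ram_index a b P = 1) \<and>
           length Qs = length Cs \<and>
           (\<forall>i < length Qs. image_mset (ram_index a b) (mset_set {P. f P = Qs ! i}) = Cs ! i)}"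

definition cover_iso ::
  "nat \<Rightarrow> 'a::alg_closed_field proj_line list \<Rightarrow> nat multiset list \<Rightarrow>
     (('a proj_line \<Rightarrow> 'a proj_line) \<times> ('a proj_line \<Rightarrow> 'a proj_line)) set" where
  "cover_iso d Qs Cs =
     {(f, g). f \<in> covers d Qs Cs \<and> g \<in> covers d Qs Cs \<and>
        (\<exists>\<mu>. line_automorphism \<mu> \<and> g = f \<circ> \<mu>)}"

text \<open>
  The number of covers with branch points \<open>Qs\<close>. Over the complex numbers this is the Hurwitz number,
  for any distinct branch points. In characteristic \<open>p\<close> it is the \<open>p\<close>-Hurwitz number if \<open>Qs\<close> is
  generic; three distinct points always are, as the automorphisms of the target permute such triples
  transitively.
\<close>

definition hurwitz_number ::
  "nat \<Rightarrow> 'a::alg_closed_field proj_line list \<Rightarrow> nat multiset list \<Rightarrow> nat" where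
  "hurwitz_number d Qs Cs = card (covers d Qs Cs // cover_iso d Qs Cs)"

definition one_cycle :: "nat \<Rightarrow> nat \<Rightarrow> nat multiset" where
  "one_cycle d e = {#e#} + replicate_mset (d - e) 1"

definition two_cycles :: "nat \<Rightarrow> nat \<Rightarrow> nat \<Rightarrow> nat multiset" where
  "two_cycles d e e' = {#e, e'#} + replicate_mset (d - (e + e')) 1"

end

theory Submission
  imports Defs "Jordan_Normal_Form.Char_Poly"
begin

text \<open>
  Put the \<open>e3\<close>-point at \<open>0\<close>, the \<open>e4\<close>-point at \<open>\<infinity>\<close>, the \<open>e1\<close>-point at \<open>1\<close> and the
  \<open>e2\<close>-point at \<open>l\<close>, and let \<open>0\<close>, \<open>\<infinity>\<close> and \<open>1\<close> be the branch points under them. A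
  cover is then a fraction \<open>u / v\<close> with \<open>u - v = (x - 1) ^ e1 * (x - l) ^ e2 * c\<close>, \<open>x ^ e3\<close>
  dividing \<open>u\<close> and \<open>deg v \<le> p - e4\<close>, so that \<open>c\<close>, of degree at most \<open>m = p - e1 - e2\<close>,
  is a polynomial for which \<open>m + 1\<close> consecutive coefficients of
  \<open>(x - 1) ^ e1 * (x - l) ^ e2 * c\<close> vanish. Such a \<open>c\<close> exists exactly if a Toeplitz
  determinant of size \<open>m + 1\<close>, a polynomial in \<open>l\<close>, vanishes. Comparing the order of
  vanishing of the Wronskian of \<open>u\<close> and \<open>v\<close> with its degree shows that every root
  \<open>l \<noteq> 0, 1\<close> gives a cover, unique for that root, and that these roots are simple
  because first order deformations are obstructed. The number of nonzero roots with
  multiplicity is read off from the orders of the determinant at \<open>0\<close> and \<open>\<infinity>\<close> and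
  does not depend on the characteristic. In characteristic \<open>0\<close> the point \<open>l = 1\<close> is not a
  root, while in characteristic \<open>p\<close> it is a root of order exactly \<open>m + 1 = p + 1 - e1 - e2\<close>:
  the inseparable solution \<open>x ^ p - 1 = (x - 1) ^ p\<close> extends to order \<open>m\<close> in \<open>l - 1\<close>, and no
  further. For \<open>e1 = e2\<close> the roots \<open>l\<close> and \<open>1 / l\<close> give isomorphic covers, and \<open>l = -1\<close> is
  not a root as \<open>e3\<close> is odd.
\<close>

hide_const (open) module.smult

section \<open>Wronskians and polynomials with a gap\<close>

text \<open>The obstacle is inseparability: in characteristic \<open>p\<close> the degree of the
  covers is \<open>p\<close>, so a nonzero solution of the linear equations may have Wronskian zero.
  As the positive integers below the degree are invertible, this leaves only
  \<open>u = a * x ^ p\<close> with \<open>v\<close> constant, and such a fraction takes the same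
  value at \<open>1\<close> and \<open>l\<close> only for \<open>l = 1\<close>. In all other cases
  the ramification at \<open>0\<close>, \<open>1\<close> and \<open>l\<close> forces
  \<open>(q + m) + (e1 - 1) + (e2 - 1)\<close> zeros on the Wronskian, the largest degree it can
  have; so every bound on an order or a degree is an equality and no further ramification fits in.
  When \<open>1\<close> and \<open>l\<close> merge, or when a first order deformation is formed, the
  same count exceeds the bound by one; hence the nonvanishing at degenerate parameters and the
  obstruction. Both fields enter through one hypothesis, the invertibility of the integers below the
  degree, so the determinant is analysed once, and the common number of nonzero roots is compared
  but never evaluated. Orders at nonzero roots come from Cramer's rule and an explicit approximate
  kernel vector; the determinant is not expanded.\<close>

definition wronskian :: "'a::field poly \<Rightarrow> 'a poly \<Rightarrow> 'a poly" where
  "wronskian u v = pderiv u * v - u * pderiv v"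

lemma wronskian_diff_left: "wronskian (u - v) v = wronskian u v"
  by (simp add: wronskian_def pderiv_diff algebra_simps)

lemma wronskian_minus_swap: "wronskian v u = - wronskian u v"
  by (simp add: wronskian_def algebra_simps)

lemma power_dvd_pderiv:
  fixes a u :: "'a::field poly"
  assumes "a ^ k dvd u"
  shows "a ^ (k - 1) dvd pderiv u"
proof -
  obtain w where u: "u = a ^ k * w" using assms by (elim dvdE)
  have "pderiv u = a ^ (k - 1) * (of_nat k * pderiv a * w) + a ^ k * pderiv w"
    by (simp add: u pderiv_mult pderiv_power of_nat_poly algebra_simps)
  moreover have "a ^ (k - 1) dvd a ^ k" by (simp add: le_imp_power_dvd)
  ultimately show ?thesis by (metis dvd_add dvd_mult2 dvd_triv_left)
qed

lemma power_dvd_wronskian: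
  assumes "a ^ k dvd u"
  shows "a ^ (k - 1) dvd wronskian u v"
proof -
  have "a ^ (k - 1) dvd u"
    using assms by (meson diff_le_self dvd_trans le_imp_power_dvd)
  then show ?thesis
    unfolding wronskian_def by (intro dvd_diff dvd_mult2 power_dvd_pderiv assms)
qed

text \<open>One order better than \<open>power_dvd_wronskian\<close>. Once the exact orders of the
  Wronskian are known, this gain excludes common zeros of numerator and denominator.\<close>

lemma power_dvd_wronskian_common:
  assumes "a ^ k dvd u" "a dvd v"
  shows "a ^ k dvd wronskian u v"
proof (cases k)
  case (Suc j)
  have "a ^ j * a dvd pderiv u * v"
    using power_dvd_pderiv[OF assms(1)] assms(2) Suc by (intro mult_dvd_mono) auto
  then show ?thesis
    unfolding wronskian_def using assms(1) Suc by (intro dvd_diff) (auto simp: mult.commute)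
qed auto

lemma degree_pderiv_le: "degree (pderiv u) \<le> degree u - 1"
  by (rule degree_le) (auto simp: coeff_pderiv coeff_eq_0)

lemma degree_wronskian:
  assumes "wronskian u v \<noteq> 0"
  shows "degree (wronskian u v) < degree u + degree v"
proof -
  have nz: "u \<noteq> 0" "v \<noteq> 0" using assms by (auto simp: wronskian_def)
  have 1: "pderiv u * v = 0 \<or> degree (pderiv u * v) < degree u + degree v"
  proof (cases "degree u = 0")
    case True
    then show ?thesis by (metis degree_eq_zeroE mult_zero_left pderiv_singleton)
  next
    case False
    then show ?thesis using degree_mult_le[of "pderiv u" v] degree_pderiv_le[of u] by linarith
  qed
  have 2: "u * pderiv v = 0 \<or> degree (u * pderiv v) < degree u + degree v"
  proof (cases "degree v = 0")
    case True
    then show ?thesis by (metis degree_eq_zeroE mult_zero_right pderiv_singleton)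
  next
    case False
    then show ?thesis using degree_mult_le[of u "pderiv v"] degree_pderiv_le[of v] by linarith
  qed
  show ?thesis
    using 1 2 assms degree_diff_less[of "pderiv u * v" "degree u + degree v" "u * pderiv v"]
    unfolding wronskian_def by auto
qed

text \<open>If \<open>u\<close> and \<open>v\<close> have orders \<open>\<alpha>\<close> and
  \<open>\<beta>\<close> at 0, the lowest coefficient of \<open>X * wronskian u v\<close> is
  \<open>\<alpha> - \<beta>\<close> times the product of the lowest coefficients of \<open>u\<close>
  and \<open>v\<close>.\<close>

lemma wronskian_nonzero:
  fixes u v :: "'a::field poly"
  assumes "u \<noteq> 0" "v \<noteq> 0" and ne: "of_nat (order 0 u) \<noteq> (of_nat (order 0 v) :: 'a)"
  shows "wronskian u v \<noteq> 0"
proof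
  assume w0: "wronskian u v = 0"
  define \<alpha> \<beta> where "\<alpha> = order 0 u" and "\<beta> = order 0 v"
  define X :: "'a poly" where "X = [:0, 1:]"
  obtain f where f: "u = X ^ \<alpha> * f" "\<not> X dvd f"
    using order_decomp[OF assms(1), of 0] by (auto simp: \<alpha>_def X_def)
  obtain g where g: "v = X ^ \<beta> * g" "\<not> X dvd g"
    using order_decomp[OF assms(2), of 0] by (auto simp: \<beta>_def X_def)
  have pX: "pderiv X = 1" by (simp add: X_def pderiv_pCons)
  \<comment> \<open>The Euler operator \<open>X * d/dX\<close> has the powers of \<open>X\<close> as
    eigenvectors; the factor \<open>X\<close> in front avoids the exponent \<open>k - 1\<close> and
    so covers \<open>k = 0\<close>.\<close>
  have XP: "X * pderiv (X ^ k) = of_nat k * X ^ k" for k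
    by (cases k) (simp_all add: pderiv_power_Suc pX of_nat_poly del: power_Suc, simp add: mult_ac)
  have du: "X * pderiv u = X ^ \<alpha> * (of_nat \<alpha> * f + X * pderiv f)"
    using XP[of \<alpha>] unfolding f pderiv_mult by (simp add: algebra_simps)
  have dv: "X * pderiv v = X ^ \<beta> * (of_nat \<beta> * g + X * pderiv g)"
    using XP[of \<beta>] unfolding g pderiv_mult by (simp add: algebra_simps)
  have "X * wronskian u v = (X * pderiv u) * v - u * (X * pderiv v)"
    by (simp add: wronskian_def algebra_simps)
  also have "\<dots> = X ^ \<alpha> * X ^ \<beta> *
      ((of_nat \<alpha> - of_nat \<beta>) * (f * g) + X * (pderiv f * g - f * pderiv g))"
    unfolding du dv unfolding f g by (simp add: algebra_simps)
  finally have "(of_nat \<alpha> - of_nat \<beta>) * (f * g) + X * (pderiv f * g - f * pderiv g) = 0"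
    using w0 by (simp add: X_def)
  then have "poly ((of_nat \<alpha> - of_nat \<beta>) * (f * g) + X * (pderiv f * g - f * pderiv g)) 0 = 0"
    by simp
  then have "(of_nat \<alpha> - of_nat \<beta>) * (poly f 0 * poly g 0) = (0::'a)"
    by (simp add: X_def)
  moreover have "poly f 0 \<noteq> 0" "poly g 0 \<noteq> 0"
    using f(2) g(2) by (auto simp: X_def poly_eq_0_iff_dvd)
  ultimately show False using ne by (simp add: \<alpha>_def \<beta>_def)
qed

lemma pderiv_eq_0_imp_const:
  fixes v :: "'a::field poly"
  assumes "pderiv v = 0" "\<And>k. 0 < k \<Longrightarrow> k \<le> degree v \<Longrightarrow> of_nat k \<noteq> (0::'a)"
  shows "degree v = 0"
proof (rule ccontr)
  assume "degree v \<noteq> 0"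
  then obtain k where k: "degree v = Suc k" by (cases "degree v") auto
  have "coeff (pderiv v) k = 0" using assms(1) by simp
  then have "of_nat (Suc k) * coeff v (Suc k) = 0" by (simp add: coeff_pderiv)
  then have "coeff v (Suc k) = 0" using assms(2)[of "Suc k"] k by (auto simp del: of_nat_Suc)
  then show False using k by (metis leading_coeff_0_iff degree_0 nat.distinct(1))
qed

text \<open>The orders of \<open>u\<close> and \<open>v\<close> at 0 must agree in the field. Their
  difference is positive and at most \<open>d\<close>, and the positive integers below
  \<open>d\<close> are invertible, so it is \<open>d\<close> itself; this leaves room only for a
  monomial \<open>u\<close>, and then \<open>pderiv v = 0\<close> with \<open>degree v < d\<close>
  makes \<open>v\<close> constant. The third case is the inseparable one.\<close>

lemma wronskian_eq_0_cases:
  fixes u v :: "'a::field poly"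
  assumes w: "wronskian u v = 0" and dvd: "[:0, 1:] ^ s dvd u"
    and deg: "degree u \<le> d" "degree v < s" "s \<le> d"
    and char: "\<And>k. 0 < k \<Longrightarrow> k < d \<Longrightarrow> of_nat k \<noteq> (0::'a)"
  obtains "u = 0" | "v = 0"
    | c b where "c \<noteq> 0" "b \<noteq> 0" "of_nat d = (0::'a)" "u = smult c ([:0, 1:] ^ d)" "v = [:b:]"
proof (cases "u = 0 \<or> v = 0")
  case True
  then show ?thesis using that by blast
next
  case False
  then have nz: "u \<noteq> 0" "v \<noteq> 0" by auto
  have su: "s \<le> order 0 u" using dvd nz order_divides[of 0 s u] by simp
  have ou: "order 0 u \<le> d" using order_degree[OF nz(1), of 0] deg by linarith
  have ov: "order 0 v < s" using order_degree[OF nz(2), of 0] deg by linarith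
  have eq: "of_nat (order 0 u) = (of_nat (order 0 v)::'a)"
    using wronskian_nonzero[OF nz] w by blast
  define k where "k = order 0 u - order 0 v"
  have k: "order 0 u = order 0 v + k" "k > 0" using su ov by (auto simp: k_def)
  have "of_nat k = (0::'a)" using eq unfolding k(1) by simp
  then have "k \<ge> d" using char[of k] k(2) by (meson not_le)
  then have o: "order 0 u = d" "order 0 v = 0" using k ou by auto
  obtain f where f: "u = [:0,1:] ^ d * f" using order_1[of 0 u] o(1) by auto
  have "f \<noteq> 0" using f nz by auto
  then have "degree u = d + degree f" by (simp add: f degree_mult_eq degree_power_eq)
  then have "degree f = 0" using deg by linarith
  then obtain c where c: "f = [:c:]" by (metis degree_eq_zeroE)
  have u: "u = smult c ([:0, 1:] ^ d)" and c0: "c \<noteq> 0" using f c nz by auto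
  have d0: "of_nat d = (0::'a)" using eq o by simp
  have "pderiv u = 0" unfolding u by (simp add: pderiv_smult pderiv_power d0)
  then have "pderiv v = 0" using w nz unfolding wronskian_def by auto
  then have "degree v = 0" using pderiv_eq_0_imp_const[of v] char deg by force
  then obtain b where "v = [:b:]" by (metis degree_eq_zeroE)
  with c0 d0 u nz that(3)[of c b] show ?thesis by auto
qed

text \<open>The bridge from linear algebra to fractions: vanishing coefficients in the positions
  \<open>q\<close> to \<open>q + m\<close> cut \<open>g\<close> into a high part \<open>u\<close>
  and a low part \<open>- v\<close>. Coefficients are used to bound \<open>v\<close> since
  \<open>degree v < q\<close> would fail for \<open>v = 0\<close> and \<open>q = 0\<close>.\<close>

lemma split_gap:
  fixes g :: "'a::field poly"
  assumes gap: "\<And>i. i \<le> m \<Longrightarrow> coeff g (q + i) = 0"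
  obtains u v where "g = u - v" "[:0, 1:] ^ (q + m + 1) dvd u" "degree u \<le> degree g"
    "\<And>i. q \<le> i \<Longrightarrow> coeff v i = 0"
proof -
  define u v where "u = monom 1 (q + m + 1) * poly_shift (q + m + 1) g" and "v = - poly_cutoff q g"
  have "coeff g i = 0" if "\<not> i < q" "\<not> q + m + 1 \<le> i" for i
    using gap[of "i - q"] that by auto
  then have "g = u - v"
    by (auto simp: poly_eq_iff u_def v_def coeff_monom_mult coeff_poly_shift coeff_poly_cutoff)
  moreover have "[:0, 1:] ^ (q + m + 1) dvd u"
    by (simp only: u_def monom_altdef[of 1] smult_1_left dvd_triv_left)
  moreover have "degree u \<le> degree g"
    by (rule degree_le) (auto simp: u_def coeff_monom_mult coeff_poly_shift coeff_eq_0)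
  moreover have "coeff v i = 0" if "q \<le> i" for i
    using that by (auto simp: v_def coeff_poly_cutoff)
  ultimately show ?thesis using that by blast
qed

lemma linear_power_dvd_mult_cancel:
  fixes g h :: "'a::field poly"
  assumes "[:-x, 1:] ^ i dvd g * h" "poly g x \<noteq> 0"
  shows "[:-x, 1:] ^ i dvd h"
proof (cases "h = 0")
  case False
  then have "g * h \<noteq> 0" using assms(2) by auto
  then show ?thesis
    using assms False by (auto simp: order_divides order_mult order_0I)
qed simp

lemma linear_power_mult_dvd:
  fixes g w :: "'a::field poly"
  assumes "[:-x, 1:] ^ i dvd w" "g dvd w" "poly g x \<noteq> 0"
  shows "[:-x, 1:] ^ i * g dvd w"
proof -
  obtain h where h: "w = g * h" using assms(2) by (elim dvdE)
  then have "[:-x, 1:] ^ i dvd h" using linear_power_dvd_mult_cancel assms by blast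
  then show ?thesis unfolding h by (metis mult.commute mult_dvd_mono dvd_refl)
qed

lemma degree_less_if_coeff_0:
  assumes "\<And>i. q \<le> i \<Longrightarrow> coeff v i = 0" "v \<noteq> 0"
  shows "degree v < q"
  using assms by (meson leading_coeff_0_iff not_le)

text \<open>The count for covers with the points \<open>1\<close> and \<open>l\<close> merged into
  one: the Wronskian is divisible by a polynomial of degree \<open>q + m + (e - 1)\<close> but has
  degree at most \<open>e + m + q - 2\<close>. So it vanishes, which the invertibility of the
  integers up to \<open>e + m\<close> excludes. This shows that determinants at degenerate
  parameters do not vanish.\<close>

lemma binomial_gap:
  fixes c :: "'a::field poly"
  assumes char: "\<And>k. 0 < k \<Longrightarrow> k \<le> e + m \<Longrightarrow> of_nat k \<noteq> (0::'a)"
    and "q \<le> e" "degree c \<le> m"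
    and gap: "\<And>i. i \<le> m \<Longrightarrow> coeff ([:-1, 1:] ^ e * c) (q + i) = 0"
  shows "c = 0"
proof (rule ccontr)
  assume c: "c \<noteq> 0"
  define g where "g = [:-1, 1:] ^ e * c"
  have g0: "g \<noteq> 0" using c by (simp add: g_def)
  have dg: "degree g = e + degree c"
    using c by (simp add: g_def degree_mult_eq degree_power_eq)
  obtain u v where uv: "g = u - v" "[:0, 1:] ^ (q + m + 1) dvd u" "degree u \<le> degree g"
    "\<And>i. q \<le> i \<Longrightarrow> coeff v i = 0"
    using split_gap[of m g q] gap unfolding g_def by metis
  have v0: "v \<noteq> 0"
  proof
    assume "v = 0"
    then have "[:0, 1:] ^ (q + m + 1) dvd [:-1, 1:] ^ e * c" using uv g_def by simp
    then have "[:0, 1:] ^ (q + m + 1) dvd c"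
      using linear_power_dvd_mult_cancel[of 0 "q + m + 1" "[:-1, 1:] ^ e" c]
      by (simp add: poly_power del: power_Suc)
    then have "degree ([:0, 1:] ^ (q + m + 1) :: 'a poly) \<le> degree c" using c dvd_imp_degree_le by blast
    then show False using assms by (simp add: degree_power_eq del: power_Suc)
  qed
  have dv: "degree v < q" using degree_less_if_coeff_0 uv v0 by blast
  have u0: "u \<noteq> 0"
  proof
    assume "u = 0"
    then have "degree v = degree g" using uv by simp
    then show False using dg dv assms by simp
  qed
  have w0: "wronskian u v = 0"
  proof (rule ccontr)
    assume w: "wronskian u v \<noteq> 0"
    have 1: "[:-0, 1:] ^ (q + m) dvd wronskian u v"
      using power_dvd_wronskian[OF uv(2), of v] by simp
    have "[:-1, 1:] ^ (e - 1) dvd wronskian (u - v) v"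
      using uv(1) g_def by (intro power_dvd_wronskian) (metis dvd_triv_left)
    then have 2: "[:-1, 1:] ^ (e - 1) dvd wronskian u v" by (simp only: wronskian_diff_left)
    have "[:-0, 1:] ^ (q + m) * [:-1, 1:] ^ (e - 1) dvd wronskian u v"
      using 1 2 by (intro linear_power_mult_dvd) (auto simp: poly_power)
    then have "degree ([:-0, 1:] ^ (q + m) * [:-1, 1:] ^ (e - 1) :: 'a poly) \<le> degree (wronskian u v)"
      using w dvd_imp_degree_le by blast
    then have "q + m + (e - 1) \<le> degree (wronskian u v)"
      by (simp add: degree_mult_eq degree_power_eq)
    then show False using degree_wronskian[OF w] uv(3) dg dv assms(2,3) by linarith
  qed
  \<comment> \<open>The bound \<open>e + m + 1\<close> is one more than \<open>u\<close> can have as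
    degree, so the inseparable case of \<open>wronskian_eq_0_cases\<close> contradicts the degree of
    \<open>u\<close>.\<close>
  have "degree u \<le> e + m + 1" "degree v < q + m + 1" "q + m + 1 \<le> e + m + 1"
    using uv(3) dg dv assms(2,3) by linarith+
  moreover have "of_nat k \<noteq> (0::'a)" if "0 < k" "k < e + m + 1" for k
    using char that by simp
  ultimately obtain a where "a \<noteq> 0" "u = smult a ([:0, 1:] ^ (e + m + 1))"
    using wronskian_eq_0_cases[OF w0 uv(2), of "e + m + 1"] u0 v0 by metis
  then have "degree u = e + m + 1" by (simp add: degree_power_eq del: power_Suc)
  then show False using uv(3) dg assms(3) by linarith
qed

section \<open>Nondegeneracy of the Pade equation\<close>

text \<open>The hypotheses say that \<open>d\<close> is the least positive integer that is zero in
  the field, hence its characteristic.\<close>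

lemma frobenius_linear_power:
  assumes "of_nat d = (0::'a::field)" "0 < d" "\<And>k. 0 < k \<Longrightarrow> k < d \<Longrightarrow> of_nat k \<noteq> (0::'a)"
  shows "[:-1, 1:] ^ d = ([:0, 1:] ^ d - 1 :: 'a poly)"
proof -
  have "CHAR('a) dvd d" using assms(1) by (simp add: of_nat_eq_0_iff_char_dvd)
  then have "0 < CHAR('a)" "CHAR('a) \<le> d" using assms(2) by (auto intro: dvd_imp_le Nat.gr0I)
  then have d: "d = CHAR('a)" using assms(3)[of "CHAR('a)"] by (auto simp: le_less)
  then have "prime d" using prime_CHAR_semidom[where 'a = 'a] assms(2) by simp
  \<comment> \<open>Expanding \<open>x = (x - 1) + 1\<close>, and not \<open>x - 1\<close>, avoids
    the sign \<open>(-1) ^ d\<close> and with it a case distinction for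
    \<open>d = 2\<close>.\<close>
  then have "([:-1, 1:] + 1) ^ d = [:-1, 1:] ^ d + (1 :: 'a poly) ^ d"
    using d by (intro freshmans_dream) auto
  moreover have "[:-1, 1:] + 1 = ([:0, 1:] :: 'a poly)" by (simp add: one_pCons)
  ultimately show ?thesis by simp
qed

text \<open>
  The degree of the covers is \<open>e1 + e2 + m\<close>, and \<open>e3 = q + m + 1\<close>, \<open>e4 = e1 + e2 + m + 1 - q\<close>. The
  parameter \<open>K\<close> only makes the field an argument of the locale predicate.
\<close>

locale pade =
  fixes e1 e2 m q :: nat and K :: "'a::alg_closed_field itself"
  assumes K: "K = TYPE('a)"
    and pos: "0 < e1" "0 < e2" "0 < q" "q < e1 + e2"
    and char: "\<And>k. 0 < k \<Longrightarrow> k < e1 + e2 + m \<Longrightarrow> of_nat k \<noteq> (0::'a)"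
begin

definition F :: "'a \<Rightarrow> 'a poly" where "F l = [:-1, 1:] ^ e1 * [:-l, 1:] ^ e2"

lemma F_nonzero [simp]: "F l \<noteq> 0" by (simp add: F_def)

lemma degree_F: "degree (F l) = e1 + e2"
  by (simp add: F_def degree_mult_eq degree_power_eq)

end

lemma pade_swap: "pade e1 e2 m q (K :: 'a::alg_closed_field itself) \<Longrightarrow> pade e2 e1 m q K"
  by (auto simp: pade_def add.commute)

text \<open>A candidate cover \<open>u / v\<close> in polynomial form. Orders and degrees are only
  bounded, as this is what a kernel vector provides; the equalities are consequences.\<close>

locale pade_solution = pade e1 e2 m q K for e1 e2 m q and K :: "'a::alg_closed_field itself" +
  fixes l :: 'a and c u v :: "'a poly"
  assumes l: "l \<noteq> 0" "l \<noteq> 1"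
    and eq: "F l * c = u - v"
    and dvd_u: "[:0, 1:] ^ (q + m + 1) dvd u"
    and deg_u: "degree u \<le> e1 + e2 + m" and deg_v: "degree v < q"
    and deg_c: "degree c \<le> m" and c_nonzero: "c \<noteq> 0"
begin

lemma v_nonzero: "v \<noteq> 0"
proof
  assume "v = 0"
  then have "[:-0, 1:] ^ (q + m + 1) dvd F l * c" using dvd_u eq by simp
  moreover have "poly (F l) 0 \<noteq> 0" using l by (simp add: F_def poly_power)
  ultimately have "[:-0, 1:] ^ (q + m + 1) dvd c" by (rule linear_power_dvd_mult_cancel)
  then have "degree ([:-0, 1:] ^ (q + m + 1) :: 'a poly) \<le> degree c"
    using c_nonzero dvd_imp_degree_le by blast
  then show False using deg_c by (simp add: degree_power_eq del: power_Suc)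
qed

lemma u_nonzero: "u \<noteq> 0"
proof
  assume "u = 0"
  then have "F l * c = - v" using eq by simp
  then have "degree (F l * c) = degree v" by simp
  then show False using deg_v pos c_nonzero by (simp add: degree_mult_eq degree_F)
qed

lemma s_le: "q + m + 1 \<le> e1 + e2 + m" using pos by simp

text \<open>In the inseparable case \<open>u - v\<close> is \<open>a * x ^ d - b\<close>. Its zeros
  \<open>1\<close> and \<open>l\<close> give \<open>l ^ d = 1\<close>, that is
  \<open>(l - 1) ^ d = 0\<close> by Frobenius, against \<open>l \<noteq> 1\<close>.\<close>

lemma wronskian_uv_nonzero: "wronskian u v \<noteq> 0"
proof
  assume w: "wronskian u v = 0"
  have "degree v < q + m + 1" using deg_v by simp
  from wronskian_eq_0_cases[OF w dvd_u deg_u this s_le char] u_nonzero v_nonzero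
  obtain a b where ab: "a \<noteq> 0" "of_nat (e1 + e2 + m) = (0::'a)"
    "u = smult a ([:0, 1:] ^ (e1 + e2 + m))" "v = [:b:]" by metis
  have "poly (u - v) 1 = 0" "poly (u - v) l = 0"
    using pos by (auto simp flip: eq simp: F_def poly_power)
  then have "a = b" "a * l ^ (e1 + e2 + m) = b" by (auto simp: ab poly_power)
  then have "l ^ (e1 + e2 + m) = 1" using ab by auto
  moreover have "[:-1, 1:] ^ (e1 + e2 + m) = ([:0, 1:] ^ (e1 + e2 + m) - 1 :: 'a poly)"
    using pos char ab(2) by (intro frobenius_linear_power) auto
  then have "poly ([:-1, 1:] ^ (e1 + e2 + m)) l = poly ([:0, 1:] ^ (e1 + e2 + m) - 1) l" by simp
  ultimately have "(l - 1) ^ (e1 + e2 + m) = 0" by (simp add: poly_power)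
  then show False using l by simp
qed

lemma e1_dvd: "[:-1, 1:] ^ e1 dvd u - v" and e2_dvd: "[:-l, 1:] ^ e2 dvd u - v"
  by (auto simp flip: eq simp: F_def)

text \<open>The Riemann-Hurwitz count: the three forced factors have total degree
  \<open>(q + m) + (e1 - 1) + (e2 - 1)\<close>, which equals
  \<open>(e1 + e2 + m) + (q - 1) - 1\<close>, the upper bound from \<open>degree_wronskian\<close>.
  The cofactor is therefore constant.\<close>

lemma wronskian_uv:
  obtains k where "k \<noteq> 0"
    "wronskian u v = smult k ([:0, 1:] ^ (q + m) * ([:-1, 1:] ^ (e1 - 1) * [:-l, 1:] ^ (e2 - 1)))"
proof -
  let ?g = "[:-0, 1:] ^ (q + m) * ([:-1, 1:] ^ (e1 - 1) * [:-l, 1:] ^ (e2 - 1)) :: 'a poly"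
  have "[:-1, 1:] ^ (e1 - 1) dvd wronskian u v" "[:-l, 1:] ^ (e2 - 1) dvd wronskian u v"
    using power_dvd_wronskian[OF e1_dvd, of v] power_dvd_wronskian[OF e2_dvd, of v]
    by (simp_all only: wronskian_diff_left)
  moreover have "[:-0, 1:] ^ (q + m) dvd wronskian u v"
    using power_dvd_wronskian[OF dvd_u, of v] by simp
  ultimately have "?g dvd wronskian u v"
    using l by (intro linear_power_mult_dvd) (auto simp: poly_power)
  then obtain h where h: "wronskian u v = ?g * h" by (elim dvdE)
  then have h0: "h \<noteq> 0" using wronskian_uv_nonzero by auto
  have "degree (wronskian u v) = q + m + (e1 - 1 + (e2 - 1)) + degree h"
    unfolding h using h0 by (simp add: degree_mult_eq degree_power_eq)
  then have "degree h = 0"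
    using degree_wronskian[OF wronskian_uv_nonzero] deg_u deg_v pos by linarith
  then obtain k where "h = [:k:]" by (metis degree_eq_zeroE)
  then show ?thesis using that[of k] h h0 by simp
qed

text \<open>Attaining the bound forces maximal degrees. That of \<open>v\<close> makes the
  ramification index at infinity exactly \<open>e1 + e2 + m + 1 - q\<close>.\<close>

lemma degree_u: "degree u = e1 + e2 + m" and degree_v: "degree v = q - 1"
proof -
  obtain k where k: "k \<noteq> 0"
    "wronskian u v = smult k ([:0, 1:] ^ (q + m) * ([:-1, 1:] ^ (e1 - 1) * [:-l, 1:] ^ (e2 - 1)))"
    using wronskian_uv .
  have "degree (wronskian u v) = q + m + (e1 - 1 + (e2 - 1))"
    unfolding k(2) using k(1) by (simp add: degree_mult_eq degree_power_eq)
  then show "degree u = e1 + e2 + m" "degree v = q - 1"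
    using degree_wronskian[OF wronskian_uv_nonzero] deg_u deg_v pos by linarith+
qed

lemma degree_c: "degree c = m"
proof -
  have "degree (u - v) = e1 + e2 + m"
    using degree_u deg_v pos degree_add_eq_left[of "- v" u] by simp
  then show ?thesis using c_nonzero by (simp flip: eq add: degree_mult_eq degree_F)
qed

text \<open>The exact orders of the Wronskian. Each lemma below in this locale excludes a
  degeneration because it would raise one of them.\<close>

lemma not_dvd_wronskian:
  "\<not> [:0, 1:] ^ (q + m + 1) dvd wronskian u v"
  "\<not> [:-1, 1:] ^ e1 dvd wronskian u v"
  "\<not> [:-l, 1:] ^ e2 dvd wronskian u v"
  "x \<noteq> 0 \<Longrightarrow> x \<noteq> 1 \<Longrightarrow> x \<noteq> l \<Longrightarrow> \<not> [:-x, 1:] dvd wronskian u v"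
proof -
  obtain k where k: "k \<noteq> 0"
    "wronskian u v = smult k ([:0, 1:] ^ (q + m) * ([:-1, 1:] ^ (e1 - 1) * [:-l, 1:] ^ (e2 - 1)))"
    using wronskian_uv .
  have ord: "order x (wronskian u v) = order x ([:-0, 1:] ^ (q + m) :: 'a poly)
     + (order x ([:-1, 1:] ^ (e1 - 1)) + order x ([:-l, 1:] ^ (e2 - 1)))" for x
    unfolding k(2) using k(1) by (simp add: order_smult order_mult)
  have other: "order x ([:-y, 1:] ^ i) = 0" if "x \<noteq> y" for x y :: 'a and i
    using that by (intro order_0I) (simp add: poly_power)
  have "order 0 (wronskian u v) = q + m"
    unfolding ord using l other[of 0 1 "e1 - 1"] other[of 0 l "e2 - 1"] order_power_n_n[of "0::'a"]
    by (auto simp del: minus_zero)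
  then show "\<not> [:0, 1:] ^ (q + m + 1) dvd wronskian u v"
    using wronskian_uv_nonzero order_divides[of 0 "q + m + 1" "wronskian u v"] by simp
  have "order 1 (wronskian u v) = e1 - 1"
    unfolding ord using l other[of 1 0 "q + m"] other[of 1 l "e2 - 1"] order_power_n_n[of "1::'a"]
    by auto
  then show "\<not> [:-1, 1:] ^ e1 dvd wronskian u v"
    using wronskian_uv_nonzero order_divides[of 1 e1 "wronskian u v"] pos by simp
  have "order l (wronskian u v) = e2 - 1"
    unfolding ord using l other[of l 0 "q + m"] other[of l 1 "e1 - 1"] order_power_n_n[of l]
    by auto
  then show "\<not> [:-l, 1:] ^ e2 dvd wronskian u v"
    using wronskian_uv_nonzero order_divides[of l e2 "wronskian u v"] pos by simp
  assume "x \<noteq> 0" "x \<noteq> 1" "x \<noteq> l"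
  then have "order x (wronskian u v) = 0"
    unfolding ord using other[of x 0 "q + m"] other[of x 1 "e1 - 1"] other[of x l "e2 - 1"] by auto
  then show "\<not> [:-x, 1:] dvd wronskian u v"
    using wronskian_uv_nonzero order_divides[of x 1 "wronskian u v"] by simp
qed

lemma order_0_u: "order 0 u = q + m + 1"
proof (rule antisym)
  show "q + m + 1 \<le> order 0 u"
    using dvd_u u_nonzero order_divides[of 0 "q + m + 1" u] by simp
  show "order 0 u \<le> q + m + 1"
  proof (rule ccontr)
    assume "\<not> order 0 u \<le> q + m + 1"
    then have "[:-0, 1:] ^ (q + m + 2) dvd u" using order_divides[of 0 "q + m + 2" u] by simp
    from power_dvd_wronskian[OF this, of v] show False using not_dvd_wronskian(1) by simp
  qed
qed

lemma poly_v_nonzero: "poly v 0 \<noteq> 0" "poly v 1 \<noteq> 0" "poly v l \<noteq> 0"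
proof -
  show "poly v 0 \<noteq> 0"
    using power_dvd_wronskian_common[OF dvd_u, of v] not_dvd_wronskian(1)
    by (auto simp only: poly_eq_0_iff_dvd minus_zero)
  show "poly v 1 \<noteq> 0"
    using power_dvd_wronskian_common[OF e1_dvd, of v] not_dvd_wronskian(2)
    by (auto simp only: poly_eq_0_iff_dvd wronskian_diff_left)
  show "poly v l \<noteq> 0"
    using power_dvd_wronskian_common[OF e2_dvd, of v] not_dvd_wronskian(3)
    by (auto simp only: poly_eq_0_iff_dvd wronskian_diff_left)
qed

lemma poly_c_nonzero: "poly c 1 \<noteq> 0" "poly c l \<noteq> 0"
proof -
  show "poly c 1 \<noteq> 0"
  proof
    assume "poly c 1 = 0"
    then obtain c' where "c = [:-1, 1:] * c'" by (auto simp: poly_eq_0_iff_dvd elim: dvdE)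
    then have "u - v = [:-1, 1:] ^ (e1 + 1) * ([:-l, 1:] ^ e2 * c')" unfolding eq[symmetric] F_def
      by (simp only: power_add power_one_right ac_simps)
    then have "[:-1, 1:] ^ (e1 + 1) dvd u - v" by (metis dvd_triv_left)
    from power_dvd_wronskian[OF this, of v] show False
      using not_dvd_wronskian(2) by (simp add: wronskian_diff_left)
  qed
  show "poly c l \<noteq> 0"
  proof
    assume "poly c l = 0"
    then obtain c' where "c = [:-l, 1:] * c'" by (auto simp: poly_eq_0_iff_dvd elim: dvdE)
    then have "u - v = [:-l, 1:] ^ (e2 + 1) * ([:-1, 1:] ^ e1 * c')" unfolding eq[symmetric] F_def
      by (simp only: power_add power_one_right ac_simps)
    then have "[:-l, 1:] ^ (e2 + 1) dvd u - v" by (metis dvd_triv_left)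
    from power_dvd_wronskian[OF this, of v] show False
      using not_dvd_wronskian(3) by (simp add: wronskian_diff_left)
  qed
qed

lemma no_common_root: "poly u x = 0 \<Longrightarrow> poly v x \<noteq> 0"
proof
  assume "poly u x = 0" "poly v x = 0"
  then have "[:-x, 1:] ^ 1 dvd u" "[:-x, 1:] dvd v" by (auto simp: poly_eq_0_iff_dvd)
  then have "[:-x, 1:] ^ 1 dvd wronskian u v" by (rule power_dvd_wronskian_common)
  then have "[:-x, 1:] dvd wronskian u v" by simp
  then show False using not_dvd_wronskian(4)[of x] poly_v_nonzero \<open>poly v x = 0\<close> by auto
qed

text \<open>Every fibre of \<open>u / v\<close> is cut out by a member of the pencil of
  \<open>u\<close> and \<open>v\<close>, and a double zero of a member is a zero of the
  Wronskian.\<close>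

lemma simple_elsewhere:
  assumes "x \<noteq> 0" "x \<noteq> 1" "x \<noteq> l" "[:-x, 1:] ^ 2 dvd smult a u + smult b v" "a \<noteq> 0 \<or> b \<noteq> 0"
  shows False
proof -
  let ?w = "smult a u + smult b v"
  have "[:-x, 1:] dvd wronskian ?w u" "[:-x, 1:] dvd wronskian ?w v"
    using power_dvd_wronskian[OF assms(4), of u] power_dvd_wronskian[OF assms(4), of v] by auto
  moreover have "wronskian ?w v = smult a (wronskian u v)" "wronskian ?w u = - smult b (wronskian u v)"
    by (simp_all add: wronskian_def pderiv_add pderiv_smult algebra_simps smult_diff_right)
  ultimately show False using not_dvd_wronskian(4)[OF assms(1-3)] assms(5) by (auto simp: dvd_smult_iff)
qed

end

section \<open>Toeplitz determinants\<close>

lemma infinite_UNIV_alg_closed: "infinite (UNIV :: 'a::alg_closed_field set)"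
proof
  assume fin: "finite (UNIV :: 'a set)"
  define p :: "'a poly" where "p = (\<Prod>a\<in>UNIV. [:-a, 1:]) + 1"
  have "degree (\<Prod>a\<in>(UNIV :: 'a set). [:-a, 1:]) = card (UNIV :: 'a set)"
    by (simp add: degree_prod_eq_sum_degree)
  moreover have "card (UNIV :: 'a set) > 0" using fin by (simp add: card_gt_0_iff)
  ultimately have "degree p > 0" unfolding p_def by (subst degree_add_eq_left) auto
  then obtain x where "poly p x = 0" using alg_closed_imp_poly_has_root by blast
  moreover have "poly p x = 1" using fin by (auto simp: p_def poly_prod)
  ultimately show False by simp
qed

lemma poly_eqI_nonzero:
  fixes f g :: "'a::alg_closed_field poly"
  assumes "\<And>x. x \<noteq> 0 \<Longrightarrow> poly f x = poly g x"
  shows "f = g"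
proof (rule ccontr)
  assume "f \<noteq> g"
  then have "finite {x. poly (f - g) x = 0}" by (intro poly_roots_finite) auto
  then have "finite (insert 0 {x. poly (f - g) x = 0})" by simp
  moreover have "UNIV \<subseteq> insert 0 {x. poly (f - g) x = 0}" using assms by auto
  ultimately show False using infinite_UNIV_alg_closed finite_subset by blast
qed

lemma sum_order_eq_degree:
  fixes f :: "'a::alg_closed_field poly"
  assumes "f \<noteq> 0"
  shows "(\<Sum>x | poly f x = 0. order x f) = degree f"
proof -
  obtain A where A: "size A = degree f" "f = smult (lead_coeff f) (\<Prod>x\<in>#A. [:-x, 1:])"
    using alg_closed_imp_factorization[OF assms] by blast
  have "proots (\<Prod>x\<in>#A. [:-x, 1:]) = A" for A :: "'a multiset"
  proof (induction A)
    case (add x A)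
    have "(\<Prod>x\<in>#A. [:-x, 1:]) \<noteq> (0 :: 'a poly)" by (auto simp: prod_mset_zero_iff)
    then have "proots ([:-x, 1:] * (\<Prod>x\<in>#A. [:-x, 1:])) = {#x#} + A"
      using add by (subst proots_mult) auto
    then show ?case by simp
  qed simp
  then have "proots f = A" using A(2) assms by (metis proots_smult leading_coeff_0_iff)
  then have "degree f = size (proots f)" using A by simp
  also have "\<dots> = (\<Sum>x | poly f x = 0. order x f)"
    using assms by (simp add: size_multiset_overloaded_eq)
  finally show ?thesis ..
qed

text \<open>The degree of \<open>f\<close> is its pole order at infinity, which is read off at 0
  after \<open>x\<close> is replaced by \<open>1 / x\<close>. It turns the symmetry of the
  determinant under inversion of \<open>l\<close> into its degree.\<close>

lemma degree_of_reflection: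
  fixes f g :: "'a::alg_closed_field poly"
  assumes "g \<noteq> 0" and eq: "\<And>x. x \<noteq> 0 \<Longrightarrow> x ^ a * poly f x = x ^ b * poly g (1 / x)"
  shows "degree f + a + order 0 g = b"
proof -
  obtain h where h: "g = [:0, 1:] ^ order 0 g * h" "\<not> [:0, 1:] dvd h"
    using order_decomp[OF assms(1), of 0] by auto
  have h0: "poly h 0 \<noteq> 0" using h(2) by (auto simp: poly_eq_0_iff_dvd)
  have "monom 1 (a + order 0 g + degree h) * f = monom 1 b * reflect_poly h"
  proof (rule poly_eqI_nonzero)
    fix x :: 'a assume x: "x \<noteq> 0"
    have g: "poly g (1 / x) = (1 / x) ^ order 0 g * poly h (1 / x)"
      by (subst h(1)) (simp add: poly_power)
    have "x ^ (a + order 0 g + degree h) * poly f x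
        = x ^ order 0 g * x ^ degree h * (x ^ a * poly f x)"
      by (simp add: power_add mult_ac)
    also have "\<dots> = x ^ b * (x ^ degree h * poly h (1 / x)) * (x ^ order 0 g * (1 / x) ^ order 0 g)"
      unfolding eq[OF x] g by (simp only: mult_ac)
    also have "x ^ order 0 g * (1 / x) ^ order 0 g = 1"
      using x by (simp flip: power_mult_distrib)
    finally have "x ^ (a + order 0 g + degree h) * poly f x = x ^ b * (x ^ degree h * poly h (1 / x))"
      by simp
    then show "poly (monom 1 (a + order 0 g + degree h) * f) x = poly (monom 1 b * reflect_poly h) x"
      using x by (simp add: poly_monom poly_reflect_poly_nz inverse_eq_divide)
  qed
  moreover have "reflect_poly h \<noteq> 0" using h0 by auto
  moreover from calculation have "f \<noteq> 0" by auto
  ultimately have "a + order 0 g + degree h + degree f = b + degree h"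
    using h0 by (metis degree_mult_eq degree_monom_eq degree_reflect_poly_eq monom_eq_0_iff
      poly_0_coeff_0 zero_neq_one)
  then show ?thesis by simp
qed

text \<open>The matrix, in the monomial basis, of the map that sends \<open>c\<close> of degree
  below \<open>N\<close> to the coefficients of \<open>f * c\<close> in the positions
  \<open>q\<close> to \<open>q + N - 1\<close>. Multiplying by a monomial avoids the truncated index
  \<open>q + i - j\<close>.\<close>

definition toeplitz :: "nat \<Rightarrow> nat \<Rightarrow> 'b::comm_ring_1 poly \<Rightarrow> 'b mat" where
  "toeplitz q N f = mat N N (\<lambda>(i, j). coeff (monom 1 j * f) (q + i))"

definition coeff_vec :: "nat \<Rightarrow> 'b::comm_ring_1 poly \<Rightarrow> 'b vec" where
  "coeff_vec N c = vec N (coeff c)"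

definition vec_poly :: "'b::comm_ring_1 vec \<Rightarrow> 'b poly" where
  "vec_poly v = (\<Sum>j<dim_vec v. monom (v $ j) j)"

lemma toeplitz_carrier [simp]: "toeplitz q N f \<in> carrier_mat N N"
  by (simp add: toeplitz_def)

lemma toeplitz_index:
  "i < N \<Longrightarrow> j < N \<Longrightarrow> toeplitz q N f $$ (i, j) = (if j \<le> q + i then coeff f (q + i - j) else 0)"
  by (simp add: toeplitz_def coeff_monom_mult)

lemma coeff_vec_carrier [simp]: "coeff_vec N c \<in> carrier_vec N"
  by (simp add: coeff_vec_def)

lemma coeff_vec_poly: "coeff (vec_poly v) i = (if i < dim_vec v then v $ i else 0)"
  by (simp add: vec_poly_def coeff_sum)

lemma coeff_vec_vec_poly [simp]: "v \<in> carrier_vec N \<Longrightarrow> coeff_vec N (vec_poly v) = v"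
  by (auto simp: coeff_vec_def coeff_vec_poly)

lemma degree_vec_poly: "v \<in> carrier_vec (Suc m) \<Longrightarrow> degree (vec_poly v) \<le> m"
  by (intro degree_le) (auto simp: coeff_vec_poly)

lemma toeplitz_mult_coeff_vec:
  assumes "degree c < N"
  shows "toeplitz q N f *\<^sub>v coeff_vec N c = vec N (\<lambda>i. coeff (f * c) (q + i))"
proof (rule eq_vecI)
  fix i assume i: "i < dim_vec (vec N (\<lambda>i. coeff (f * c) (q + i)))"
  have c: "c = (\<Sum>j<N. monom (coeff c j) j)"
    using assms by (auto simp: poly_eq_iff coeff_sum coeff_eq_0)
  have "coeff (f * c) (q + i) = (\<Sum>j<N. coeff (monom 1 j * f) (q + i) * coeff c j)"
    by (subst c) (simp add: sum_distrib_right coeff_sum coeff_monom_mult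
        mult.commute[of f], auto intro!: sum.cong)
  then show "(toeplitz q N f *\<^sub>v coeff_vec N c) $ i = vec N (\<lambda>i. coeff (f * c) (q + i)) $ i"
    using i by (simp add: toeplitz_def coeff_vec_def scalar_prod_def lessThan_atLeast0)
qed (simp add: toeplitz_def)

lemma det_toeplitz_eq_0_iff:
  fixes f :: "'b::idom poly"
  shows "det (toeplitz q (Suc m) f) = 0 \<longleftrightarrow>
    (\<exists>c. c \<noteq> 0 \<and> degree c \<le> m \<and> (\<forall>i\<le>m. coeff (f * c) (q + i) = 0))"
proof
  assume "det (toeplitz q (Suc m) f) = 0"
  then obtain v where v: "v \<in> carrier_vec (Suc m)" "v \<noteq> 0\<^sub>v (Suc m)"
    "toeplitz q (Suc m) f *\<^sub>v v = 0\<^sub>v (Suc m)"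
    using det_0_iff_vec_prod_zero[OF toeplitz_carrier[of q "Suc m" f]] by blast
  define c where "c = vec_poly v"
  have cv: "coeff_vec (Suc m) c = v" and deg: "degree c \<le> m"
    using v by (simp_all add: c_def degree_vec_poly)
  have "vec (Suc m) (\<lambda>i. coeff (f * c) (q + i)) = 0\<^sub>v (Suc m)"
    using v(3) toeplitz_mult_coeff_vec[of c "Suc m" q f] cv deg by simp
  then have "\<forall>i\<le>m. coeff (f * c) (q + i) = 0" by (metis index_vec index_zero_vec(1) less_Suc_eq_le)
  moreover have "c \<noteq> 0" using cv v(2) by (auto simp: coeff_vec_def)
  ultimately show "\<exists>c. c \<noteq> 0 \<and> degree c \<le> m \<and> (\<forall>i\<le>m. coeff (f * c) (q + i) = 0)"
    using deg by blast
next
  assume "\<exists>c. c \<noteq> 0 \<and> degree c \<le> m \<and> (\<forall>i\<le>m. coeff (f * c) (q + i) = 0)"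
  then obtain c where c: "c \<noteq> 0" "degree c \<le> m" "\<forall>i\<le>m. coeff (f * c) (q + i) = 0" by blast
  have "toeplitz q (Suc m) f *\<^sub>v coeff_vec (Suc m) c = 0\<^sub>v (Suc m)"
    using c by (subst toeplitz_mult_coeff_vec) auto
  moreover have "coeff_vec (Suc m) c \<noteq> 0\<^sub>v (Suc m)"
  proof
    assume "coeff_vec (Suc m) c = 0\<^sub>v (Suc m)"
    then have "coeff_vec (Suc m) c $ degree c = 0\<^sub>v (Suc m) $ degree c" by simp
    then show False using c by (simp add: coeff_vec_def)
  qed
  ultimately show "det (toeplitz q (Suc m) f) = 0"
    using det_0_iff_vec_prod_zero[OF toeplitz_carrier[of q "Suc m" f]] coeff_vec_carrier by blast
qed

text \<open>Scaling rows and columns by the diagonal matrix with entries \<open>x ^ i\<close> does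
  not change the determinant: in the Leibniz sum each permutation collects the same power
  \<open>x ^ S\<close> from rows and from columns.\<close>

lemma det_scale:
  fixes A B :: "'b::idom mat"
  assumes A: "A \<in> carrier_mat N N" and B: "B \<in> carrier_mat N N" and "x \<noteq> 0"
    and eq: "\<And>i j. i < N \<Longrightarrow> j < N \<Longrightarrow> x ^ (s + i) * A $$ (i, j) = x ^ (t + j) * B $$ (i, j)"
  shows "x ^ (N * s) * det A = x ^ (N * t) * det B"
proof -
  define S where "S = (\<Sum>i = 0..<N. i)"
  have S: "(\<Prod>i = 0..<N. x ^ (r + i)) = x ^ (N * r) * x ^ S" for r
    by (simp add: S_def flip: power_sum power_add) (simp add: sum.distrib)
  have "x ^ (N * s) * x ^ S * det A
      = (\<Sum>p | p permutes {0..<N}. signof p * (\<Prod>i = 0..<N. x ^ (s + i) * A $$ (i, p i)))"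
    unfolding det_def'[OF A] sum_distrib_left
    by (rule sum.cong) (simp_all add: prod.distrib S mult_ac)
  also have "\<dots> = (\<Sum>p | p permutes {0..<N}. signof p * (\<Prod>i = 0..<N. x ^ (t + p i) * B $$ (i, p i)))"
  proof (rule sum.cong)
    fix p assume "p \<in> {p. p permutes {0..<N}}"
    then have "p i < N" if "i < N" for i using that by (simp add: permutes_nat_less)
    then have "(\<Prod>i = 0..<N. x ^ (s + i) * A $$ (i, p i)) = (\<Prod>i = 0..<N. x ^ (t + p i) * B $$ (i, p i))"
      using eq by (intro prod.cong) auto
    then show "signof p * (\<Prod>i = 0..<N. x ^ (s + i) * A $$ (i, p i)) =
      signof p * (\<Prod>i = 0..<N. x ^ (t + p i) * B $$ (i, p i))" by simp
  qed simp
  also have "\<dots> = x ^ (N * t) * x ^ S * det B"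
    unfolding det_def'[OF B] sum_distrib_left
  proof (rule sum.cong)
    fix p assume "p \<in> {p. p permutes {0..<N}}"
    then have "(\<Prod>i = 0..<N. x ^ (t + p i)) = (\<Prod>i = 0..<N. x ^ (t + i))"
      using prod.permute[of p "{0..<N}" "\<lambda>i. x ^ (t + i)"] by (simp add: comp_def)
    then show "signof p * (\<Prod>i = 0..<N. x ^ (t + p i) * B $$ (i, p i)) =
        x ^ (N * t) * x ^ S * (signof p * (\<Prod>i = 0..<N. B $$ (i, p i)))"
      by (simp add: prod.distrib S mult_ac)
  qed simp
  finally show ?thesis using assms(3) by (simp add: mult.commute mult.left_commute)
qed

text \<open>Replacing the variable of \<open>f\<close> by \<open>x\<close> times itself multiplies
  the coefficient of index \<open>q + i - j\<close> by \<open>x ^ (q + i - j)\<close>, a diagonal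
  scaling up to \<open>x ^ q\<close>.\<close>

lemma det_toeplitz_scale:
  fixes f g :: "'b::idom poly"
  assumes "x \<noteq> 0" "pcompose f [:0, x:] = smult (x ^ a) g"
  shows "x ^ (N * q) * det (toeplitz q N f) = x ^ (N * a) * det (toeplitz q N g)"
proof (rule det_scale[OF toeplitz_carrier toeplitz_carrier assms(1)])
  have k: "x ^ k * coeff f k = x ^ a * coeff g k" for k
    using arg_cong[OF assms(2), of "\<lambda>p. coeff p k"] by (simp add: coeff_pcompose_linear)
  fix i j assume ij: "i < N" "j < N"
  show "x ^ (q + i) * toeplitz q N f $$ (i, j) = x ^ (a + j) * toeplitz q N g $$ (i, j)"
  proof (cases "j \<le> q + i")
    case True
    then have "x ^ (q + i) = x ^ (q + i - j) * x ^ j" by (simp flip: power_add)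
    then show ?thesis
      using True ij k[of "q + i - j"] by (simp add: toeplitz_index power_add mult_ac)
  qed (use ij in \<open>simp add: toeplitz_index\<close>)
qed

section \<open>Specialization of matrices and the order of a determinant\<close>

lemma map_mat_toeplitz:
  assumes "comm_ring_hom h"
  shows "map_mat h (toeplitz q N f) = toeplitz q N (map_poly h f)"
proof -
  interpret comm_ring_hom h by fact
  show ?thesis by (auto simp: toeplitz_def coeff_monom_mult)
qed

lemma map_vec_coeff_vec:
  assumes "comm_ring_hom h"
  shows "map_vec h (coeff_vec N f) = coeff_vec N (map_poly h f)"
proof -
  interpret comm_ring_hom h by fact
  show ?thesis by (auto simp: coeff_vec_def)
qed

lemma comm_ring_hom_poly: "comm_ring_hom (\<lambda>p. poly p x)"
  by unfold_locales auto

text \<open>Cramer's rule with column \<open>j\<close> replaced by \<open>A *\<^sub>v v\<close>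
  gives \<open>v $ j * det A = [:-x, 1:] ^ k * det R\<close>. Here \<open>v $ j\<close> is a unit at
  \<open>x\<close>, and so is \<open>det R\<close>, because at \<open>x\<close> the kernel of
  \<open>A\<close> is spanned by \<open>v\<close> and \<open>w\<close> lies outside the
  image.\<close>

lemma order_det:
  fixes A :: "'b::field poly mat"
  assumes A: "A \<in> carrier_mat N N" and v: "v \<in> carrier_vec N" and w: "w \<in> carrier_vec N"
    and Av: "A *\<^sub>v v = [:-x, 1:] ^ k \<cdot>\<^sub>v w"
    and vx: "map_vec (\<lambda>p. poly p x) v \<noteq> 0\<^sub>v N"
    and kernel: "\<And>c. c \<in> carrier_vec N \<Longrightarrow> map_mat (\<lambda>p. poly p x) A *\<^sub>v c = 0\<^sub>v N \<Longrightarrow>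
      \<exists>a. c = a \<cdot>\<^sub>v map_vec (\<lambda>p. poly p x) v"
    and image: "\<And>c. c \<in> carrier_vec N \<Longrightarrow>
      map_mat (\<lambda>p. poly p x) A *\<^sub>v c \<noteq> map_vec (\<lambda>p. poly p x) w"
  shows "order x (det A) = k"
proof -
  let ?h = "\<lambda>p. poly p x"
  interpret comm_ring_hom ?h by (rule comm_ring_hom_poly)
  obtain j where j: "j < N" "poly (v $ j) x \<noteq> 0"
    using vx v by (auto simp: vec_eq_iff)
  define R where "R = replace_col A w j"
  have R: "R \<in> carrier_mat N N" using A by (simp add: R_def replace_col_def)
  have "v $ j * det A = det (replace_col A ([:-x, 1:] ^ k \<cdot>\<^sub>v w) j)"
    using cramer_lemma_mat[OF A v j(1)] Av by simp
  also have "\<dots> = [:-x, 1:] ^ k * det R"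
  proof -
    have "replace_col A ([:-x, 1:] ^ k \<cdot>\<^sub>v w) j = (multrow j ([:-x, 1:] ^ k) R\<^sup>T)\<^sup>T"
      using A w j by (intro eq_matI) (auto simp: R_def replace_col_def)
    also have "det \<dots> = det (multrow j ([:-x, 1:] ^ k) R\<^sup>T)"
      using R by (intro det_transpose[of _ N]) (auto simp: mat_multrow_def)
    also have "\<dots> = [:-x, 1:] ^ k * det R\<^sup>T" using R j by (intro det_multrow) auto
    also have "det R\<^sup>T = det R" using R by (rule det_transpose)
    finally show ?thesis .
  qed
  finally have det: "v $ j * det A = [:-x, 1:] ^ k * det R" .
  have "poly (det R) x \<noteq> 0"
  proof
    assume "poly (det R) x = 0"
    then have "det (map_mat ?h R) = 0"
      by (simp only: comm_ring_hom.hom_det[OF comm_ring_hom_poly])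
    then obtain c where c: "c \<in> carrier_vec N" "c \<noteq> 0\<^sub>v N" "map_mat ?h R *\<^sub>v c = 0\<^sub>v N"
      using det_0_iff_vec_prod_zero_field[of "map_mat ?h R" N] R by auto
    let ?c = "vec N (\<lambda>i. if i = j then 0 else c $ i)"
    have split: "map_mat ?h A *\<^sub>v ?c + c $ j \<cdot>\<^sub>v map_vec ?h w = 0\<^sub>v N"
    proof (rule eq_vecI)
      fix i assume i: "i < dim_vec (0\<^sub>v N)"
      have "0 = (\<Sum>b\<in>{0..<N}. poly (R $$ (i, b)) x * c $ b)"
        using arg_cong[OF c(3), of "\<lambda>v. vec_index v i"] i R c(1) by (simp add: scalar_prod_def)
      also have "\<dots> = poly (w $ i) x * c $ j + (\<Sum>b\<in>{0..<N} - {j}. poly (R $$ (i, b)) x * c $ b)"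
        using j i A by (subst sum.remove[of _ j]) (auto simp: R_def replace_col_def)
      also have "(\<Sum>b\<in>{0..<N} - {j}. poly (R $$ (i, b)) x * c $ b)
          = (\<Sum>b\<in>{0..<N} - {j}. poly (A $$ (i, b)) x * ?c $ b)"
        using i A by (intro sum.cong) (auto simp: R_def replace_col_def)
      also have "\<dots> = (\<Sum>b\<in>{0..<N}. poly (A $$ (i, b)) x * ?c $ b)"
        using j by (subst sum.remove[of "{0..<N}" j]) auto
      finally show "(map_mat ?h A *\<^sub>v ?c + c $ j \<cdot>\<^sub>v map_vec ?h w) $ i = 0\<^sub>v N $ i"
        using i A w by (simp add: scalar_prod_def mult.commute add.commute)
    qed (use A w in auto)
    \<comment> \<open>If \<open>c $ j = 0\<close>, then \<open>c\<close> is a kernel vector of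
      \<open>A\<close> at \<open>x\<close>, so a multiple of \<open>v\<close>; it is zero as
      \<open>v $ j\<close> does not vanish there. Otherwise dividing by \<open>c $ j\<close>
      exhibits \<open>w\<close> as an image.\<close>
    show False
    proof (cases "c $ j = 0")
      case True
      have "map_mat ?h A *\<^sub>v ?c = 0\<^sub>v N"
        using split True A w by (auto simp: vec_eq_iff)
      then obtain a where a: "?c = a \<cdot>\<^sub>v map_vec ?h v" using kernel[of ?c] by auto
      have "?c $ j = a * poly (v $ j) x" using a j v by (metis carrier_vecD index_map_vec index_smult_vec(1))
      then have "a = 0" using j by simp
      then have "?c = 0\<^sub>v N" using a v by auto
      moreover have "c = ?c" using c(1) True by auto
      ultimately show False using c(2) by metis
    next
      case False
      define b where "b = (- (1 / c $ j)) \<cdot>\<^sub>v ?c"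
      have "(map_mat ?h A *\<^sub>v b) $ i = map_vec ?h w $ i" if "i < N" for i
      proof -
        have "(map_mat ?h A *\<^sub>v ?c) $ i + c $ j * poly (w $ i) x = 0"
          using arg_cong[OF split, of "\<lambda>v. vec_index v i"] that A w by simp
        moreover have "(map_mat ?h A *\<^sub>v b) $ i = - (1 / c $ j) * (map_mat ?h A *\<^sub>v ?c) $ i"
          unfolding b_def using that A by (subst mult_mat_vec[of _ N N]) auto
        ultimately show ?thesis using that w False by (simp add: field_simps add_eq_0_iff)
      qed
      then have "map_mat ?h A *\<^sub>v b = map_vec ?h w" using A w by (intro eq_vecI) auto
      then show False using image[of b] by (simp add: b_def)
    qed
  qed
  then have nz: "det R \<noteq> 0" "order x (det R) = 0" by (auto simp: order_0I)
  then have "v $ j * det A \<noteq> 0" unfolding det by simp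
  then have "order x (v $ j * det A) = order x (v $ j) + order x (det A)" by (rule order_mult)
  moreover have "order x (v $ j) = 0" using j by (intro order_0I)
  moreover have "order x ([:-x, 1:] ^ k * det R) = k"
    using nz by (subst order_mult) (auto simp: order_power_n_n)
  ultimately show ?thesis using det by simp
qed

section \<open>The determinant as a polynomial in the fourth ramification point\<close>

lemma linear_power_expand:
  fixes y t :: "'b::comm_ring_1"
  obtains r where "(y - t) ^ e = y ^ e - of_nat e * t * y ^ (e - 1) + t\<^sup>2 * r"
proof -
  have "\<exists>r. (y - t) ^ e = y ^ e - of_nat e * t * y ^ (e - 1) + t\<^sup>2 * r"
  proof (induction e)
    case (Suc e)
    then obtain r where r: "(y - t) ^ e = y ^ e - of_nat e * t * y ^ (e - 1) + t\<^sup>2 * r" by blast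
    have ye: "of_nat e * (y * y ^ (e - 1)) = of_nat e * y ^ e" by (cases e) auto
    have "(y - t) ^ Suc e = y ^ Suc e - of_nat e * (y * y ^ (e - 1)) * t - t * y ^ e
        + t\<^sup>2 * (of_nat e * y ^ (e - 1) + y * r - t * r)"
      by (simp add: r algebra_simps power2_eq_square)
    also have "\<dots> = y ^ Suc e - of_nat (Suc e) * t * y ^ (Suc e - 1)
        + t\<^sup>2 * (of_nat e * y ^ (e - 1) + y * r - t * r)"
      unfolding ye by (simp add: algebra_simps)
    finally show ?case by blast
  qed (auto intro: exI[of _ 0])
  then show ?thesis using that by blast
qed

text \<open>The homogenized truncation at order \<open>m\<close> of the binomial series of \<open>(1 - t) ^ (- e)\<close>.\<close>

definition truncated_series :: "'b::comm_ring_1 \<Rightarrow> 'b \<Rightarrow> nat \<Rightarrow> nat \<Rightarrow> 'b" where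
  "truncated_series y t e m = (\<Sum>j\<le>m. of_nat ((e + j - 1) choose j) * t ^ j * y ^ (m - j))"

lemma truncated_series_Suc:
  "truncated_series y t e (Suc m) =
     y * truncated_series y t e m + of_nat ((e + m) choose Suc m) * t ^ Suc m"
  by (simp add: truncated_series_def sum_distrib_left Suc_diff_le mult_ac)

text \<open>Multiplying \<open>(1 - t) ^ (- (e + 1))\<close> by \<open>1 - t\<close> lowers the
  exponent by one; the truncation leaves a single boundary term. The induction step is Pascal's
  rule.\<close>

lemma truncated_series_step:
  "(y - t) * truncated_series y t (Suc e) m =
     y * truncated_series y t e m - of_nat ((e + m) choose m) * t ^ Suc m"
proof (induction m)
  case (Suc m)
  have "(y - t) * truncated_series y t (Suc e) (Suc m)
      = y * ((y - t) * truncated_series y t (Suc e) m)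
        + (y - t) * of_nat ((Suc e + m) choose Suc m) * t ^ Suc m"
    by (simp only: truncated_series_Suc) (simp add: algebra_simps)
  also have "\<dots> = y * (y * truncated_series y t e m - of_nat ((e + m) choose m) * t ^ Suc m)
        + (y - t) * (of_nat ((e + m) choose m) + of_nat ((e + m) choose Suc m)) * t ^ Suc m"
    by (simp add: Suc.IH)
  also have "\<dots> = y * truncated_series y t e (Suc m) - of_nat ((e + Suc m) choose Suc m) * t ^ Suc (Suc m)"
    by (simp add: truncated_series_Suc algebra_simps)
  finally show ?case .
qed (simp add: truncated_series_def)

text \<open>The first error term is needed exactly: it is what obstructs a further extension at
  \<open>l = 1\<close>.\<close>

lemma truncated_series_error:
  fixes y t :: "'b::comm_ring_1"
  shows "\<exists>r. (y - t) ^ e * truncated_series y t e m =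
    y ^ (e + m) - of_nat ((e + m) choose Suc m) * t ^ Suc m * y ^ (e - 1) + t ^ Suc (Suc m) * r"
proof (induction e)
  case 0
  have "truncated_series y t 0 m = y ^ m"
    by (simp add: truncated_series_def sum.atMost_shift binomial_eq_0)
  then show ?case by (intro exI[of _ 0]) (simp add: binomial_eq_0)
next
  case (Suc e)
  then obtain r where r: "(y - t) ^ e * truncated_series y t e m =
    y ^ (e + m) - of_nat ((e + m) choose Suc m) * t ^ Suc m * y ^ (e - 1) + t ^ Suc (Suc m) * r" by blast
  obtain r' where r': "(y - t) ^ e = y ^ e - of_nat e * t * y ^ (e - 1) + t\<^sup>2 * r'"
    by (rule linear_power_expand)
  \<comment> \<open>For \<open>e = 0\<close> the exponent \<open>e - 1\<close> is truncated, but
    then the binomial coefficient is 0.\<close>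
  have ye: "of_nat ((e + m) choose Suc m) * (y * y ^ (e - 1)) = of_nat ((e + m) choose Suc m) * y ^ e"
    by (cases e) (auto simp: binomial_eq_0)
  have "(y - t) ^ Suc e * truncated_series y t (Suc e) m
      = (y - t) ^ e * ((y - t) * truncated_series y t (Suc e) m)"
    by (simp only: power_Suc mult_ac)
  also have "\<dots> = y * ((y - t) ^ e * truncated_series y t e m)
      - of_nat ((e + m) choose m) * t ^ Suc m * (y - t) ^ e"
    unfolding truncated_series_step by (simp only: algebra_simps)
  also have "\<dots> = y ^ (Suc e + m) - of_nat ((e + m) choose Suc m) * (y * y ^ (e - 1)) * t ^ Suc m
      - of_nat ((e + m) choose m) * t ^ Suc m * y ^ e
      + t ^ Suc (Suc m) * (y * r + of_nat ((e + m) choose m) * (of_nat e * y ^ (e - 1) - t * r'))"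
    unfolding r unfolding r' by (simp add: algebra_simps power2_eq_square)
  also have "\<dots> = y ^ (Suc e + m) - of_nat ((Suc e + m) choose Suc m) * t ^ Suc m * y ^ (Suc e - 1)
      + t ^ Suc (Suc m) * (y * r + of_nat ((e + m) choose m) * (of_nat e * y ^ (e - 1) - t * r'))"
    unfolding ye by (simp add: algebra_simps)
  finally show ?case by blast
qed

section \<open>Polynomials in \<open>x\<close> with coefficients polynomial in
  \<open>l\<close>\<close>

lemma map_poly_comm_ring_hom_poly: "map_poly_comm_ring_hom (\<lambda>p. poly p x)"
  unfolding map_poly_comm_ring_hom_def by (rule comm_ring_hom_poly)

lemma comm_ring_hom_map_poly_poly: "comm_ring_hom (map_poly (\<lambda>p. poly (p :: 'b::comm_ring_1 poly) x))"
proof -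
  interpret map_poly_comm_ring_hom "\<lambda>p. poly (p :: 'b poly) x" by (rule map_poly_comm_ring_hom_poly)
  show ?thesis by unfold_locales
qed

lemma det_toeplitz_poly:
  "poly (det (toeplitz q N f)) x = det (toeplitz q N (map_poly (\<lambda>p. poly p x) f))"
  using comm_ring_hom.hom_det[OF comm_ring_hom_poly, of x "toeplitz q N f"]
  by (simp add: map_mat_toeplitz[OF comm_ring_hom_poly])

lemma comm_ring_hom_const: "comm_ring_hom (\<lambda>a. [:a:])"
  by unfold_locales (auto simp: one_pCons)

lemma comm_ring_hom_lift: "comm_ring_hom (map_poly (\<lambda>a::'b::comm_ring_1. [:a:]))"
proof -
  interpret map_poly_comm_ring_hom "\<lambda>a::'b. [:a:]"
    unfolding map_poly_comm_ring_hom_def by (rule comm_ring_hom_const)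
  show ?thesis by unfold_locales
qed

abbreviation lift :: "'b::comm_ring_1 poly \<Rightarrow> 'b poly poly" where
  "lift \<equiv> map_poly (\<lambda>a. [:a:])"

lemma coeff_lift: "coeff (lift f) i = [:coeff f i:]"
  by (simp add: coeff_map_poly)

lemma map_poly_lift: "map_poly (\<lambda>p. poly p x) (lift f) = f"
  by (simp add: poly_eq_iff coeff_map_poly)

lemma map_poly_pCons1:
  "map_poly (\<lambda>p. poly p x) [:a, b:] = [:poly a x, poly b x:]"
  by (simp add: poly_eq_iff coeff_map_poly coeff_pCons split: nat.split)

section \<open>The determinant \<open>DD\<close> and its orders at 0 and infinity\<close>

context pade
begin

text \<open>In \<open>FF\<close> and \<open>DD\<close> the variable of the coefficient ring \<open>'a poly\<close> plays the role of \<open>l\<close>.\<close>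

definition FF :: "'a poly poly" where "FF = [:-1, 1:] ^ e1 * [:-[:0, 1:], 1:] ^ e2"

definition DD :: "'a poly" where "DD = det (toeplitz q (Suc m) FF)"

lemma map_FF: "map_poly (\<lambda>p. poly p x) FF = F x"
proof -
  interpret comm_ring_hom "map_poly (\<lambda>p. poly (p :: 'a poly) x)" by (rule comm_ring_hom_map_poly_poly)
  show ?thesis by (simp add: FF_def F_def hom_mult hom_power map_poly_pCons1)
qed

lemma poly_DD: "poly DD x = det (toeplitz q (Suc m) (F x))"
  by (simp add: DD_def det_toeplitz_poly map_FF)

lemma poly_DD_eq_0_iff: "poly DD x = 0 \<longleftrightarrow>
    (\<exists>c. c \<noteq> 0 \<and> degree c \<le> m \<and> (\<forall>i\<le>m. coeff (F x * c) (q + i) = 0))"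
  unfolding poly_DD by (rule det_toeplitz_eq_0_iff)

lemma split_gap_pade:
  fixes g :: "'a poly"
  assumes "degree g \<le> e1 + e2 + m" "\<And>i. i \<le> m \<Longrightarrow> coeff g (q + i) = 0"
  obtains u v where "g = u - v" "[:0, 1:] ^ (q + m + 1) dvd u" "degree u \<le> e1 + e2 + m" "degree v < q"
proof -
  obtain u v where uv: "g = u - v" "[:0, 1:] ^ (q + m + 1) dvd u" "degree u \<le> degree g"
    "\<And>i. q \<le> i \<Longrightarrow> coeff v i = 0"
    using split_gap[of m g q] assms(2) by metis
  have "degree v < q" using degree_less_if_coeff_0[OF uv(4)] pos by (cases "v = 0") auto
  then show ?thesis using that uv assms(1) by force
qed

lemma solutionE:
  assumes "l \<noteq> 0" "l \<noteq> 1" "c \<noteq> 0" "degree c \<le> m" "\<And>i. i \<le> m \<Longrightarrow> coeff (F l * c) (q + i) = 0"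
  obtains u v where "pade_solution e1 e2 m q K l c u v"
proof -
  have "degree (F l * c) \<le> e1 + e2 + m" using degree_mult_le[of "F l" c] degree_F assms(4) by simp
  from split_gap_pade[OF this assms(5)] obtain u v where
    uv: "F l * c = u - v" "[:0, 1:] ^ (q + m + 1) dvd u" "degree u \<le> e1 + e2 + m" "degree v < q" by blast
  then have "pade_solution e1 e2 m q K l c u v"
    using assms by unfold_locales auto
  then show ?thesis using that by blast
qed

text \<open>For \<open>q \<le> e2\<close>, rescaling \<open>x\<close> by \<open>l\<close> splits off
  the power of \<open>l\<close>, and the remaining determinant at 0 belongs to a multiple of
  \<open>(x - 1) ^ e2\<close>. For \<open>q > e2\<close> the factor \<open>x ^ e2\<close> of
  \<open>F 0\<close> shifts the gap to start at \<open>q - e2\<close>. In both cases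
  \<open>binomial_gap\<close> gives nonvanishing; in the second \<open>e2 - q\<close> is 0 by
  truncation.\<close>

lemma order_0_DD: "DD \<noteq> 0" "order 0 DD = Suc m * (e2 - q)"
proof -
  have "DD \<noteq> 0 \<and> order 0 DD = Suc m * (e2 - q)"
  proof (cases "q \<le> e2")
    case True
    \<comment> \<open>This is \<open>FF\<close> at \<open>l * x\<close>, divided by
      \<open>l ^ e2\<close>: the \<open>e2\<close>-point is now at \<open>1\<close>, the
      \<open>e1\<close>-point at \<open>1 / l\<close>, and the latter goes to infinity as
      \<open>l\<close> tends to 0.\<close>
    define G :: "'a poly poly" where "G = [:-1, [:0, 1:]:] ^ e1 * [:-1, 1:] ^ e2"
    have "FF \<circ>\<^sub>p [:0, [:0, 1:]:] = [:-1, [:0, 1:]:] ^ e1 * (smult [:0, 1:] [:-1, 1:]) ^ e2"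
      by (simp add: FF_def pcompose_mult pcompose_hom.hom_power pcompose_pCons)
    also have "\<dots> = smult ([:0, 1:] ^ e2) G"
      by (simp only: G_def smult_power mult_smult_right)
    finally have "[:0, 1:] ^ (Suc m * q) * DD = [:0, 1:] ^ (Suc m * e2) * det (toeplitz q (Suc m) G)"
      unfolding DD_def by (intro det_toeplitz_scale) auto
    moreover have "[:0, 1:] ^ (Suc m * e2) = [:0, 1:] ^ (Suc m * q) * ([:0, 1:] ^ (Suc m * (e2 - q)) :: 'a poly)"
      using True by (simp only: power_add[symmetric] add_mult_distrib2[symmetric] le_add_diff_inverse)
    ultimately have D: "DD = [:0, 1:] ^ (Suc m * (e2 - q)) * det (toeplitz q (Suc m) G)"
      by (simp add: mult.assoc del: power_Suc mult_Suc)
    have "poly (det (toeplitz q (Suc m) G)) 0 \<noteq> 0"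
    proof
      assume z: "poly (det (toeplitz q (Suc m) G)) 0 = 0"
      interpret comm_ring_hom "map_poly (\<lambda>p. poly (p :: 'a poly) 0)" by (rule comm_ring_hom_map_poly_poly)
      have G0: "map_poly (\<lambda>p. poly p 0) G = [:-1:] ^ e1 * [:-1, 1:] ^ e2"
        by (simp add: G_def hom_mult hom_power map_poly_pCons1)
      from z obtain c :: "'a poly" where c: "c \<noteq> 0" "degree c \<le> m"
        "\<forall>i\<le>m. coeff ([:-1:] ^ e1 * [:-1, 1:] ^ e2 * c) (q + i) = 0"
        unfolding det_toeplitz_poly det_toeplitz_eq_0_iff G0 by (elim exE conjE)
      have "[:-1:] ^ e1 * [:-1, 1:] ^ e2 * c = smult ((-1) ^ e1) ([:-1, 1:] ^ e2 * c)"
        by (simp only: poly_const_pow mult_pCons_left mult_zero_left pCons_0_0 add_0_right mult_smult_left)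
      then have "\<And>i. i \<le> m \<Longrightarrow> coeff ([:-1, 1:] ^ e2 * c) (q + i) = 0" using c(3) by auto
      then have "c = 0"
        by (intro binomial_gap[of e2 m q c] char) (use pos True c in linarith)+
      then show False using c by simp
    qed
    then have "det (toeplitz q (Suc m) G) \<noteq> 0" "order 0 (det (toeplitz q (Suc m) G)) = 0"
      by (auto simp: order_0I)
    then show ?thesis
      using order_power_n_n[of "0::'a"] by (simp add: D order_mult del: power_Suc mult_Suc)
  next
    case False
    have "poly DD 0 \<noteq> 0"
    proof
      assume "poly DD 0 = 0"
      then obtain c where c: "c \<noteq> 0" "degree c \<le> m" "\<forall>i\<le>m. coeff (F 0 * c) (q + i) = 0"
        unfolding poly_DD_eq_0_iff by blast
      have "F 0 * c = monom 1 e2 * ([:-1, 1:] ^ e1 * c)"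
        by (simp add: F_def monom_altdef mult_ac)
      then have "coeff ([:-1, 1:] ^ e1 * c) (q - e2 + i) = 0" if "i \<le> m" for i
      proof -
        have "coeff (monom 1 e2 * ([:-1, 1:] ^ e1 * c)) (q + i) = 0"
          using c(3) that \<open>F 0 * c = _\<close> by metis
        moreover have "q + i = e2 + (q - e2 + i)" using False by simp
        ultimately have "coeff (monom 1 e2 * ([:-1, 1:] ^ e1 * c)) (e2 + (q - e2 + i)) = 0" by metis
        then show ?thesis by (simp only: coeff_monom_mult) simp
      qed
      then have "c = 0"
        by (intro binomial_gap[of e1 m "q - e2" c] char) (use pos False c in linarith)+
      then show False using c by simp
    qed
    then show ?thesis using False by (auto simp: order_0I)
  qed
  then show "DD \<noteq> 0" "order 0 DD = Suc m * (e2 - q)" by auto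
qed

text \<open>Rescaling \<open>x\<close> by \<open>l\<close> moves the \<open>e2\<close>-point to
  \<open>1\<close> and the \<open>e1\<close>-point to \<open>1 / l\<close>. So the order at infinity
  is the order at 0 with \<open>e1\<close> and \<open>e2\<close> exchanged.\<close>

lemma DD_swap:
  assumes "l \<noteq> 0"
  shows "l ^ (Suc m * q) * poly DD l = l ^ (Suc m * (e1 + e2)) * poly (pade.DD e2 e1 m q) (1 / l)"
proof -
  interpret swap: pade e2 e1 m q K using pade_swap pade_axioms .
  have "[:-1, 1:] \<circ>\<^sub>p [:0, l:] = smult l [:-(1 / l), 1:]" "[:-l, 1:] \<circ>\<^sub>p [:0, l:] = smult l [:-1, 1:]"
    using assms by (simp_all add: pcompose_pCons)
  then have "F l \<circ>\<^sub>p [:0, l:] = (smult l [:-(1 / l), 1:]) ^ e1 * (smult l [:-1, 1:]) ^ e2"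
    by (simp only: F_def pcompose_mult pcompose_hom.hom_power)
  also have "\<dots> = smult (l ^ (e1 + e2)) (swap.F (1 / l))"
    by (simp only: swap.F_def smult_power mult_smult_left mult_smult_right smult_smult
        power_add mult.commute)
  finally have "F l \<circ>\<^sub>p [:0, l:] = smult (l ^ (e1 + e2)) (swap.F (1 / l))" .
  then show ?thesis
    unfolding poly_DD swap.poly_DD by (intro det_toeplitz_scale assms)
qed

text \<open>The degree of \<open>DD\<close> minus its order at 0. The differences
  \<open>e1 - q\<close> and \<open>e2 - q\<close> truncate at 0 on purpose. No field occurs, so the
  number is the same in every characteristic.\<close>

definition ncrit :: nat where
  "ncrit = Suc m * (e1 + e2) - Suc m * q - Suc m * (e1 - q) - Suc m * (e2 - q)"

lemma sum_order_nonzero: "(\<Sum>x | x \<noteq> 0 \<and> poly DD x = 0. order x DD) = ncrit"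
proof -
  interpret swap: pade e2 e1 m q K using pade_swap pade_axioms .
  have fin: "finite {x. poly DD x = 0}" using order_0_DD(1) by (rule poly_roots_finite)
  have "degree DD + Suc m * q + order 0 swap.DD = Suc m * (e1 + e2)"
    using swap.order_0_DD(1) DD_swap by (intro degree_of_reflection)
  then have "degree DD + Suc m * q + Suc m * (e1 - q) = Suc m * (e1 + e2)"
    unfolding swap.order_0_DD(2) .
  moreover have "degree DD = order 0 DD + (\<Sum>x | x \<noteq> 0 \<and> poly DD x = 0. order x DD)"
  proof (cases "poly DD 0 = 0")
    case True
    then have "{x. poly DD x = 0} = insert 0 {x. x \<noteq> 0 \<and> poly DD x = 0}" by auto
    then show ?thesis using fin sum_order_eq_degree[OF order_0_DD(1)] by simp
  next
    case False
    then have "{x. poly DD x = 0} = {x. x \<noteq> 0 \<and> poly DD x = 0}" by auto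
    then show ?thesis using sum_order_eq_degree[OF order_0_DD(1)] False by (simp add: order_0I)
  qed
  ultimately show ?thesis unfolding ncrit_def order_0_DD(2) by linarith
qed

end

lemma of_nat_choose_nonzero:
  assumes "\<And>k. 0 < k \<Longrightarrow> k \<le> n \<Longrightarrow> of_nat k \<noteq> (0::'a::field)" "k \<le> n"
  shows "of_nat (n choose k) \<noteq> (0::'a)"
proof -
  have "of_nat (fact n) \<noteq> (0::'a)"
    using assms(1)
  proof (induction n)
    case (Suc n)
    then have "of_nat (fact n) \<noteq> (0::'a)" "of_nat (Suc n) \<noteq> (0::'a)" by (blast intro: le_SucI)+
    then show ?case by (simp only: fact_Suc of_nat_mult of_nat_id mult_eq_0_iff not_False_eq_True simp_thms)
  qed simp
  moreover have "fact k * fact (n - k) * (n choose k) = (fact n :: nat)"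
    using assms(2) by (rule binomial_fact_lemma)
  ultimately show ?thesis by (metis mult_zero_right of_nat_mult)
qed

section \<open>Orders of \<open>DD\<close> at nonzero parameters\<close>

context pade
begin

text \<open>Polynomial form of \<open>order_det\<close>: \<open>V\<close> is a family of approximate
  solutions near the parameter \<open>x\<close>, and \<open>W\<close> is the leading part of its
  defect.\<close>

lemma order_DD_eqI:
  fixes V W :: "'a poly poly"
  assumes V: "degree V \<le> m"
    and FV: "\<And>i. i \<le> m \<Longrightarrow> coeff (FF * V) (q + i) = [:-x, 1:] ^ k * coeff W (q + i)"
    and Vx: "map_poly (\<lambda>p. poly p x) V \<noteq> 0"
    and kernel: "\<And>c. degree c \<le> m \<Longrightarrow> (\<And>i. i \<le> m \<Longrightarrow> coeff (F x * c) (q + i) = 0) \<Longrightarrow>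
      \<exists>a. c = smult a (map_poly (\<lambda>p. poly p x) V)"
    and image: "\<And>c. degree c \<le> m \<Longrightarrow>
      (\<And>i. i \<le> m \<Longrightarrow> coeff (F x * c) (q + i) = coeff (map_poly (\<lambda>p. poly p x) W) (q + i)) \<Longrightarrow> False"
  shows "order x DD = k"
  unfolding DD_def
proof (rule order_det)
  let ?h = "\<lambda>p. poly p x"
  let ?V = "map_poly ?h V"
  have degV: "degree ?V \<le> m" using V degree_map_poly_le[of ?h V] by linarith
  have hV: "map_vec ?h (coeff_vec (Suc m) V) = coeff_vec (Suc m) ?V"
    by (rule map_vec_coeff_vec[OF comm_ring_hom_poly])
  have hF: "map_mat ?h (toeplitz q (Suc m) FF) = toeplitz q (Suc m) (F x)"
    by (simp only: map_mat_toeplitz[OF comm_ring_hom_poly] map_FF)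
  have mult: "toeplitz q (Suc m) (F x) *\<^sub>v c = vec (Suc m) (\<lambda>i. coeff (F x * vec_poly c) (q + i))"
    if "c \<in> carrier_vec (Suc m)" for c
    using toeplitz_mult_coeff_vec[of "vec_poly c" "Suc m" q "F x"] that degree_vec_poly[OF that] by simp
  show "toeplitz q (Suc m) FF \<in> carrier_mat (Suc m) (Suc m)" by simp
  show "coeff_vec (Suc m) V \<in> carrier_vec (Suc m)" by simp
  show "vec (Suc m) (\<lambda>i. coeff W (q + i)) \<in> carrier_vec (Suc m)" by simp
  show "toeplitz q (Suc m) FF *\<^sub>v coeff_vec (Suc m) V
      = [:-x, 1:] ^ k \<cdot>\<^sub>v vec (Suc m) (\<lambda>i. coeff W (q + i))"
    using V FV by (subst toeplitz_mult_coeff_vec) auto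
  show "map_vec ?h (coeff_vec (Suc m) V) \<noteq> 0\<^sub>v (Suc m)"
  proof
    assume "map_vec ?h (coeff_vec (Suc m) V) = 0\<^sub>v (Suc m)"
    then have "coeff_vec (Suc m) ?V $ degree ?V = 0\<^sub>v (Suc m) $ degree ?V" unfolding hV by simp
    then have "coeff ?V (degree ?V) = 0" using degV by (simp add: coeff_vec_def)
    then show False using Vx leading_coeff_0_iff by blast
  qed
  fix c :: "'a vec" assume c: "c \<in> carrier_vec (Suc m)"
  show "\<exists>a. c = a \<cdot>\<^sub>v map_vec ?h (coeff_vec (Suc m) V)"
    if "map_mat ?h (toeplitz q (Suc m) FF) *\<^sub>v c = 0\<^sub>v (Suc m)"
  proof -
    have "coeff (F x * vec_poly c) (q + i) = 0" if "i \<le> m" for i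
      using \<open>_ = 0\<^sub>v (Suc m)\<close> that unfolding hF mult[OF c]
      by (metis index_vec index_zero_vec(1) less_Suc_eq_le)
    then obtain a where a: "vec_poly c = smult a ?V"
      using kernel degree_vec_poly[OF c] by blast
    have "c = coeff_vec (Suc m) (vec_poly c)" using c by simp
    also have "\<dots> = a \<cdot>\<^sub>v coeff_vec (Suc m) ?V" unfolding a by (auto simp: coeff_vec_def)
    finally show ?thesis unfolding hV by blast
  qed
  show "map_mat ?h (toeplitz q (Suc m) FF) *\<^sub>v c \<noteq> map_vec ?h (vec (Suc m) (\<lambda>i. coeff W (q + i)))"
  proof
    assume eq: "map_mat ?h (toeplitz q (Suc m) FF) *\<^sub>v c = map_vec ?h (vec (Suc m) (\<lambda>i. coeff W (q + i)))"
    have "coeff (F x * vec_poly c) (q + i) = coeff (map_poly ?h W) (q + i)" if "i \<le> m" for i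
    proof -
      have "vec (Suc m) (\<lambda>i. coeff (F x * vec_poly c) (q + i)) $ i
          = map_vec ?h (vec (Suc m) (\<lambda>i. coeff W (q + i))) $ i"
        using eq unfolding hF mult[OF c] by simp
      then show ?thesis using that by (simp add: coeff_map_poly)
    qed
    then show False using image degree_vec_poly[OF c] by blast
  qed
qed

text \<open>Every nonzero solution has degree exactly \<open>m\<close>, by \<open>degree_c\<close>;
  cancelling the leading coefficients of two solutions therefore leaves 0.\<close>

lemma kernel_unique:
  assumes l: "l \<noteq> 0" "l \<noteq> 1"
    and c: "c \<noteq> 0" "degree c \<le> m" "\<And>i. i \<le> m \<Longrightarrow> coeff (F l * c) (q + i) = 0"
    and c': "degree c' \<le> m" "\<And>i. i \<le> m \<Longrightarrow> coeff (F l * c') (q + i) = 0"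
  shows "\<exists>a. c' = smult a c"
proof -
  have deg: "degree b = m"
    if b: "b \<noteq> 0" "degree b \<le> m" "\<And>i. i \<le> m \<Longrightarrow> coeff (F l * b) (q + i) = 0" for b
  proof -
    obtain u v where "pade_solution e1 e2 m q K l b u v" by (rule solutionE[OF l b])
    then show ?thesis by (rule pade_solution.degree_c)
  qed
  define a where "a = coeff c' m / coeff c m"
  define b where "b = c' - smult a c"
  have cm: "coeff c m \<noteq> 0" using deg[OF c] c(1) by (metis leading_coeff_0_iff)
  have "coeff (F l * b) (q + i) = 0" if "i \<le> m" for i
    using c(3)[OF that] c'(2)[OF that] by (simp add: b_def right_diff_distrib)
  moreover have "degree b \<le> m"
    unfolding b_def by (intro degree_diff_le c'(1) order_trans[OF degree_smult_le c(2)])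
  moreover have "coeff b m = 0" using cm by (simp add: b_def a_def)
  ultimately have "b = 0" using deg[of b] by (metis leading_coeff_0_iff)
  then show ?thesis by (auto simp: b_def)
qed

text \<open>
  The right-hand side comes from the derivative of \<open>F l\<close> with respect to \<open>l\<close>, so \<open>c'\<close> would give a
  cover over the dual numbers in which \<open>l\<close> moves while the branch points stay fixed.
\<close>

lemma deformation_obstructed:
  assumes l: "l \<noteq> 0" "l \<noteq> 1"
    and c: "c \<noteq> 0" "degree c \<le> m" "\<And>i. i \<le> m \<Longrightarrow> coeff (F l * c) (q + i) = 0"
    and c': "degree c' \<le> m" "\<And>i. i \<le> m \<Longrightarrow> coeff (F l * c') (q + i)
        = coeff ([:-1, 1:] ^ e1 * (- of_nat e2 * [:-l, 1:] ^ (e2 - 1)) * c) (q + i)"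
  shows False
proof -
  obtain u v where "pade_solution e1 e2 m q K l c u v" by (rule solutionE[OF l c])
  then interpret pade_solution e1 e2 m q K l c u v .
  define P where "P = [:-1, 1:] ^ e1 * [:-l, 1:] ^ (e2 - 1)"
  have FP: "F l = P * [:-l, 1:]"
    using power_minus_mult[OF pos(2), of "[:-l, 1:]"] by (simp only: F_def P_def mult.assoc)
  have P0: "P \<noteq> 0" and degP: "degree P = e1 + (e2 - 1)"
    by (simp_all add: P_def degree_mult_eq degree_power_eq)
  \<comment> \<open>Over the dual numbers, \<open>P * b\<close> is the first order term of
    \<open>F (l + \<epsilon>) * (c - \<epsilon> * c')\<close>. It has the same gap, so it splits as
    \<open>u' - v'\<close>.\<close>
  define b where "b = - of_nat e2 * c - [:-l, 1:] * c'"
  have "degree (of_nat e2 * c) \<le> m"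
    using degree_mult_le[of "of_nat e2" c] c(2) by simp
  moreover have "degree ([:-l, 1:] * c') \<le> Suc m" using degree_mult_le[of "[:-l, 1:]" c'] c'(1) by simp
  ultimately have "degree b \<le> Suc m" unfolding b_def by (intro degree_diff_le) auto
  then have "degree (P * b) \<le> e1 + e2 + m" using degree_mult_le[of P b] degP pos by linarith
  moreover have "P * b = [:-1, 1:] ^ e1 * (- of_nat e2 * [:-l, 1:] ^ (e2 - 1)) * c - F l * c'"
    unfolding b_def FP unfolding P_def by (simp only: algebra_simps)
  then have "coeff (P * b) (q + i) = 0" if "i \<le> m" for i
    using c'(2)[OF that] by simp
  ultimately obtain u' v' where uv': "P * b = u' - v'" "[:0, 1:] ^ (q + m + 1) dvd u'"
    "degree u' \<le> e1 + e2 + m" "degree v' < q" using split_gap_pade by blast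
  \<comment> \<open>The numerator of the derivative of \<open>u / v\<close> along the deformation.
    It is divisible by \<open>x ^ (q + m + 1) * P\<close>, of degree \<open>e1 + e2 + m + q\<close>,
    one more than its degree allows.\<close>
  define N where "N = u' * v - u * v'"
  have N: "N = P * (b * v - [:-l, 1:] * c * v')"
  proof -
    have "N = (u' - v') * v - (u - v) * v'" by (simp add: N_def algebra_simps)
    also have "\<dots> = P * b * v - P * [:-l, 1:] * c * v'" by (simp only: uv'(1) eq[symmetric] FP)
    finally show ?thesis by (simp only: algebra_simps)
  qed
  have "N = 0"
  proof (rule ccontr)
    assume N0: "N \<noteq> 0"
    have "[:-0, 1:] ^ (q + m + 1) dvd N" using uv'(2) dvd_u by (simp add: N_def)
    then have "[:-0, 1:] ^ (q + m + 1) * P dvd N"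
      using l N by (intro linear_power_mult_dvd) (auto simp: P_def poly_power)
    then have "degree ([:-0, 1:] ^ (q + m + 1) * P) \<le> degree N" using N0 by (rule dvd_imp_degree_le)
    then have "q + m + 1 + (e1 + (e2 - 1)) \<le> degree N"
      using P0 degP by (simp add: degree_mult_eq degree_power_eq del: power_Suc)
    moreover have "degree N \<le> e1 + e2 + m + (q - 1)"
      unfolding N_def using deg_u deg_v uv' degree_mult_le[of u' v] degree_mult_le[of u v']
      by (intro degree_diff_le) auto
    ultimately show False using pos by linarith
  qed
  \<comment> \<open>At \<open>l\<close> only the term \<open>- of_nat e2 * c\<close> of
    \<open>b\<close> survives, so a product of nonzero values would vanish.\<close>
  then have "b * v = [:-l, 1:] * c * v'" using N P0 by simp
  then have "poly (b * v) l = poly ([:-l, 1:] * c * v') l" by (rule arg_cong)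
  then have "of_nat e2 * (poly c l * poly v l) = 0" by (simp add: b_def)
  then show False using poly_c_nonzero poly_v_nonzero char[of e2] pos by simp
qed

text \<open>The family that is constantly \<open>c\<close> solves the equations up to first order,
  and \<open>deformation_obstructed\<close> says that its defect is not in the image.\<close>

lemma order_DD_simple:
  assumes l: "l \<noteq> 0" "l \<noteq> 1" and root: "poly DD l = 0"
  shows "order l DD = 1"
proof -
  obtain c where c: "c \<noteq> 0" "degree c \<le> m" "\<forall>i\<le>m. coeff (F l * c) (q + i) = 0"
    using root unfolding poly_DD_eq_0_iff by blast
  \<comment> \<open>\<open>T\<close> is the increment of the variable parameter over the fixed root
    \<open>l\<close>, so the linear factor of \<open>FF\<close> that moves is
    \<open>Z - T\<close>.\<close>
  define Y Z T :: "'a poly poly" where "Y = [:-1, 1:]" and "Z = [:-[:l:], 1:]" and "T = [:[:-l, 1:]:]"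
  obtain R where R: "(Z - T) ^ e2 = Z ^ e2 - of_nat e2 * T * Z ^ (e2 - 1) + T\<^sup>2 * R"
    by (rule linear_power_expand)
  define W where "W = Y ^ e1 * (- of_nat e2 * Z ^ (e2 - 1) + T * R) * lift c"
  interpret ev: comm_ring_hom "map_poly (\<lambda>p. poly (p :: 'a poly) l)" by (rule comm_ring_hom_map_poly_poly)
  interpret li: comm_ring_hom "map_poly (\<lambda>a::'a. [:a:])" by (rule comm_ring_hom_lift)
  have lin: "lift [:-1, 1:] = Y" "lift [:-l, 1:] = Z"
    by (simp_all add: Y_def Z_def poly_eq_iff coeff_lift coeff_pCons one_pCons split: nat.splits)
  have "FF = Y ^ e1 * (Z - T) ^ e2" by (simp add: FF_def Y_def Z_def T_def)
  then have "FF * lift c = Y ^ e1 * (Z - T) ^ e2 * lift c" by (simp only:)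
  also have "\<dots> = lift (F l * c) + T * W"
    unfolding R W_def F_def li.hom_mult li.hom_power lin by (simp add: algebra_simps power2_eq_square)
  finally have "FF * lift c = lift (F l * c) + T * W" .
  then have FV: "coeff (FF * lift c) (q + i) = [:-l, 1:] ^ 1 * coeff W (q + i)" if "i \<le> m" for i
    using c(3) that by (simp add: coeff_lift T_def)
  have W: "map_poly (\<lambda>p. poly p l) W = [:-1, 1:] ^ e1 * (- of_nat e2 * [:-l, 1:] ^ (e2 - 1)) * c"
  proof -
    have "map_poly (\<lambda>p. poly p l) Y = [:-1, 1:]" "map_poly (\<lambda>p. poly p l) Z = [:-l, 1:]"
      "map_poly (\<lambda>p. poly p l) T = 0"
      by (simp_all add: Y_def Z_def T_def map_poly_pCons1 poly_eq_iff coeff_map_poly coeff_pCons split: nat.splits)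
    then show ?thesis
      by (simp only: W_def ev.hom_mult ev.hom_power ev.hom_add ev.hom_uminus ev.hom_of_nat
          map_poly_lift mult_zero_left add_0_right)
  qed
  show ?thesis
  proof (rule order_DD_eqI[OF _ FV])
    show "degree (lift c) \<le> m" using c(2) degree_map_poly_le[of "\<lambda>a. [:a:]" c] by linarith
    show "map_poly (\<lambda>p. poly p l) (lift c) \<noteq> 0" using c(1) by (simp add: map_poly_lift)
    fix c' :: "'a poly" assume c': "degree c' \<le> m"
    show "\<exists>a. c' = smult a (map_poly (\<lambda>p. poly p l) (lift c))"
      if "\<And>i. i \<le> m \<Longrightarrow> coeff (F l * c') (q + i) = 0"
      using kernel_unique[OF l _ _ _ c' that] c by (simp add: map_poly_lift)
    show False
      if "\<And>i. i \<le> m \<Longrightarrow> coeff (F l * c') (q + i) = coeff (map_poly (\<lambda>p. poly p l) W) (q + i)"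
      using deformation_obstructed[OF l _ _ _ c'] c that unfolding W by blast
  qed
qed

lemma F_1: "F 1 = [:-1, 1:] ^ (e1 + e2)"
  by (simp add: F_def power_add)

lemma poly_DD_1_nonzero:
  assumes "of_nat (e1 + e2 + m) \<noteq> (0::'a)"
  shows "poly DD 1 \<noteq> 0"
proof
  assume "poly DD 1 = 0"
  then obtain c where c: "c \<noteq> 0" "degree c \<le> m" "\<And>i. i \<le> m \<Longrightarrow> coeff (F 1 * c) (q + i) = 0"
    unfolding poly_DD_eq_0_iff by blast
  have "of_nat k \<noteq> (0::'a)" if "0 < k" "k \<le> e1 + e2 + m" for k
    using assms char that by (cases "k = e1 + e2 + m") auto
  then have "c = 0"
    using pos c(2) c(3)[unfolded F_1] by (intro binomial_gap[of "e1 + e2" m q c]) auto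
  then show False using c by simp
qed

text \<open>At \<open>l = 1\<close> the kernel is spanned by \<open>(x - 1) ^ m\<close>, from the
  inseparable solution \<open>(x - 1) ^ d = x ^ d - 1\<close>. Truncating
  \<open>y ^ m * (1 - t / y) ^ (- e2)\<close> makes the product with \<open>FF\<close> independent
  of \<open>t = l - 1\<close> up to order \<open>m\<close>; the defect at order \<open>m + 1\<close>
  is a nonzero multiple of \<open>y ^ (n - 1)\<close> and is not in the image.\<close>

lemma order_DD_1:
  assumes d0: "of_nat (e1 + e2 + m) = (0::'a)"
  shows "order 1 DD = Suc m" "poly DD 1 = 0"
proof -
  define n where "n = e1 + e2"
  define y :: "'a poly" where "y = [:-1, 1:]"
  have n: "q \<le> n - 1" "0 < n" "F 1 = y ^ n" using pos by (auto simp: n_def F_1 y_def)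
  have frob: "y ^ (n + m) = [:0, 1:] ^ (n + m) - 1"
    unfolding y_def using d0 char pos by (intro frobenius_linear_power) (auto simp: n_def)
  have frob_gap: "coeff (y ^ (n + m)) (q + i) = 0" if "i \<le> m" for i
  proof -
    have "[:0, 1:] ^ (n + m) = (monom 1 (n + m) :: 'a poly)" by (simp only: monom_altdef smult_1_left)
    then show ?thesis unfolding frob using that n pos by simp
  qed
  \<comment> \<open>With exponent \<open>n - 1\<close> in place of \<open>n\<close>, only integers
    up to \<open>d - 1\<close> have to be invertible, so \<open>binomial_gap\<close> applies
    although \<open>d\<close> is zero in the field.\<close>
  have gap: "b = 0" if "degree b \<le> m" "\<And>i. i \<le> m \<Longrightarrow> coeff (y ^ (n - 1) * b) (q + i) = 0" for b
    using that n(1,2) char unfolding y_def n_def by (intro binomial_gap[of "e1 + e2 - 1" m q b]) auto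
  define B :: 'a where "B = of_nat ((e2 + m) choose Suc m)"
  have B0: "B \<noteq> 0" unfolding B_def using pos char by (intro of_nat_choose_nonzero) auto
  define Y T :: "'a poly poly" where "Y = [:-1, 1:]" and "T = [:[:-1, 1:]:]"
  define V where "V = truncated_series Y T e2 m"
  obtain R where R: "(Y - T) ^ e2 * V
      = Y ^ (e2 + m) - of_nat ((e2 + m) choose Suc m) * T ^ Suc m * Y ^ (e2 - 1) + T ^ Suc (Suc m) * R"
    unfolding V_def using truncated_series_error by blast
  define W where "W = Y ^ e1 * (- of_nat ((e2 + m) choose Suc m) * Y ^ (e2 - 1) + T * R)"
  interpret ev: comm_ring_hom "map_poly (\<lambda>p. poly (p :: 'a poly) 1)" by (rule comm_ring_hom_map_poly_poly)
  interpret li: comm_ring_hom "map_poly (\<lambda>a::'a. [:a:])" by (rule comm_ring_hom_lift)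
  have lin: "lift y = Y"
    by (simp add: Y_def y_def poly_eq_iff coeff_lift coeff_pCons one_pCons split: nat.splits)
  have "FF = Y ^ e1 * (Y - T) ^ e2" by (simp add: FF_def Y_def T_def one_pCons)
  then have "FF * V = Y ^ e1 * ((Y - T) ^ e2 * V)" by (simp only: mult.assoc)
  also have "\<dots> = lift (y ^ (n + m)) + T ^ Suc m * W"
    unfolding R W_def li.hom_power lin n_def by (simp add: algebra_simps power_add)
  finally have FV: "coeff (FF * V) (q + i) = [:-1, 1:] ^ Suc m * coeff W (q + i)" if "i \<le> m" for i
    using frob_gap[OF that] by (simp add: coeff_lift T_def poly_const_pow del: power_Suc)
  have evY: "map_poly (\<lambda>p. poly p 1) Y = y" and evT: "map_poly (\<lambda>p. poly p 1) T = 0"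
    by (simp_all add: Y_def T_def y_def map_poly_pCons1 poly_eq_iff coeff_map_poly coeff_pCons split: nat.splits)
  have V1: "map_poly (\<lambda>p. poly p 1) V = y ^ m"
    unfolding V_def truncated_series_def ev.hom_sum ev.hom_mult ev.hom_power evY evT ev.hom_of_nat
    by (simp add: sum.atMost_shift)
  have W1: "map_poly (\<lambda>p. poly p 1) W = - smult B (y ^ (n - 1))"
  proof -
    have "map_poly (\<lambda>p. poly p 1) W = y ^ e1 * (- of_nat ((e2 + m) choose Suc m) * y ^ (e2 - 1))"
      by (simp only: W_def ev.hom_mult ev.hom_power ev.hom_add ev.hom_uminus ev.hom_of_nat evY evT
          mult_zero_left add_0_right)
    also have "\<dots> = - smult B (y ^ e1 * y ^ (e2 - 1))" by (simp add: B_def of_nat_poly)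
    also have "y ^ e1 * y ^ (e2 - 1) = y ^ (n - 1)"
      using pos by (simp add: n_def flip: power_add)
    finally show ?thesis .
  qed
  have ypow: "y ^ n = y ^ (n - 1) * y" using n by (simp flip: power_Suc2)
  have degy: "degree (y ^ k) = k" for k by (simp add: y_def degree_power_eq)
  have ycoeff: "coeff (y ^ k) k = 1" for k
    using lead_coeff_power[of y k] degy[of k] by (simp add: y_def)
  have ydeg: "degree (y * b) \<le> m" if "\<And>k. k \<ge> m \<Longrightarrow> coeff b k = 0" for b
  proof (cases "b = 0")
    case False
    then have "degree b < m" using degree_less_if_coeff_0[OF that] by blast
    then show ?thesis using degree_mult_le[of y b] degy[of 1] by simp
  qed simp
  show order: "order 1 DD = Suc m"
  proof (rule order_DD_eqI[OF _ FV])
    have "degree (of_nat k * T ^ j * Y ^ (m - j)) \<le> m" for j k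
    proof -
      have "of_nat k * T ^ j = [:of_nat k * [:-1, 1:] ^ j:]" by (simp add: T_def poly_const_pow of_nat_poly)
      then have "degree (of_nat k * T ^ j) = 0" by simp
      moreover have "degree (Y ^ (m - j)) \<le> m - j" using degree_power_le[of Y "m - j"] by (simp add: Y_def)
      ultimately show ?thesis using degree_mult_le[of "of_nat k * T ^ j" "Y ^ (m - j)"] by linarith
    qed
    then show "degree V \<le> m" unfolding V_def truncated_series_def by (intro degree_sum_le) auto
    show "map_poly (\<lambda>p. poly p 1) V \<noteq> 0" by (simp add: V1 y_def)
    fix c :: "'a poly" assume c: "degree c \<le> m"
    show "\<exists>a. c = smult a (map_poly (\<lambda>p. poly p 1) V)"
      if g: "\<And>i. i \<le> m \<Longrightarrow> coeff (F 1 * c) (q + i) = 0"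
    proof -
      define b where "b = c - smult (coeff c m) (y ^ m)"
      have "coeff b k = 0" if "k \<ge> m" for k
        using that c degy[of m] ycoeff[of m] by (cases "k = m") (auto simp: b_def coeff_eq_0)
      then have "degree (y * b) \<le> m" by (rule ydeg)
      moreover have "y ^ (n - 1) * (y * b) = F 1 * c - smult (coeff c m) (y ^ (n + m))"
        by (simp add: b_def n(3) ypow power_add algebra_simps smult_diff_right)
      then have "coeff (y ^ (n - 1) * (y * b)) (q + i) = 0" if "i \<le> m" for i
        using g[OF that] frob_gap[OF that] by simp
      ultimately have "y * b = 0" by (rule gap)
      moreover have "y \<noteq> 0" by (simp add: y_def)
      ultimately have "b = 0" by simp
      then show ?thesis unfolding V1 b_def by auto
    qed
    show False
      if g: "\<And>i. i \<le> m \<Longrightarrow> coeff (F 1 * c) (q + i) = coeff (map_poly (\<lambda>p. poly p 1) W) (q + i)"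
    proof -
      \<comment> \<open>Subtracting a multiple of the kernel element \<open>y ^ m\<close> lowers the
        degree of \<open>c\<close>, so that \<open>b\<close> has degree at most \<open>m\<close>. A
        preimage \<open>c\<close> of the defect would give \<open>y ^ (n - 1) * b\<close> the full
        gap, hence \<open>b = 0\<close>, although \<open>b\<close> takes the value \<open>B\<close>
        at 1.\<close>
      define b where "b = [:B:] + y * (c - smult (coeff c m) (y ^ m))"
      have "coeff (c - smult (coeff c m) (y ^ m)) k = 0" if "k \<ge> m" for k
        using that c degy[of m] ycoeff[of m] by (cases "k = m") (auto simp: coeff_eq_0)
      then have "degree (y * (c - smult (coeff c m) (y ^ m))) \<le> m" by (rule ydeg)
      then have "degree b \<le> m" unfolding b_def by (intro degree_add_le) auto
      moreover have "y ^ (n - 1) * b = smult B (y ^ (n - 1)) + F 1 * c - smult (coeff c m) (y ^ (n + m))"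
      proof -
        have "y ^ (n - 1) * b = y ^ (n - 1) * [:B:] + (y ^ (n - 1) * y) * (c - smult (coeff c m) (y ^ m))"
          by (simp only: b_def distrib_left mult.assoc)
        also have "y ^ (n - 1) * [:B:] = smult B (y ^ (n - 1))" by simp
        finally show ?thesis
          unfolding n(3) ypow[symmetric]
          by (simp only: right_diff_distrib mult_smult_right power_add add_diff_eq)
      qed
      then have "coeff (y ^ (n - 1) * b) (q + i) = 0" if "i \<le> m" for i
        using g[OF that] frob_gap[OF that] by (simp add: W1)
      ultimately have "b = 0" by (rule gap)
      then have "poly b 1 = 0" by simp
      then show False using B0 by (simp add: b_def y_def)
    qed
  qed
  then show "poly DD 1 = 0" using order_0I[of DD 1] by fastforce
qed

definition crit :: "'a set" where "crit = {l. l \<noteq> 0 \<and> l \<noteq> 1 \<and> poly DD l = 0}"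

lemma finite_crit: "finite crit"
  using poly_roots_finite[OF order_0_DD(1)] by (rule rev_finite_subset) (auto simp: crit_def)

lemma card_crit: "card crit + (if of_nat (e1 + e2 + m) = (0::'a) then Suc m else 0) = ncrit"
proof -
  have one: "(\<Sum>x\<in>crit. order x DD) = card crit"
    using order_DD_simple by (simp add: crit_def)
  show ?thesis
  proof (cases "of_nat (e1 + e2 + m) = (0::'a)")
    case True
    have "{x. x \<noteq> 0 \<and> poly DD x = 0} = insert 1 crit" using order_DD_1(2)[OF True] by (auto simp: crit_def)
    moreover have "1 \<notin> crit" by (simp add: crit_def)
    ultimately show ?thesis
      using sum_order_nonzero finite_crit one order_DD_1(1)[OF True] True by simp
  next
    case False
    then have "{x. x \<noteq> 0 \<and> poly DD x = 0} = crit" using poly_DD_1_nonzero by (auto simp: crit_def)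
    then show ?thesis using sum_order_nonzero one False by simp
  qed
qed

end

section \<open>Morphisms of the projective line\<close>

lemma coprime_iff_no_common_root:
  fixes a b :: "'a::alg_closed_field poly"
  shows "coprime a b \<longleftrightarrow> (\<forall>x. poly a x = 0 \<longrightarrow> poly b x \<noteq> 0)"
proof
  assume cop: "coprime a b"
  show "\<forall>x. poly a x = 0 \<longrightarrow> poly b x \<noteq> 0"
  proof (intro allI impI notI)
    fix x assume "poly a x = 0" "poly b x = 0"
    then have "[:-x, 1:] dvd a" "[:-x, 1:] dvd b" by (auto simp: poly_eq_0_iff_dvd)
    then have "is_unit [:-x, 1:]" using cop by (rule coprime_common_divisor[rotated 1])
    then show False by (simp add: is_unit_iff_degree)
  qed
next
  assume *: "\<forall>x. poly a x = 0 \<longrightarrow> poly b x \<noteq> 0"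
  show "coprime a b"
  proof (rule coprimeI)
    fix c assume c: "c dvd a" "c dvd b"
    have "c \<noteq> 0" using c * by auto
    moreover have "degree c = 0"
    proof (rule ccontr)
      assume "degree c \<noteq> 0"
      then obtain x where "poly c x = 0" using alg_closed_imp_poly_has_root by blast
      then show False using c * by (metis dvd_trans poly_eq_0_iff_dvd)
    qed
    ultimately show "is_unit c" by (simp add: is_unit_iff_degree)
  qed
qed

text \<open>The point with homogeneous coordinates \<open>\<alpha> : \<beta>\<close>; the pair of
  zeros is sent to \<open>Infty\<close> and has to be excluded by hypotheses.\<close>

definition pt :: "'a::field \<Rightarrow> 'a \<Rightarrow> 'a proj_line" where
  "pt \<alpha> \<beta> = (if \<beta> = 0 then Infty else Fin (\<alpha> / \<beta>))"

text \<open>A polynomial \<open>g\<close> of degree at most \<open>n\<close> stands for its homogenization of degree \<open>n\<close>.\<close>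

fun form_eval :: "nat \<Rightarrow> 'a::field poly \<Rightarrow> 'a proj_line \<Rightarrow> 'a" where
  "form_eval n g (Fin x) = poly g x"
| "form_eval n g Infty = coeff g n"

fun form_order :: "nat \<Rightarrow> 'a::field poly \<Rightarrow> 'a proj_line \<Rightarrow> nat" where
  "form_order n g (Fin x) = order x g"
| "form_order n g Infty = n - degree g"

lemma pt_eq_iff:
  assumes "\<alpha> \<noteq> 0 \<or> \<beta> \<noteq> 0" "\<gamma> \<noteq> 0 \<or> \<delta> \<noteq> 0"
  shows "pt \<alpha> \<beta> = pt \<gamma> \<delta> \<longleftrightarrow> \<alpha> * \<delta> = \<gamma> * \<beta>"
  using assms by (auto simp: pt_def field_simps)

lemma pt_scale: "c \<noteq> 0 \<Longrightarrow> pt (c * \<alpha>) (c * \<beta>) = pt \<alpha> \<beta>"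
  by (auto simp: pt_def)

lemma rat_map_eq_pt:
  "rat_map a b P = pt (form_eval (rat_degree a b) a P) (form_eval (rat_degree a b) b P)"
  by (cases P) (auto simp: pt_def Let_def)

lemma ram_index_eq: "ram_index a b P = form_order (rat_degree a b) (fibre_poly a b (rat_map a b P)) P"
  by (cases P) (auto simp: ram_index_def Let_def)

lemma degree_le_rat_degree: "degree a \<le> rat_degree a b" "degree b \<le> rat_degree a b"
  by (auto simp: rat_degree_def)

lemma form_eval_nonzero:
  fixes a b :: "'a::alg_closed_field poly"
  assumes "coprime a b"
  shows "form_eval (rat_degree a b) a P \<noteq> 0 \<or> form_eval (rat_degree a b) b P \<noteq> 0"
proof (cases P)
  case (Fin x)
  then show ?thesis using assms by (auto simp: coprime_iff_no_common_root)
next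
  case Infty
  have "a \<noteq> 0 \<or> b \<noteq> 0" using assms by auto
  moreover have "coeff a (degree a) \<noteq> 0" if "a \<noteq> 0" using that by simp
  moreover have "coeff b (degree b) \<noteq> 0" if "b \<noteq> 0" using that by simp
  ultimately show ?thesis using Infty
    by (cases "degree a \<le> degree b"; cases "b = 0"; cases "a = 0") (auto simp: rat_degree_def max_def)
qed

lemma form_eval_diff_smult:
  "form_eval n (a - smult c b) P = form_eval n a P - c * form_eval n b P"
  by (cases P) auto

lemma rat_map_eq_iff:
  fixes a b :: "'a::alg_closed_field poly"
  assumes "coprime a b"
  shows "rat_map a b P = Q \<longleftrightarrow> form_eval (rat_degree a b) (fibre_poly a b Q) P = 0"
  using form_eval_nonzero[OF assms, of P]
  by (cases Q) (auto simp: rat_map_eq_pt pt_def form_eval_diff_smult field_simps)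

lemma form_order_pos_iff:
  assumes "g \<noteq> 0" "degree g \<le> n"
  shows "form_order n g P > 0 \<longleftrightarrow> form_eval n g P = 0"
proof (cases P)
  case (Fin x)
  then show ?thesis using assms by (simp add: order_gt_0_iff)
next
  case Infty
  then show ?thesis using assms
    by (auto simp: coeff_eq_0 le_less)
qed

lemma form_order_mult:
  assumes "f \<noteq> 0" "g \<noteq> 0" "degree f \<le> j" "degree g \<le> l"
  shows "form_order (j + l) (f * g) P = form_order j f P + form_order l g P"
  using assms by (cases P) (auto simp: order_mult degree_mult_eq)

lemma form_order_power:
  assumes "f \<noteq> 0" "degree f \<le> 1"
  shows "form_order j (f ^ j) P = j * form_order 1 f P"
proof (induction j)
  case 0
  then show ?case by (cases P) auto
next
  case (Suc j)
  have "degree (f ^ j) \<le> j" using assms degree_power_le[of f j] by (metis le_trans mult.commute mult_le_mono2 nat_mult_1)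
  then show ?case using form_order_mult[of f "f ^ j" 1 j P] assms Suc by simp
qed

lemma form_order_smult: "c \<noteq> 0 \<Longrightarrow> form_order n (smult c g) P = form_order n g P"
  by (cases P) (auto simp: order_smult)

lemma form_zeros:
  fixes g :: "'a::alg_closed_field poly"
  assumes "g \<noteq> 0" "degree g \<le> n"
  shows "finite {P. form_eval n g P = 0}"
    and "(\<Sum>P | form_eval n g P = 0. form_order n g P) = n"
proof -
  have fin: "finite {x. poly g x = 0}" using assms(1) by (rule poly_roots_finite)
  have split: "{P. form_eval n g P = 0} = Fin ` {x. poly g x = 0} \<union> (if coeff g n = 0 then {Infty} else {})"
  proof (intro equalityI subsetI)
    fix P assume "P \<in> {P. form_eval n g P = 0}"
    then show "P \<in> Fin ` {x. poly g x = 0} \<union> (if coeff g n = 0 then {Infty} else {})"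
      by (cases P) auto
  qed (auto split: if_splits)
  then show "finite {P. form_eval n g P = 0}" using fin by auto
  have "(\<Sum>P\<in>Fin ` {x. poly g x = 0}. form_order n g P) = degree g"
    using sum_order_eq_degree[OF assms(1)] by (subst sum.reindex) (auto simp: inj_on_def)
  moreover have "coeff g n \<noteq> 0 \<Longrightarrow> degree g = n" using assms(2) by (simp add: le_degree le_antisym)
  ultimately show "(\<Sum>P | form_eval n g P = 0. form_order n g P) = n"
    unfolding split using fin assms by (subst sum.union_disjoint) auto
qed

lemma fibre_poly_nonzero:
  assumes "coprime a b" "0 < rat_degree a b"
  shows "fibre_poly a b Q \<noteq> 0"
proof
  assume z: "fibre_poly a b Q = 0"
  have "degree a = 0 \<and> degree b = 0"
  proof (cases Q)
    case (Fin c)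
    then have a: "a = smult c b" using z by simp
    then have "b dvd a" by (simp add: dvd_smult)
    then have "is_unit b" using assms(1) by (meson coprime_common_divisor dvd_refl)
    then have "degree b = 0" by (auto simp: is_unit_iff_degree)
    then show ?thesis using a degree_smult_le[of c b] by simp
  next
    case Infty
    then have "b = 0" using z by simp
    then have "is_unit a" using assms(1) by simp
    then show ?thesis using \<open>b = 0\<close> by (auto simp: is_unit_iff_degree)
  qed
  then show False using assms(2) by (simp add: rat_degree_def)
qed

lemma degree_fibre_poly: "degree (fibre_poly a b Q) \<le> rat_degree a b"
proof (cases Q)
  case (Fin c)
  have "degree (a - smult c b) \<le> max (degree a) (degree b)"
    using degree_diff_le_max[of a "smult c b"] degree_smult_le[of c b] by linarith
  then show ?thesis using Fin by (simp add: rat_degree_def)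
qed (simp add: rat_degree_def)

lemma fibre:
  fixes a b :: "'a::alg_closed_field poly"
  assumes "coprime a b" "0 < rat_degree a b"
  shows "finite {P. rat_map a b P = Q}"
    and "(\<Sum>P | rat_map a b P = Q. ram_index a b P) = rat_degree a b"
proof -
  let ?g = "fibre_poly a b Q"
  have eq: "{P. rat_map a b P = Q} = {P. form_eval (rat_degree a b) ?g P = 0}"
    using rat_map_eq_iff[OF assms(1)] by auto
  note z = form_zeros[OF fibre_poly_nonzero[OF assms] degree_fibre_poly, of Q]
  show "finite {P. rat_map a b P = Q}" unfolding eq by (rule z)
  have "(\<Sum>P | rat_map a b P = Q. ram_index a b P) = (\<Sum>P | rat_map a b P = Q. form_order (rat_degree a b) ?g P)"
    by (rule sum.cong) (auto simp: ram_index_eq)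
  then show "(\<Sum>P | rat_map a b P = Q. ram_index a b P) = rat_degree a b" unfolding eq using z(2) by simp
qed

text \<open>\<open>homog n u a b\<close> is \<open>b ^ n * u (a / b)\<close>.\<close>

definition homog_eval :: "nat \<Rightarrow> 'a::field poly \<Rightarrow> 'a \<Rightarrow> 'a \<Rightarrow> 'a" where
  "homog_eval n u \<alpha> \<beta> = (\<Sum>i\<le>n. coeff u i * (\<alpha> ^ i * \<beta> ^ (n - i)))"

definition homog :: "nat \<Rightarrow> 'a::field poly \<Rightarrow> 'a poly \<Rightarrow> 'a poly \<Rightarrow> 'a poly" where
  "homog n u a b = (\<Sum>i\<le>n. smult (coeff u i) (a ^ i * b ^ (n - i)))"

lemma poly_homog: "poly (homog n u a b) x = homog_eval n u (poly a x) (poly b x)"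
  by (simp add: homog_def homog_eval_def poly_sum poly_power)

lemma coeff_mult_top:
  fixes f g :: "'a::field poly"
  assumes "degree f \<le> j" "degree g \<le> l"
  shows "coeff (f * g) (j + l) = coeff f j * coeff g l"
proof (cases "degree f = j \<and> degree g = l")
  case True
  then show ?thesis using coeff_mult_degree_sum[of f g] by auto
next
  case False
  then have "degree (f * g) < j + l" using assms degree_mult_le[of f g] by linarith
  moreover have "coeff f j = 0 \<or> coeff g l = 0" using False assms by (auto simp: le_less coeff_eq_0)
  ultimately show ?thesis by (auto simp: coeff_eq_0)
qed

lemma coeff_power_top:
  fixes f :: "'a::field poly"
  assumes "degree f \<le> k"
  shows "degree (f ^ i) \<le> i * k" "coeff (f ^ i) (i * k) = coeff f k ^ i"
proof -
  show d: "degree (f ^ i) \<le> i * k" for i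
    using degree_power_le[of f i] assms by (metis le_trans mult.commute mult_le_mono2)
  show "coeff (f ^ i) (i * k) = coeff f k ^ i"
    by (induction i) (use coeff_mult_top[OF assms d] in \<open>auto\<close>)
qed

lemma homog_top:
  fixes a b :: "'a::field poly"
  assumes "degree a \<le> k" "degree b \<le> k"
  shows "degree (homog n u a b) \<le> n * k"
    and "coeff (homog n u a b) (n * k) = homog_eval n u (coeff a k) (coeff b k)"
proof -
  have *: "degree (a ^ i * b ^ (n - i)) \<le> n * k"
    "coeff (a ^ i * b ^ (n - i)) (n * k) = coeff a k ^ i * coeff b k ^ (n - i)" if "i \<le> n" for i
  proof -
    have nk: "n * k = i * k + (n - i) * k" using that by (simp flip: add_mult_distrib)
    show "degree (a ^ i * b ^ (n - i)) \<le> n * k"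
      using degree_mult_le[of "a ^ i" "b ^ (n - i)"] coeff_power_top(1)[OF assms(1), of i]
        coeff_power_top(1)[OF assms(2), of "n - i"] nk by linarith
    show "coeff (a ^ i * b ^ (n - i)) (n * k) = coeff a k ^ i * coeff b k ^ (n - i)"
      unfolding nk using coeff_power_top[OF assms(1), of i] coeff_power_top[OF assms(2), of "n - i"]
      by (subst coeff_mult_top) auto
  qed
  show "degree (homog n u a b) \<le> n * k"
    unfolding homog_def using *(1) by (intro degree_sum_le) (auto intro: order_trans[OF degree_smult_le])
  show "coeff (homog n u a b) (n * k) = homog_eval n u (coeff a k) (coeff b k)"
    unfolding homog_def homog_eval_def coeff_sum by (rule sum.cong) (auto simp: *(2))
qed

lemma form_eval_homog:
  fixes a b :: "'a::field poly"
  assumes "degree a \<le> k" "degree b \<le> k"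
  shows "form_eval (n * k) (homog n u a b) P = homog_eval n u (form_eval k a P) (form_eval k b P)"
  using homog_top(2)[OF assms] by (cases P) (auto simp: poly_homog)

lemma homog_eval_0: "homog_eval n u \<alpha> 0 = \<alpha> ^ n * coeff u n"
proof -
  have "homog_eval n u \<alpha> 0 = (\<Sum>i\<in>{n}. coeff u i * (\<alpha> ^ i * 0 ^ (n - i)))"
    unfolding homog_eval_def by (rule sum.mono_neutral_right) auto
  then show ?thesis by simp
qed

lemma homog_eval_nonzero:
  assumes "\<beta> \<noteq> 0" "degree u \<le> n"
  shows "homog_eval n u \<alpha> \<beta> = \<beta> ^ n * poly u (\<alpha> / \<beta>)"
proof -
  have "poly u (\<alpha> / \<beta>) = (\<Sum>i\<le>n. coeff u i * (\<alpha> / \<beta>) ^ i)"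
    unfolding poly_altdef using assms(2) by (intro sum.mono_neutral_left) (auto simp: coeff_eq_0)
  then show ?thesis using assms(1)
    by (auto simp: homog_eval_def sum_distrib_left power_diff field_simps intro!: sum.cong)
qed

text \<open>The scalar \<open>c\<close> does not depend on \<open>u\<close>: numerator and
  denominator of a composite are scaled alike, so their ratio is the value of the outer map.\<close>

lemma homog_eval_eq:
  assumes "\<alpha> \<noteq> 0 \<or> \<beta> \<noteq> 0"
  obtains c where "c \<noteq> 0" "\<And>u. degree u \<le> n \<Longrightarrow> homog_eval n u \<alpha> \<beta> = c * form_eval n u (pt \<alpha> \<beta>)"
proof (cases "\<beta> = 0")
  case True
  then show ?thesis using that[of "\<alpha> ^ n"] assms by (simp add: homog_eval_0 pt_def)
next
  case False
  then show ?thesis using that[of "\<beta> ^ n"] by (simp add: homog_eval_nonzero pt_def)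
qed

lemma homog_eval_mult:
  assumes "degree g \<le> j" "degree h \<le> l"
  shows "homog_eval (j + l) (g * h) \<alpha> \<beta> = homog_eval j g \<alpha> \<beta> * homog_eval l h \<alpha> \<beta>"
proof (cases "\<beta> = 0")
  case True
  then show ?thesis using coeff_mult_top[OF assms] by (simp add: homog_eval_0 power_add)
next
  case False
  have "degree (g * h) \<le> j + l" using degree_mult_le[of g h] assms by linarith
  then show ?thesis using assms False by (simp add: homog_eval_nonzero power_add)
qed


lemma form_eval_homog_rat_map:
  fixes a b :: "'a::alg_closed_field poly"
  assumes "coprime a b"
  obtains c where "c \<noteq> 0"
    "\<forall>u. degree u \<le> n \<longrightarrow> form_eval (n * rat_degree a b) (homog n u a b) P = c * form_eval n u (rat_map a b P)"
proof -
  let ?k = "rat_degree a b"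
  obtain c where c: "c \<noteq> 0" "\<And>u. degree u \<le> n \<Longrightarrow>
    homog_eval n u (form_eval ?k a P) (form_eval ?k b P) = c * form_eval n u (rat_map a b P)"
    using homog_eval_eq[OF form_eval_nonzero[OF assms, of P], of n] unfolding rat_map_eq_pt by metis
  then show ?thesis
    using that form_eval_homog[OF degree_le_rat_degree(1)[of a b] degree_le_rat_degree(2)[of b a]] by metis
qed

lemma rat_map_comp:
  fixes a b u v :: "'a::alg_closed_field poly"
  assumes "coprime u v" "coprime a b"
  defines "n \<equiv> rat_degree u v"
  shows "coprime (homog n u a b) (homog n v a b)"
    and "rat_degree (homog n u a b) (homog n v a b) = n * rat_degree a b"
    and "rat_map u v \<circ> rat_map a b = rat_map (homog n u a b) (homog n v a b)"
proof -
  let ?k = "rat_degree a b"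
  have deg: "degree u \<le> n" "degree v \<le> n" by (simp_all add: n_def rat_degree_def)
  have nz: "form_eval (n * ?k) (homog n u a b) P \<noteq> 0 \<or> form_eval (n * ?k) (homog n v a b) P \<noteq> 0" for P
  proof -
    obtain c where "c \<noteq> 0" "\<forall>w. degree w \<le> n \<longrightarrow>
      form_eval (n * ?k) (homog n w a b) P = c * form_eval n w (rat_map a b P)"
      using form_eval_homog_rat_map[OF assms(2), of n P] .
    then show ?thesis using form_eval_nonzero[OF assms(1), of "rat_map a b P"] deg by (auto simp: n_def)
  qed
  show cop: "coprime (homog n u a b) (homog n v a b)"
    unfolding coprime_iff_no_common_root
  proof (intro allI impI)
    fix x assume "poly (homog n u a b) x = 0"
    then show "poly (homog n v a b) x \<noteq> 0" using nz[of "Fin x"] by simp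
  qed
  have ab: "degree a \<le> ?k" "degree b \<le> ?k" by (simp_all add: rat_degree_def)
  show d: "rat_degree (homog n u a b) (homog n v a b) = n * ?k"
  proof (rule antisym)
    show "rat_degree (homog n u a b) (homog n v a b) \<le> n * ?k"
      using homog_top(1)[OF ab] by (simp add: rat_degree_def)
    show "n * ?k \<le> rat_degree (homog n u a b) (homog n v a b)"
      using nz[of Infty] by (auto simp: rat_degree_def le_max_iff_disj dest: le_degree)
  qed
  show "rat_map u v \<circ> rat_map a b = rat_map (homog n u a b) (homog n v a b)"
  proof
    fix P
    obtain c where "c \<noteq> 0" "\<forall>w. degree w \<le> n \<longrightarrow>
      form_eval (n * ?k) (homog n w a b) P = c * form_eval n w (rat_map a b P)"
      using form_eval_homog_rat_map[OF assms(2), of n P] .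
    then show "(rat_map u v \<circ> rat_map a b) P = rat_map (homog n u a b) (homog n v a b) P"
      using deg unfolding comp_apply rat_map_eq_pt[of u v] rat_map_eq_pt[of "homog n u a b"] d
      by (simp add: pt_scale n_def)
  qed
qed

lemma homog_mult:
  fixes a b :: "'a::alg_closed_field poly"
  assumes "degree g \<le> j" "degree h \<le> l"
  shows "homog (j + l) (g * h) a b = homog j g a b * homog l h a b"
  by (rule poly_eqI_nonzero) (simp add: poly_homog homog_eval_mult[OF assms])

lemma homog_power:
  fixes a b :: "'a::alg_closed_field poly"
  assumes "degree g \<le> 1"
  shows "homog j (g ^ j) a b = homog 1 g a b ^ j"
proof (induction j)
  case (Suc j)
  have "degree (g ^ j) \<le> j" using coeff_power_top(1)[OF assms, of j] by simp
  then show ?case using homog_mult[OF assms, of "g ^ j" j a b] Suc by simp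
qed (simp add: homog_def)

lemma homog_1: "homog 1 g a b = smult (coeff g 0) b + smult (coeff g 1) a"
  by (simp add: homog_def)

lemma homog_diff_smult: "homog n (u - smult c v) a b = homog n u a b - smult c (homog n v a b)"
  by (simp add: homog_def smult_diff_left sum_subtractf smult_sum2)

lemma fibre_poly_homog:
  "fibre_poly (homog n u a b) (homog n v a b) Q = homog n (fibre_poly u v Q) a b"
  by (cases Q) (simp_all add: homog_diff_smult)

text \<open>Otherwise \<open>w\<close> would vanish at every value of a nonconstant map. Zeros and
  fibres are finite, but the line is infinite.\<close>

lemma homog_nonzero:
  fixes a b :: "'a::alg_closed_field poly"
  assumes "coprime a b" "0 < rat_degree a b" "w \<noteq> 0" "degree w \<le> n"
  shows "homog n w a b \<noteq> 0"
proof
  assume z: "homog n w a b = 0"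
  have fin: "finite {Q. form_eval n w Q = 0}" using form_zeros(1)[OF assms(3,4)] .
  have "form_eval n w (rat_map a b P) = 0" for P
  proof -
    obtain c where "c \<noteq> 0" "\<forall>w. degree w \<le> n \<longrightarrow>
      form_eval (n * rat_degree a b) (homog n w a b) P = c * form_eval n w (rat_map a b P)"
      using form_eval_homog_rat_map[OF assms(1), of n P] .
    then have "0 = c * form_eval n w (rat_map a b P)" using z assms(4) by (cases P) fastforce+
    then show ?thesis using \<open>c \<noteq> 0\<close> by simp
  qed
  then have "UNIV = (\<Union>Q\<in>{Q. form_eval n w Q = 0}. {P. rat_map a b P = Q})" by auto
  then have "finite (UNIV :: 'a proj_line set)" using fin fibre(1)[OF assms(1,2)] by (metis finite_UN_I)
  then have "finite (range (Fin :: 'a \<Rightarrow> _))" by (rule rev_finite_subset) auto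
  then have "finite (UNIV :: 'a set)" by (rule finite_imageD) (auto simp: inj_on_def)
  then show False using infinite_UNIV_alg_closed by blast
qed

text \<open>Write \<open>w\<close> as a power of the linear form vanishing at the image of
  \<open>P\<close>, times a form nonzero there. Under a map of degree 1 a linear form pulls back to
  a nonzero linear form, which has order at most 1.\<close>

lemma form_order_homog:
  fixes a b :: "'a::alg_closed_field poly"
  assumes cop: "coprime a b" and deg1: "rat_degree a b = 1" and w: "w \<noteq> 0" "degree w \<le> n"
  shows "form_order n (homog n w a b) P = form_order n w (rat_map a b P)"
proof -
  have pos: "0 < rat_degree a b" using deg1 by simp
  have ab: "degree a \<le> 1" "degree b \<le> 1" using deg1 by (simp_all add: rat_degree_def)
  have top: "degree (homog i g a b) \<le> i" for i g using homog_top(1)[OF ab, of i g] by simp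
  have eval: "\<exists>c. c \<noteq> 0 \<and> form_eval i (homog i g a b) P = c * form_eval i g (rat_map a b P)"
    if "degree g \<le> i" for i g
    using form_eval_homog_rat_map[OF cop, of i P] that deg1 by (metis mult.right_neutral)
  have one: "form_order 1 (homog 1 g a b) P = 1"
    if g: "g \<noteq> 0" "degree g \<le> 1" "form_eval 1 g (rat_map a b P) = 0" for g
  proof -
    let ?h = "homog 1 g a b"
    have h: "?h \<noteq> 0" using homog_nonzero[OF cop pos g(1,2)] .
    have "form_eval 1 ?h P = 0" using eval[OF g(2)] g(3) by auto
    then have "form_order 1 ?h P > 0" using form_order_pos_iff[OF h top] by simp
    moreover have "form_order 1 ?h P \<le> 1"
      using order_degree[OF h] top[of 1 g] by (cases P) (auto intro: order_trans)
    ultimately show ?thesis by simp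
  qed
  have key: "form_order n (homog n w a b) P = j"
    if j: "w = g ^ j * h" "n = j + i" "degree g \<le> 1" "g \<noteq> 0" "degree h \<le> i" "h \<noteq> 0"
      "form_eval 1 g (rat_map a b P) = 0" "form_eval i h (rat_map a b P) \<noteq> 0" for g h i j
  proof -
    have dg: "degree (g ^ j) \<le> j" using coeff_power_top(1)[OF j(3), of j] by simp
    have hh: "homog i h a b \<noteq> 0" using homog_nonzero[OF cop pos j(6,5)] .
    have hg: "homog 1 g a b \<noteq> 0" using homog_nonzero[OF cop pos j(4,3)] .
    have "homog n w a b = homog 1 g a b ^ j * homog i h a b"
      unfolding j(1,2) homog_mult[OF dg j(5)] homog_power[OF j(3)] ..
    moreover have "degree (homog 1 g a b ^ j) \<le> j" using coeff_power_top(1)[OF top, of 1 g j] by simp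
    ultimately have "form_order n (homog n w a b) P = form_order j (homog 1 g a b ^ j) P + form_order i (homog i h a b) P"
      using hh hg top[of i h] unfolding j(2) by (simp add: form_order_mult)
    also have "form_order j (homog 1 g a b ^ j) P = j"
      using form_order_power[OF hg top, of j P] one[OF j(4,3,7)] by simp
    also have "form_order i (homog i h a b) P = 0"
      using form_order_pos_iff[OF hh top, of P] eval[OF j(5)] j(8) by auto
    finally show ?thesis by simp
  qed
  show ?thesis
  proof (cases "rat_map a b P")
    case (Fin \<rho>)
    obtain h where h: "w = [:-\<rho>, 1:] ^ order \<rho> w * h" "\<not> [:-\<rho>, 1:] dvd h"
      using order_decomp[OF w(1)] by blast
    have h0: "h \<noteq> 0" using h(2) by auto
    have "degree w = order \<rho> w + degree h"
      using h0 by (subst h(1)) (simp add: degree_mult_eq degree_power_eq)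
    then have "form_order n (homog n w a b) P = order \<rho> w"
      using h0 h(2) w(2) Fin by (intro key[OF h(1), of "n - order \<rho> w"]) (auto simp: poly_eq_0_iff_dvd)
    then show ?thesis using Fin by simp
  next
    case Infty
    \<comment> \<open>The linear form that vanishes at infinity has the dehomogenization 1.\<close>
    have "form_order n (homog n w a b) P = n - degree w"
      using w Infty by (intro key[of 1 "n - degree w" w "degree w"]) auto
    then show ?thesis using Infty by simp
  qed
qed

lemma ram_index_comp:
  fixes a b u v :: "'a::alg_closed_field poly"
  assumes "coprime u v" "coprime a b" "rat_degree a b = 1" "0 < rat_degree u v"
  defines "n \<equiv> rat_degree u v"
  shows "ram_index (homog n u a b) (homog n v a b) P = ram_index u v (rat_map a b P)"
proof -
  have "rat_map (homog n u a b) (homog n v a b) P = rat_map u v (rat_map a b P)"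
    using rat_map_comp(3)[OF assms(1,2)] by (simp add: n_def fun_eq_iff)
  then show ?thesis
    using rat_map_comp(2)[OF assms(1,2)] assms(3)
      form_order_homog[OF assms(2,3) fibre_poly_nonzero[OF assms(1,4)] degree_fibre_poly]
    by (simp add: ram_index_eq n_def fibre_poly_homog)
qed

text \<open>A linear form on the target that vanishes at \<open>Q\<close> is unique up to a scalar,
  so the composite has the same fibre forms up to scalars.\<close>

lemma ram_index_comp_left:
  fixes a b s t :: "'a::alg_closed_field poly"
  assumes "coprime s t" "rat_degree s t = 1" "coprime a b"
  shows "ram_index (homog 1 s a b) (homog 1 t a b) P = ram_index a b P"
proof -
  define Q where "Q = rat_map a b P"
  define g where "g = fibre_poly s t (rat_map s t Q)"
  have map: "rat_map (homog 1 s a b) (homog 1 t a b) P = rat_map s t Q"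
    using rat_map_comp(3)[OF assms(1,3)] assms(2) by (simp add: fun_eq_iff Q_def)
  have deg: "rat_degree (homog 1 s a b) (homog 1 t a b) = rat_degree a b"
    using rat_map_comp(2)[OF assms(1,3)] assms(2) by simp
  have g: "g \<noteq> 0" "degree g \<le> 1" "form_eval 1 g Q = 0"
    using fibre_poly_nonzero[OF assms(1)] degree_fibre_poly[of s t] rat_map_eq_iff[OF assms(1)] assms(2)
    unfolding g_def by auto
  have "\<exists>k. k \<noteq> 0 \<and> homog 1 g a b = smult k (fibre_poly a b Q)"
  proof (cases Q)
    case Infty
    then have "coeff g 1 = 0" using g(3) by simp
    moreover from this have "coeff g 0 \<noteq> 0" using g(1,2)
      by (metis One_nat_def le_Suc_eq le_zero_eq leading_coeff_0_iff)
    ultimately show ?thesis using Infty unfolding homog_1 by (intro exI[of _ "coeff g 0"]) simp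
  next
    case (Fin c)
    have geq: "g = [:coeff g 0, coeff g 1:]"
      using g(2) by (auto simp: poly_eq_iff coeff_pCons coeff_eq_0 split: nat.splits)
    then have "poly g c = poly [:coeff g 0, coeff g 1:] c" by (rule arg_cong)
    also have "\<dots> = coeff g 0 + c * coeff g 1" by simp
    finally have "poly g c = coeff g 0 + c * coeff g 1" .
    then have c0: "coeff g 0 = - c * coeff g 1" using g(3) Fin by (simp add: eq_neg_iff_add_eq_0)
    then have "coeff g 1 \<noteq> 0" using g(1) geq by auto
    moreover have "homog 1 g a b = smult (coeff g 1) (a - smult c b)"
      unfolding homog_1 c0 by (simp add: smult_diff_right mult.commute)
    ultimately show ?thesis using Fin by auto
  qed
  then show ?thesis unfolding ram_index_eq map deg fibre_poly_homog g_def Q_def by (auto simp: form_order_smult)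
qed

section \<open>Uniqueness of the reduced fraction\<close>

lemma bezout_poly:
  fixes a b :: "'a::field poly"
  assumes "coprime a b"
  shows "\<exists>s t. s * a + t * b = 1"
  using assms
\<comment> \<open>The measure separates the zero polynomial from nonzero constants, which have the
  same degree.\<close>
proof (induction "if b = 0 then 0 else Suc (degree b)" arbitrary: a b rule: less_induct)
  case less
  show ?case
  proof (cases "b = 0")
    case True
    then have "a dvd 1" using less.prems by simp
    then obtain s where "1 = a * s" by (elim dvdE)
    then show ?thesis using True by (metis add_0_right mult.commute mult_zero_right)
  next
    case False
    have cop: "coprime b (a mod b)"
    proof (rule coprimeI)
      fix c assume c: "c dvd b" "c dvd a mod b"
      then have "c dvd a div b * b + a mod b" by (intro dvd_add dvd_mult)
      then show "is_unit c"
        using less.prems c(1) by (metis coprime_common_divisor div_mult_mod_eq)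
    qed
    have "(if a mod b = 0 then 0 else Suc (degree (a mod b))) < (if b = 0 then 0 else Suc (degree b))"
      using False degree_mod_less'[of b a] by auto
    from less.hyps[OF this cop] obtain s t where "s * b + t * (a mod b) = 1" by blast
    then have "t * a + (s - t * (a div b)) * b = 1"
      by (simp add: algebra_simps minus_div_mult_eq_mod[symmetric])
    then show ?thesis by blast
  qed
qed

text \<open>Equal values give \<open>a * b' = a' * b\<close>, and with
  \<open>s * a + t * b = 1\<close> the pair \<open>a'\<close>, \<open>b'\<close> is
  \<open>k = s * a' + t * b'\<close> times \<open>a\<close>, \<open>b\<close>. As a common divisor
  of coprime polynomials \<open>k\<close> is a unit.\<close>

lemma rat_map_unique:
  fixes a b a' b' :: "'a::alg_closed_field poly"
  assumes "coprime a b" "coprime a' b'" "rat_map a b = rat_map a' b'"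
  obtains c where "c \<noteq> 0" "a' = smult c a" "b' = smult c b"
proof -
  have "poly a x * poly b' x = poly a' x * poly b x" for x
  proof -
    have "pt (poly a x) (poly b x) = pt (poly a' x) (poly b' x)"
      using assms(3)[THEN fun_cong, of "Fin x"] by (simp add: rat_map_eq_pt del: rat_map.simps)
    then show ?thesis
      using assms(1,2) by (subst (asm) pt_eq_iff) (auto simp: coprime_iff_no_common_root)
  qed
  then have cross: "a * b' = a' * b" by (intro poly_eqI_nonzero) simp
  obtain s t where st: "s * a + t * b = 1" using bezout_poly[OF assms(1)] by blast
  define k where "k = s * a' + t * b'"
  have "a' = (s * a + t * b) * a'" using st by simp
  also have "\<dots> = a * (s * a') + t * (a' * b)" by (simp add: algebra_simps)
  also have "\<dots> = a * k" by (simp add: k_def algebra_simps flip: cross)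
  finally have a': "a' = a * k" .
  have "b' = (s * a + t * b) * b'" using st by simp
  also have "\<dots> = s * (a * b') + b * (t * b')" by (simp add: algebra_simps)
  also have "\<dots> = b * k" by (simp add: k_def algebra_simps cross)
  finally have b': "b' = b * k" .
  have "k dvd a'" "k dvd b'" by (simp_all add: a' b')
  then have "is_unit k" using assms(2) coprime_common_divisor by blast
  then obtain c where "k = [:c:]" "c \<noteq> 0"
    by (metis degree_eq_zeroE is_unit_iff_degree not_is_unit_0 pCons_0_0)
  then show ?thesis using that[of c] a' b' by simp
qed

lemma rat_degree_smult: "c \<noteq> 0 \<Longrightarrow> rat_degree (smult c a) (smult c b) = rat_degree a b"
  by (simp add: rat_degree_def)

lemma rat_map_smult: "c \<noteq> 0 \<Longrightarrow> rat_map (smult c a) (smult c b) = rat_map a b"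
proof
  fix P assume "c \<noteq> 0"
  then show "rat_map (smult c a) (smult c b) P = rat_map a b P"
    by (cases P) (auto simp: rat_degree_smult Let_def)
qed

lemma ram_index_smult:
  assumes "c \<noteq> 0"
  shows "ram_index (smult c a) (smult c b) P = ram_index a b P"
proof -
  have "fibre_poly (smult c a) (smult c b) Q = smult c (fibre_poly a b Q)" for Q
    by (cases Q) (auto simp: smult_diff_right mult.commute)
  then show ?thesis using assms
    by (simp add: ram_index_eq rat_degree_smult rat_map_smult form_order_smult)
qed

section \<open>Change of coordinates\<close>

lemma linear_forms_coprime:
  fixes a0 a1 b0 b1 :: "'a::alg_closed_field"
  assumes "a1 * b0 - a0 * b1 \<noteq> 0"
  shows "coprime [:a0, a1:] [:b0, b1:]" "rat_degree [:a0, a1:] [:b0, b1:] = 1"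
proof -
  show "coprime [:a0, a1:] [:b0, b1:]"
    unfolding coprime_iff_no_common_root
  proof (intro allI impI notI)
    fix x assume "poly [:a0, a1:] x = 0" "poly [:b0, b1:] x = 0"
    then have "a0 = - (x * a1)" "b0 = - (x * b1)" by (auto simp: eq_neg_iff_add_eq_0)
    then show False using assms by simp
  qed
  show "rat_degree [:a0, a1:] [:b0, b1:] = 1"
    using assms by (auto simp: rat_degree_def)
qed

lemma degree_1_forms:
  fixes a b :: "'a::alg_closed_field poly"
  assumes "coprime a b" "rat_degree a b = 1"
  obtains a0 a1 b0 b1 where "a = [:a0, a1:]" "b = [:b0, b1:]" "a1 * b0 - a0 * b1 \<noteq> 0"
proof -
  have lin: "f = [:coeff f 0, coeff f 1:]" if "degree f \<le> 1" for f :: "'a poly"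
    using that by (auto simp: poly_eq_iff coeff_pCons coeff_eq_0 split: nat.splits)
  have "degree a \<le> 1" "degree b \<le> 1" using assms(2) by (auto simp: rat_degree_def)
  then obtain a0 a1 b0 b1 where ab: "a = [:a0, a1:]" "b = [:b0, b1:]" using lin by metis
  have "a1 * b0 - a0 * b1 \<noteq> 0"
  proof
    assume z: "a1 * b0 - a0 * b1 = 0"
    have "a1 \<noteq> 0 \<or> b1 \<noteq> 0" using assms(2) unfolding ab by (auto simp: rat_degree_def)
    then have "\<exists>x. poly a x = 0 \<and> poly b x = 0"
    proof
      assume "a1 \<noteq> 0"
      then show ?thesis using z by (intro exI[of _ "- a0 / a1"]) (auto simp: ab field_simps)
    next
      assume "b1 \<noteq> 0"
      then show ?thesis using z by (intro exI[of _ "- b0 / b1"]) (auto simp: ab field_simps)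
    qed
    then show False using assms(1) by (auto simp: coprime_iff_no_common_root)
  qed
  then show ?thesis using that ab by blast
qed

lemma rat_map_id: "c \<noteq> 0 \<Longrightarrow> rat_map [:0, c:] [:c:] = (id :: 'a::field proj_line \<Rightarrow> _)"
proof
  fix P :: "'a proj_line" assume "c \<noteq> 0"
  then show "rat_map [:0, c:] [:c:] P = id P"
    by (cases P) (auto simp: rat_degree_def Let_def)
qed

definition moebius :: "('a::alg_closed_field proj_line \<Rightarrow> 'a proj_line) \<Rightarrow> bool" where
  "moebius f \<longleftrightarrow> (\<exists>a b. coprime a b \<and> rat_degree a b = 1 \<and> f = rat_map a b)"

lemma moebius_comp:
  assumes "moebius f" "moebius g"
  shows "moebius (f \<circ> g)"
proof -
  obtain a b c e where "coprime a b" "rat_degree a b = 1" "f = rat_map a b"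
    "coprime c e" "rat_degree c e = 1" "g = rat_map c e"
    using assms by (auto simp: moebius_def)
  then show ?thesis using rat_map_comp[of a b c e] unfolding moebius_def by auto
qed

lemma moebius_inverse:
  assumes "moebius f"
  obtains g where "moebius g" "f \<circ> g = id" "g \<circ> f = id"
proof -
  obtain a b where ab: "coprime a b" "rat_degree a b = 1" "f = rat_map a b"
    using assms by (auto simp: moebius_def)
  obtain a0 a1 b0 b1 where lin: "a = [:a0, a1:]" "b = [:b0, b1:]" and \<Delta>: "a1 * b0 - a0 * b1 \<noteq> 0"
    using degree_1_forms[OF ab(1,2)] .
  \<comment> \<open>The adjugate of the coefficient matrix.\<close>
  define c e where "c = [:- a0, b0:]" and "e = [:a1, - b1:]"
  have ce: "coprime c e" "rat_degree c e = 1"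
    unfolding c_def e_def using \<Delta> by (intro linear_forms_coprime; simp add: algebra_simps)+
  have h: "homog 1 a c e = [:0, a1 * b0 - a0 * b1:]" "homog 1 b c e = [:a1 * b0 - a0 * b1:]"
    "homog 1 c a b = [:0, a1 * b0 - a0 * b1:]" "homog 1 e a b = [:a1 * b0 - a0 * b1:]"
    unfolding homog_1 by (simp_all add: lin c_def e_def algebra_simps)
  have 1: "f \<circ> rat_map c e = id"
    using rat_map_comp(3)[OF ab(1) ce(1)] unfolding ab(2,3) h rat_map_id[OF \<Delta>] .
  have 2: "rat_map c e \<circ> f = id"
    using rat_map_comp(3)[OF ce(1) ab(1)] unfolding ce(2) ab(3) h rat_map_id[OF \<Delta>] .
  show ?thesis using that[of "rat_map c e"] ce 1 2 by (auto simp: moebius_def)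
qed

lemma moebius_bij: "moebius f \<Longrightarrow> bij f"
  by (metis moebius_inverse o_bij)

text \<open>Degrees multiply under composition and the identity has degree 1.\<close>

lemma line_automorphism_iff_moebius: "line_automorphism f \<longleftrightarrow> moebius f"
proof
  assume "line_automorphism f"
  then obtain a b c e where f: "coprime a b" "f = rat_map a b" and g: "coprime c e" "rat_map c e \<circ> f = id"
    unfolding line_automorphism_def line_morphism_def by blast
  let ?u = "homog (rat_degree c e) c a b" and ?v = "homog (rat_degree c e) e a b"
  have "rat_map ?u ?v = rat_map [:0, 1:] [:1:]"
    using rat_map_comp(3)[OF g(1) f(1)] f(2) g(2) rat_map_id[of "1 :: 'a"] by simp
  moreover have "coprime [:0, 1 :: 'a:] [:1:]" using linear_forms_coprime(1)[of 1 1 0 0] by simp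
  ultimately obtain k where "k \<noteq> 0" "?u = smult k [:0, 1:]" "?v = smult k [:1:]"
    using rat_map_unique[of "[:0, 1:]" "[:1:]" ?u ?v] rat_map_comp(1)[OF g(1) f(1)] by metis
  then have "rat_degree ?u ?v = 1" by (simp add: rat_degree_def)
  then have "rat_degree a b = 1" using rat_map_comp(2)[OF g(1) f(1)] by simp
  then show "moebius f" using f by (auto simp: moebius_def)
next
  assume f: "moebius f"
  then obtain g where "moebius g" "f \<circ> g = id" "g \<circ> f = id" using moebius_inverse by blast
  then show "line_automorphism f"
    using f unfolding line_automorphism_def line_morphism_def moebius_def by blast
qed

lemma moebius_three_points:
  fixes P0 P1 Pinf :: "'a::alg_closed_field proj_line"
  assumes "P0 \<noteq> P1" "P0 \<noteq> Pinf" "P1 \<noteq> Pinf"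
  obtains f where "moebius f" "f (Fin 0) = P0" "f (Fin 1) = P1" "f Infty = Pinf"
proof -
  have rep: "\<exists>\<alpha> \<beta>. (\<alpha> \<noteq> 0 \<or> \<beta> \<noteq> 0) \<and> P = pt \<alpha> \<beta>" for P :: "'a proj_line"
  proof (cases P)
    case (Fin x)
    then show ?thesis by (intro exI[of _ x] exI[of _ 1]) (simp add: pt_def)
  next
    case Infty
    then show ?thesis by (intro exI[of _ 1] exI[of _ 0]) (simp add: pt_def)
  qed
  obtain a b where P0: "a \<noteq> 0 \<or> b \<noteq> 0" "P0 = pt a b" using rep by blast
  obtain c e where Pinf: "c \<noteq> 0 \<or> e \<noteq> 0" "Pinf = pt c e" using rep by blast
  obtain g h where P1: "g \<noteq> 0 \<or> h \<noteq> 0" "P1 = pt g h" using rep by blast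
  define \<Delta> where "\<Delta> = c * b - a * e"
  \<comment> \<open>Cramer's rule: the coordinate vectors of \<open>P0\<close> and
    \<open>Pinf\<close>, scaled by \<open>s\<close> and \<open>t\<close>, add up to a multiple of
    that of \<open>P1\<close>, so the map with these columns sends \<open>1\<close> to
    \<open>P1\<close>.\<close>
  define s t where "s = c * h - g * e" and "t = g * b - a * h"
  have nz: "\<Delta> \<noteq> 0" "s \<noteq> 0" "t \<noteq> 0"
    using assms unfolding P0(2) Pinf(2) P1(2) pt_eq_iff[OF P0(1) P1(1)] pt_eq_iff[OF P0(1) Pinf(1)]
      pt_eq_iff[OF P1(1) Pinf(1)] by (auto simp: \<Delta>_def s_def t_def)
  have comb: "s * a + t * c = \<Delta> * g" "s * b + t * e = \<Delta> * h"
    by (simp_all add: s_def t_def \<Delta>_def algebra_simps)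
  let ?u = "[:s * a, t * c:]" and ?v = "[:s * b, t * e:]"
  have "t * c * (s * b) - s * a * (t * e) = s * t * \<Delta>" by (simp add: \<Delta>_def algebra_simps)
  then have uv: "coprime ?u ?v" "rat_degree ?u ?v = 1"
    using linear_forms_coprime[of "t * c" "s * b" "s * a" "t * e"] nz by auto
  have "rat_map ?u ?v (Fin 0) = pt (s * a) (s * b)" "rat_map ?u ?v (Fin 1) = pt (\<Delta> * g) (\<Delta> * h)"
    "rat_map ?u ?v Infty = pt (t * c) (t * e)"
    unfolding rat_map_eq_pt uv(2) by (simp_all add: comb)
  then show ?thesis
    using that[of "rat_map ?u ?v"] uv nz P0(2) P1(2) Pinf(2) by (auto simp: moebius_def pt_scale)
qed

lemma moebius_fixing_0_infinity:
  assumes "moebius f" "f (Fin 0) = Fin 0" "f Infty = Infty"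
  obtains c where "c \<noteq> 0" "\<And>x. f (Fin x) = Fin (c * x)"
proof -
  obtain a b where ab: "coprime a b" "rat_degree a b = 1" "f = rat_map a b"
    using assms by (auto simp: moebius_def)
  obtain a0 a1 b0 b1 where lin: "a = [:a0, a1:]" "b = [:b0, b1:]" and \<Delta>: "a1 * b0 - a0 * b1 \<noteq> 0"
    using degree_1_forms[OF ab(1,2)] .
  have "b1 = 0" using assms(3) ab lin by (auto simp: Let_def split: if_splits)
  moreover have "a0 = 0" using assms(2) ab lin by (auto split: if_splits)
  ultimately have "f (Fin x) = Fin (a1 / b0 * x)" for x
    using ab(3) lin \<Delta> by auto
  then show ?thesis using that[of "a1 / b0"] \<Delta> \<open>b1 = 0\<close> by auto
qed

lemma moebius_scale:
  assumes "c \<noteq> 0"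
  shows "moebius (rat_map [:0, c:] [:1:])" "rat_map [:0, c:] [:1:] (Fin x) = Fin (c * x)"
    "rat_map [:0, c:] [:1:] Infty = Infty"
proof -
  show "moebius (rat_map [:0, c:] [:1:])"
    unfolding moebius_def using linear_forms_coprime[of c 1 0 0] assms
    by (intro exI[of _ "[:0, c:]"] exI[of _ "[:1:]"]) auto
qed (use assms in \<open>auto simp: rat_degree_def mult.commute\<close>)

lemma wronskian_nonzero_if_unramified:
  fixes a b :: "'a::alg_closed_field poly"
  assumes "coprime a b" "0 < rat_degree a b" and ram: "ram_index a b (Fin x) = 1"
  shows "wronskian a b \<noteq> 0"
proof
  assume w: "wronskian a b = 0"
  have key: "poly (wronskian g h) x \<noteq> 0" if "order x g = 1" "poly h x \<noteq> 0" "g \<noteq> 0" for g h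
  proof -
    have "poly g x = 0" using that(1) by (auto simp: order_root)
    then obtain k where k: "g = [:-x, 1:] * k" by (auto simp: poly_eq_0_iff_dvd elim: dvdE)
    have "poly k x \<noteq> 0"
    proof
      assume "poly k x = 0"
      then have "[:-x, 1:] ^ 2 dvd g"
        unfolding k power2_eq_square by (intro mult_dvd_mono) (simp_all only: poly_eq_0_iff_dvd dvd_refl)
      then show False using that(1) that(3) order_divides[of x 2 g] by simp
    qed
    moreover have "poly (pderiv g) x = poly k x"
      unfolding k pderiv_mult by (simp add: pderiv_pCons)
    ultimately show ?thesis using that(2) \<open>poly g x = 0\<close> by (simp add: wronskian_def)
  qed
  show False
  proof (cases "rat_map a b (Fin x)")
    case (Fin c)
    then have "poly b x \<noteq> 0" "order x (a - smult c b) = 1"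
      using ram by (auto simp: ram_index_def split: if_splits)
    moreover have "a - smult c b \<noteq> 0" using fibre_poly_nonzero[OF assms(1,2), of "Fin c"] by simp
    ultimately have "poly (wronskian (a - smult c b) b) x \<noteq> 0" using key by blast
    moreover have "wronskian (a - smult c b) b = wronskian a b"
      by (simp add: wronskian_def pderiv_diff pderiv_smult algebra_simps)
    ultimately show False using w by simp
  next
    case Infty
    then have b: "poly b x = 0" "order x b = 1"
      using ram by (auto simp: ram_index_def split: if_splits)
    then have "poly a x \<noteq> 0" using assms(1) by (auto simp: coprime_iff_no_common_root)
    moreover have "b \<noteq> 0" using fibre_poly_nonzero[OF assms(1,2), of Infty] by simp
    ultimately have "poly (wronskian b a) x \<noteq> 0" using key b by blast
    then show False using w wronskian_minus_swap[of b a] by simp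
  qed
qed

text \<open>Two fractions of the same map differ by a scalar, which changes neither degree nor
  ramification. Separability is read off at an unramified finite point; there is one because the
  fibres over \<open>Qs\<close> are finite and the field is infinite.\<close>

lemma covers_iff:
  fixes a b :: "'a::alg_closed_field poly"
  assumes cop: "coprime a b" and d: "0 < d"
  shows "rat_map a b \<in> covers d Qs Cs \<longleftrightarrow> rat_degree a b = d \<and>
    (\<forall>P. rat_map a b P \<notin> set Qs \<longrightarrow> ram_index a b P = 1) \<and> length Qs = length Cs \<and>
    (\<forall>i < length Qs. image_mset (ram_index a b) (mset_set {P. rat_map a b P = Qs ! i}) = Cs ! i)"
    (is "_ \<longleftrightarrow> ?R a b")
proof
  assume "rat_map a b \<in> covers d Qs Cs"
  then obtain a' b' where ab': "coprime a' b'" "rat_map a b = rat_map a' b'" "?R a' b'"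
    unfolding covers_def by auto
  obtain c where c: "c \<noteq> 0" "a' = smult c a" "b' = smult c b"
    using rat_map_unique[OF cop ab'(1,2)] .
  have "ram_index a' b' = ram_index a b" using ram_index_smult[OF c(1)] c by auto
  moreover have "rat_degree a' b' = rat_degree a b" using c by (simp add: rat_degree_smult)
  ultimately show "?R a b" using ab'(2,3) by metis
next
  assume R: "?R a b"
  have "finite (\<Union>Q\<in>set Qs. {P. rat_map a b P = Q})" using fibre(1)[OF cop] R d by auto
  then have "\<not> range Fin \<subseteq> (\<Union>Q\<in>set Qs. {P. rat_map a b P = Q})"
    using infinite_UNIV_alg_closed finite_imageD[of Fin "UNIV :: 'a set"] finite_subset
    by (metis inj_onI proj_line.inject)
  then obtain x where "rat_map a b (Fin x) \<notin> set Qs" by blast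
  then have "wronskian a b \<noteq> 0" using R cop d wronskian_nonzero_if_unramified by blast
  then show "rat_map a b \<in> covers d Qs Cs"
    using R cop unfolding covers_def wronskian_def by blast
qed

section \<open>Automorphisms of source and target acting on covers\<close>

lemma covers_comp_moebius:
  assumes f: "f \<in> covers d Qs Cs" and d: "0 < d" and g: "moebius g"
  shows "f \<circ> g \<in> covers d Qs Cs"
proof -
  obtain u v where uv: "coprime u v" "f = rat_map u v" using f by (auto simp: covers_def)
  obtain a b where ab: "coprime a b" "rat_degree a b = 1" "g = rat_map a b" using g by (auto simp: moebius_def)
  note R = iffD1[OF covers_iff[OF uv(1) d] f[unfolded uv(2)]]
  define U V where "U = homog d u a b" and "V = homog d v a b"
  have cop: "coprime U V" and deg: "rat_degree U V = d" and map: "f \<circ> g = rat_map U V"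
    using rat_map_comp[OF uv(1) ab(1)] R ab uv unfolding U_def V_def by simp_all
  have ram: "ram_index U V P = ram_index u v (g P)" for P
    using ram_index_comp[OF uv(1) ab(1,2), of P] R d ab(3) unfolding U_def V_def by simp
  have map': "rat_map U V P = f (g P)" for P using map by (metis comp_apply)
  have "image_mset (ram_index U V) (mset_set {P. rat_map U V P = Q})
      = image_mset (ram_index u v) (mset_set {P. rat_map u v P = Q})" for Q
  proof -
    have "g ` {P. rat_map U V P = Q} = {P. f P = Q}"
      using moebius_bij[OF g] unfolding map' by (auto simp: image_iff bij_def surj_def)
    moreover have "image_mset g (mset_set {P. rat_map U V P = Q}) = mset_set (g ` {P. rat_map U V P = Q})"
      using moebius_bij[OF g] by (intro image_mset_mset_set) (auto simp: bij_def inj_on_def)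
    moreover have "ram_index U V = ram_index u v \<circ> g" using ram by auto
    then have "image_mset (ram_index U V) M = image_mset (ram_index u v) (image_mset g M)" for M
      by (simp add: multiset.map_comp)
    ultimately show ?thesis by (simp add: uv(2))
  qed
  then show ?thesis
    unfolding map covers_iff[OF cop d] using R deg ram map' uv(2) by simp
qed

lemma moebius_comp_covers:
  assumes f: "f \<in> covers d Qs Cs" and d: "0 < d" and g: "moebius g"
  shows "g \<circ> f \<in> covers d (map g Qs) Cs"
proof -
  obtain u v where uv: "coprime u v" "f = rat_map u v" using f by (auto simp: covers_def)
  obtain a b where ab: "coprime a b" "rat_degree a b = 1" "g = rat_map a b" using g by (auto simp: moebius_def)
  note R = iffD1[OF covers_iff[OF uv(1) d] f[unfolded uv(2)]]
  define U V where "U = homog 1 a u v" and "V = homog 1 b u v"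
  have cop: "coprime U V" and deg: "rat_degree U V = d" and map: "g \<circ> f = rat_map U V"
    using rat_map_comp[OF ab(1) uv(1)] R ab uv unfolding U_def V_def by simp_all
  have ram: "ram_index U V = ram_index u v"
    using ram_index_comp_left[OF ab(1,2) uv(1)] unfolding U_def V_def by blast
  have map': "rat_map U V P = g (f P)" for P using map by (metis comp_apply)
  have inj: "g x = g y \<longleftrightarrow> x = y" for x y using moebius_bij[OF g] by (metis bij_pointE)
  show ?thesis
    unfolding map covers_iff[OF cop d] using R deg by (auto simp: ram map' inj uv(2) simp del: rat_map.simps)
qed

lemma cover_iso_iff:
  assumes "0 < d"
  shows "(f, g) \<in> cover_iso d Qs Cs \<longleftrightarrow> f \<in> covers d Qs Cs \<and> (\<exists>h. moebius h \<and> g = f \<circ> h)"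
  unfolding cover_iso_def line_automorphism_iff_moebius using covers_comp_moebius[OF _ assms] by auto

lemma moebius_id: "moebius id"
  using rat_map_id[of "1 :: 'a"] linear_forms_coprime[of "1::'a" 1 0 0] by (force simp: moebius_def)

lemma equiv_cover_iso:
  assumes "0 < d"
  shows "equiv (covers d Qs Cs) (cover_iso d Qs Cs)"
proof (rule equivI)
  show "refl_on (covers d Qs Cs) (cover_iso d Qs Cs)"
    using moebius_id by (force simp: refl_on_def cover_iso_iff[OF assms])
  show "sym (cover_iso d Qs Cs)"
  proof (rule symI)
    fix f g assume "(f, g) \<in> cover_iso d Qs Cs"
    then obtain h where h: "f \<in> covers d Qs Cs" "moebius h" "g = f \<circ> h" by (auto simp: cover_iso_iff[OF assms])
    obtain k where k: "moebius k" "h \<circ> k = id" using moebius_inverse[OF h(2)] by blast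
    have "f = g \<circ> k" using h k by (simp add: comp_assoc)
    then show "(g, f) \<in> cover_iso d Qs Cs"
      using h k covers_comp_moebius[OF h(1) assms h(2)] by (auto simp: cover_iso_iff[OF assms])
  qed
  show "trans (cover_iso d Qs Cs)"
    using moebius_comp by (force simp: trans_def cover_iso_iff[OF assms] comp_assoc)
qed (auto simp: cover_iso_def)

section \<open>Covers with marked ramification points\<close>

definition morphism_degree :: "('a::alg_closed_field proj_line \<Rightarrow> 'a proj_line) \<Rightarrow> nat" where
  "morphism_degree f = (THE n. \<exists>a b. coprime a b \<and> f = rat_map a b \<and> rat_degree a b = n)"

text \<open>Well defined for a morphism by \<open>rat_map_unique\<close>; it allows statements about
  covers without a chosen fraction.\<close>

definition ramification :: "('a::alg_closed_field proj_line \<Rightarrow> 'a proj_line) \<Rightarrow> 'a proj_line \<Rightarrow> nat" where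
  "ramification f P = (THE n. \<exists>a b. coprime a b \<and> f = rat_map a b \<and> ram_index a b P = n)"

lemma morphism_degree_rat_map:
  assumes "coprime a b"
  shows "morphism_degree (rat_map a b) = rat_degree a b"
  unfolding morphism_degree_def
proof (rule the_equality)
  fix n assume "\<exists>a' b'. coprime a' b' \<and> rat_map a b = rat_map a' b' \<and> rat_degree a' b' = n"
  then obtain a' b' where *: "coprime a' b'" "rat_map a b = rat_map a' b'" "rat_degree a' b' = n" by blast
  obtain c where "c \<noteq> 0" "a' = smult c a" "b' = smult c b" using rat_map_unique[OF assms *(1,2)] .
  then show "n = rat_degree a b" using *(3) by (simp add: rat_degree_smult)
qed (use assms in blast)

lemma ramification_rat_map:
  assumes "coprime a b"
  shows "ramification (rat_map a b) P = ram_index a b P"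
  unfolding ramification_def
proof (rule the_equality)
  fix n assume "\<exists>a' b'. coprime a' b' \<and> rat_map a b = rat_map a' b' \<and> ram_index a' b' P = n"
  then obtain a' b' where *: "coprime a' b'" "rat_map a b = rat_map a' b'" "ram_index a' b' P = n" by blast
  obtain c where "c \<noteq> 0" "a' = smult c a" "b' = smult c b" using rat_map_unique[OF assms *(1,2)] .
  then show "n = ram_index a b P" using *(3) by (simp add: ram_index_smult)
qed (use assms in blast)

lemma comp_moebius:
  assumes "line_morphism f" "0 < morphism_degree f" "moebius g"
  shows "line_morphism (f \<circ> g)" "morphism_degree (f \<circ> g) = morphism_degree f"
    "ramification (f \<circ> g) P = ramification f (g P)"
proof -
  obtain u v where uv: "coprime u v" "f = rat_map u v" using assms(1) by (auto simp: line_morphism_def)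
  obtain a b where ab: "coprime a b" "rat_degree a b = 1" "g = rat_map a b"
    using assms(3) by (auto simp: moebius_def)
  define U V where "U = homog (rat_degree u v) u a b" and "V = homog (rat_degree u v) v a b"
  have UV: "coprime U V" "rat_degree U V = rat_degree u v" "f \<circ> g = rat_map U V"
    using rat_map_comp[OF uv(1) ab(1)] ab uv by (simp_all add: U_def V_def)
  show "line_morphism (f \<circ> g)" using UV by (auto simp: line_morphism_def)
  show "morphism_degree (f \<circ> g) = morphism_degree f"
    using UV uv by (simp add: morphism_degree_rat_map)
  have "0 < rat_degree u v" using assms(2) uv by (simp add: morphism_degree_rat_map)
  then show "ramification (f \<circ> g) P = ramification f (g P)"
    unfolding UV(3) ramification_rat_map[OF UV(1)] unfolding uv(2) ramification_rat_map[OF uv(1)]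
    using ram_index_comp[OF uv(1) ab(1,2)] ab(3) by (simp add: U_def V_def)
qed

text \<open>The number of entries 1 is determined by the sum of the indices, which for a fibre is
  the degree.\<close>

lemma one_cycle_iff:
  assumes fin: "finite S" and sum: "sum r S = d" and e: "1 < e"
  shows "image_mset r (mset_set S) = one_cycle d e \<longleftrightarrow>
    (\<exists>P\<in>S. r P = e \<and> (\<forall>P'\<in>S - {P}. r P' = 1))"
proof
  assume eq: "image_mset r (mset_set S) = one_cycle d e"
  then have "e \<in># image_mset r (mset_set S)" by (simp add: one_cycle_def)
  then obtain P where P: "P \<in> S" "r P = e" using fin by auto
  have "mset_set S = add_mset P (mset_set (S - {P}))" using P fin by (simp add: mset_set.remove)
  then have "image_mset r (mset_set (S - {P})) = replicate_mset (d - e) 1"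
    using eq P by (simp add: one_cycle_def)
  then have "r P' = 1" if "P' \<in> S - {P}" for P'
    using that fin by (metis finite_Diff finite_set_mset_mset_set image_eqI in_replicate_mset set_image_mset)
  then show "\<exists>P\<in>S. r P = e \<and> (\<forall>P'\<in>S - {P}. r P' = 1)" using P by blast
next
  assume "\<exists>P\<in>S. r P = e \<and> (\<forall>P'\<in>S - {P}. r P' = 1)"
  then obtain P where P: "P \<in> S" "r P = e" "\<And>P'. P' \<in> S - {P} \<Longrightarrow> r P' = 1" by blast
  have "mset_set S = add_mset P (mset_set (S - {P}))" using P fin by (simp add: mset_set.remove)
  moreover have "image_mset r (mset_set (S - {P})) = image_mset (\<lambda>_. 1) (mset_set (S - {P}))"
    using P(3) fin by (intro image_mset_cong) auto
  moreover have "d = e + card (S - {P})"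
    using sum sum.remove[OF fin P(1), of r] P(2,3) by simp
  ultimately show "image_mset r (mset_set S) = one_cycle d e"
    using P by (simp add: one_cycle_def image_mset_const_eq)
qed

lemma two_cycles_iff:
  assumes fin: "finite S" and sum: "sum r S = d" and e: "1 < e" "1 < e'"
  shows "image_mset r (mset_set S) = two_cycles d e e' \<longleftrightarrow>
    (\<exists>P\<in>S. \<exists>P'\<in>S. P \<noteq> P' \<and> r P = e \<and> r P' = e' \<and> (\<forall>P''\<in>S - {P, P'}. r P'' = 1))"
    (is "_ \<longleftrightarrow> ?R")
proof
  assume eq: "image_mset r (mset_set S) = two_cycles d e e'"
  then have "e \<in># image_mset r (mset_set S)" by (simp add: two_cycles_def)
  then obtain P where P: "P \<in> S" "r P = e" using fin by auto
  have "mset_set S = add_mset P (mset_set (S - {P}))" using P fin by (simp add: mset_set.remove)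
  then have "image_mset r (mset_set (S - {P})) = one_cycle (d - e) e'"
    using eq P by (simp add: two_cycles_def one_cycle_def)
  moreover have "sum r (S - {P}) = d - e" using sum sum.remove[OF fin P(1), of r] P(2) by simp
  ultimately obtain P' where "P' \<in> S - {P}" "r P' = e'" "\<forall>P''\<in>S - {P} - {P'}. r P'' = 1"
    using one_cycle_iff[of "S - {P}" r "d - e" e'] fin e by auto
  then show ?R using P by (intro bexI[of _ P] bexI[of _ P']) auto
next
  assume ?R
  then obtain P P' where P: "P \<in> S" "P' \<in> S" "P \<noteq> P'" "r P = e" "r P' = e'"
    "\<forall>P''\<in>S - {P, P'}. r P'' = 1" by blast
  have s: "sum r (S - {P}) = d - e" "e \<le> d" using sum sum.remove[OF fin P(1), of r] P(4) by simp_all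
  have "image_mset r (mset_set (S - {P})) = one_cycle (d - e) e'"
    using P fin s(1) e by (subst one_cycle_iff) (auto intro!: bexI[of _ P'])
  moreover have "mset_set S = add_mset P (mset_set (S - {P}))" using P fin by (simp add: mset_set.remove)
  ultimately show "image_mset r (mset_set S) = two_cycles d e e'"
    using P(4) by (simp add: two_cycles_def one_cycle_def)
qed

definition marked :: "nat \<Rightarrow> nat \<Rightarrow> nat \<Rightarrow> nat \<Rightarrow> nat \<Rightarrow> ('a::alg_closed_field proj_line \<Rightarrow> 'a proj_line) \<Rightarrow>
    'a proj_line \<Rightarrow> 'a proj_line \<Rightarrow> 'a proj_line \<Rightarrow> 'a proj_line \<Rightarrow> bool" where
  "marked d e1 e2 e3 e4 f P1 P2 P3 P4 \<longleftrightarrow>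
     line_morphism f \<and> morphism_degree f = d \<and> P1 \<noteq> P2 \<and>
     f P1 = Fin 1 \<and> f P2 = Fin 1 \<and> f P3 = Fin 0 \<and> f P4 = Infty \<and>
     ramification f P1 = e1 \<and> ramification f P2 = e2 \<and>
     ramification f P3 = e3 \<and> ramification f P4 = e4 \<and>
     (\<forall>P. P \<notin> {P1, P2, P3, P4} \<longrightarrow> ramification f P = 1)"

lemma covers_iff_marked:
  fixes f :: "'a::alg_closed_field proj_line \<Rightarrow> 'a proj_line"
  assumes d: "0 < d" and e: "1 < e1" "1 < e2" "1 < e3" "1 < e4"
  shows "f \<in> covers d [Fin 1, Fin 0, Infty] [two_cycles d e1 e2, one_cycle d e3, one_cycle d e4] \<longleftrightarrow>
    (\<exists>P1 P2 P3 P4. marked d e1 e2 e3 e4 f P1 P2 P3 P4)"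
proof (cases "line_morphism f \<and> morphism_degree f = d")
  case False
  then show ?thesis
    by (auto simp: covers_def marked_def line_morphism_def morphism_degree_rat_map)
next
  case True
  then obtain a b where ab: "coprime a b" "f = rat_map a b" "rat_degree a b = d"
    by (auto simp: line_morphism_def morphism_degree_rat_map)
  let ?r = "ramification f"
  have r: "ram_index a b = ?r" by (rule ext) (simp add: ab(2) ramification_rat_map[OF ab(1)])
  define S where "S Q = {P. f P = Q}" for Q
  have S: "finite (S Q)" "sum ?r (S Q) = d" for Q
    using fibre[OF ab(1), of Q] ab d unfolding S_def r by auto
  have "f \<in> covers d [Fin 1, Fin 0, Infty] [two_cycles d e1 e2, one_cycle d e3, one_cycle d e4] \<longleftrightarrow>
     (\<forall>P. f P \<notin> {Fin 1, Fin 0, Infty} \<longrightarrow> ?r P = 1) \<and>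
     image_mset ?r (mset_set (S (Fin 1))) = two_cycles d e1 e2 \<and>
     image_mset ?r (mset_set (S (Fin 0))) = one_cycle d e3 \<and>
     image_mset ?r (mset_set (S Infty)) = one_cycle d e4"
    using covers_iff[OF ab(1) d, of "[Fin 1, Fin 0, Infty]"] ab(2,3) unfolding r S_def
    by (simp add: All_less_Suc2 numeral_eq_Suc)
  also have "\<dots> \<longleftrightarrow> (\<forall>P. f P \<notin> {Fin 1, Fin 0, Infty} \<longrightarrow> ?r P = 1) \<and>
     (\<exists>P1\<in>S (Fin 1). \<exists>P2\<in>S (Fin 1). P1 \<noteq> P2 \<and> ?r P1 = e1 \<and> ?r P2 = e2 \<and> (\<forall>P\<in>S (Fin 1) - {P1, P2}. ?r P = 1)) \<and>
     (\<exists>P3\<in>S (Fin 0). ?r P3 = e3 \<and> (\<forall>P\<in>S (Fin 0) - {P3}. ?r P = 1)) \<and>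
     (\<exists>P4\<in>S Infty. ?r P4 = e4 \<and> (\<forall>P\<in>S Infty - {P4}. ?r P = 1))"
    unfolding two_cycles_iff[OF S e(1,2)] one_cycle_iff[OF S e(3)] one_cycle_iff[OF S e(4)] ..
  also have "\<dots> \<longleftrightarrow> (\<exists>P1 P2 P3 P4. marked d e1 e2 e3 e4 f P1 P2 P3 P4)"
    (is "?A \<longleftrightarrow> ?B")
  proof
    assume ?A
    then obtain P1 P2 P3 P4 where *: "\<forall>P. f P \<notin> {Fin 1, Fin 0, Infty} \<longrightarrow> ?r P = 1"
      "f P1 = Fin 1" "f P2 = Fin 1" "P1 \<noteq> P2" "?r P1 = e1" "?r P2 = e2" "\<forall>P\<in>S (Fin 1) - {P1, P2}. ?r P = 1"
      "f P3 = Fin 0" "?r P3 = e3" "\<forall>P\<in>S (Fin 0) - {P3}. ?r P = 1"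
      "f P4 = Infty" "?r P4 = e4" "\<forall>P\<in>S Infty - {P4}. ?r P = 1"
      unfolding S_def by blast
    have "?r P = 1" if "P \<notin> {P1, P2, P3, P4}" for P
      using * that unfolding S_def by (cases "f P = Fin 1"; cases "f P = Fin 0"; cases "f P = Infty") auto
    then show ?B using * True unfolding marked_def by blast
  next
    assume ?B
    then obtain P1 P2 P3 P4 where m: "marked d e1 e2 e3 e4 f P1 P2 P3 P4" by blast
    have 1: "?r P = 1" if "f P \<notin> {Fin 1, Fin 0, Infty}" for P
      using m that unfolding marked_def by auto
    have vals: "f P1 = Fin 1" "f P2 = Fin 1" "f P3 = Fin 0" "f P4 = Infty"
      and ram: "P1 \<noteq> P2" "?r P1 = e1" "?r P2 = e2" "?r P3 = e3" "?r P4 = e4"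
      using m unfolding marked_def by simp_all
    have sp: "?r P = 1 \<or> P = P1 \<or> P = P2 \<or> P = P3 \<or> P = P4" for P
      using m unfolding marked_def by blast
    have rest: "\<forall>P\<in>S (Fin 1) - {P1, P2}. ?r P = 1" "\<forall>P\<in>S (Fin 0) - {P3}. ?r P = 1"
      "\<forall>P\<in>S Infty - {P4}. ?r P = 1"
      using sp vals unfolding S_def by fastforce+
    have "P1 \<in> S (Fin 1)" "P2 \<in> S (Fin 1)" "P3 \<in> S (Fin 0)" "P4 \<in> S Infty"
      using vals by (simp_all add: S_def)
    then show ?A using 1 ram rest
      by (intro conjI allI impI) (assumption | rule bexI conjI | simp)+
  qed
  finally show ?thesis .
qed

lemma marked_comp:
  assumes "0 < d" "moebius g" "line_morphism f" "morphism_degree f = d"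
  shows "marked d e1 e2 e3 e4 (f \<circ> g) P1 P2 P3 P4 \<longleftrightarrow> marked d e1 e2 e3 e4 f (g P1) (g P2) (g P3) (g P4)"
proof -
  have b: "bij g" using moebius_bij assms(2) .
  have inj: "g x = g y \<longleftrightarrow> x = y" for x y using bij_is_inj[OF b] by (rule inj_eq)
  have "(\<forall>P. P \<notin> {P1, P2, P3, P4} \<longrightarrow> ramification f (g P) = 1) \<longleftrightarrow>
    (\<forall>P. P \<notin> {g P1, g P2, g P3, g P4} \<longrightarrow> ramification f P = 1)"
  proof (intro iffI allI impI)
    fix P assume "\<forall>P. P \<notin> {P1, P2, P3, P4} \<longrightarrow> ramification f (g P) = 1" "P \<notin> {g P1, g P2, g P3, g P4}"
    moreover obtain Q where "P = g Q" using bij_is_surj[OF b] by (elim surjE)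
    ultimately show "ramification f P = 1" by auto
  next
    fix P assume "\<forall>P. P \<notin> {g P1, g P2, g P3, g P4} \<longrightarrow> ramification f P = 1" "P \<notin> {P1, P2, P3, P4}"
    then show "ramification f (g P) = 1" using inj by simp
  qed
  then show ?thesis
    using comp_moebius[OF assms(3) _ assms(2)] assms inj by (simp add: marked_def)
qed

text \<open>The marked points are the only ramified ones, and their images 1, 0 and infinity tell
  \<open>P3\<close> and \<open>P4\<close> from the pair over 1. Within this pair only equal indices
  allow an exchange.\<close>

lemma marked_unique:
  fixes f :: "'a::alg_closed_field proj_line \<Rightarrow> 'a proj_line"
  assumes "marked d e1 e2 e3 e4 f P1 P2 P3 P4" "marked d e1 e2 e3 e4 f P1' P2' P3' P4'"
    and "1 < e1" "1 < e2" "1 < e3" "1 < e4"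
  shows "P3 = P3'" "P4 = P4'" "P1 = P1' \<and> P2 = P2' \<or> e1 = e2 \<and> P1 = P2' \<and> P2 = P1'"
proof -
  have sp: "P = P1' \<or> P = P2' \<or> P = P3' \<or> P = P4'" if "ramification f P \<noteq> 1" for P
    using assms(2) that unfolding marked_def by blast
  have m: "P1 \<noteq> P2" "f P1 = Fin 1" "f P2 = Fin 1" "f P3 = Fin 0" "f P4 = Infty"
    "ramification f P1 = e1" "ramification f P2 = e2" "ramification f P3 = e3" "ramification f P4 = e4"
    using assms(1) unfolding marked_def by simp_all
  have m': "f P1' = Fin 1" "f P2' = Fin 1" "f P3' = Fin 0" "f P4' = Infty"
    "ramification f P1' = e1" "ramification f P2' = e2"
    using assms(2) unfolding marked_def by simp_all
  have ne: "(Fin 1 :: 'a proj_line) \<noteq> Fin 0" by simp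
  show "P3 = P3'" using sp[of P3] m m' assms(5) ne by (metis less_irrefl proj_line.distinct(1))
  show "P4 = P4'" using sp[of P4] m m' assms(6) by (metis less_irrefl proj_line.distinct(1))
  have "P1 = P1' \<or> P1 = P2'" "P2 = P1' \<or> P2 = P2'"
    using sp[of P1] sp[of P2] m m' assms(3,4) ne by (metis less_irrefl proj_line.distinct(1))+
  then show "P1 = P1' \<and> P2 = P2' \<or> e1 = e2 \<and> P1 = P2' \<and> P2 = P1'" using m m' by metis
qed

lemma card_quotient_transfer:
  assumes R: "equiv X R" and T: "equiv L T" and \<phi>: "\<And>l. l \<in> L \<Longrightarrow> \<phi> l \<in> X"
    and surj: "\<And>x. x \<in> X \<Longrightarrow> \<exists>l\<in>L. (\<phi> l, x) \<in> R"
    and iff: "\<And>l l'. l \<in> L \<Longrightarrow> l' \<in> L \<Longrightarrow> (\<phi> l, \<phi> l') \<in> R \<longleftrightarrow> (l, l') \<in> T"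
  shows "card (X // R) = card (L // T)"
proof -
  have im: "R `` (\<phi> ` (T `` {l})) = R `` {\<phi> l}" if l: "l \<in> L" for l
  proof -
    have "R `` {\<phi> l'} = R `` {\<phi> l}" if "l' \<in> T `` {l}" for l'
    proof -
      have "l' \<in> L" "(l, l') \<in> T" using that T by (auto dest: equiv_type)
      then have "(\<phi> l, \<phi> l') \<in> R" using iff l by blast
      then show ?thesis using equiv_class_eq[OF R] by metis
    qed
    moreover have "l \<in> T `` {l}" using equiv_class_self[OF T l] .
    ultimately show ?thesis by blast
  qed
  have "bij_betw (\<lambda>C. R `` (\<phi> ` C)) (L // T) (X // R)"
    unfolding bij_betw_def
  proof
    show "inj_on (\<lambda>C. R `` (\<phi> ` C)) (L // T)"
    proof (rule inj_onI)
      fix C C' assume "C \<in> L // T" "C' \<in> L // T" and eq: "R `` (\<phi> ` C) = R `` (\<phi> ` C')"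
      then obtain l l' where l: "l \<in> L" "C = T `` {l}" "l' \<in> L" "C' = T `` {l'}" by (auto elim!: quotientE)
      then have "R `` {\<phi> l} = R `` {\<phi> l'}" using eq im by metis
      then have "(\<phi> l, \<phi> l') \<in> R" using eq_equiv_class[OF _ R] \<phi> l by blast
      then show "C = C'" using iff l equiv_class_eq[OF T] by metis
    qed
    show "(\<lambda>C. R `` (\<phi> ` C)) ` (L // T) = X // R"
    proof (intro equalityI subsetI)
      fix D assume "D \<in> (\<lambda>C. R `` (\<phi> ` C)) ` (L // T)"
      then obtain l where l: "l \<in> L" "D = R `` (\<phi> ` (T `` {l}))" by (auto elim: quotientE)
      show "D \<in> X // R" unfolding l(2) im[OF l(1)] using \<phi>[OF l(1)] by (rule quotientI)
    next
      fix D assume "D \<in> X // R"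
      then obtain x where x: "x \<in> X" "D = R `` {x}" by (auto elim: quotientE)
      then obtain l where l: "l \<in> L" "(\<phi> l, x) \<in> R" using surj by blast
      then have "D = R `` (\<phi> ` (T `` {l}))"
        unfolding im[OF l(1)] x(2) equiv_class_eq[OF R l(2)] by simp
      moreover have "T `` {l} \<in> L // T" using l(1) by (rule quotientI)
      ultimately show "D \<in> (\<lambda>C. R `` (\<phi> ` C)) ` (L // T)" by (rule image_eqI)
    qed
  qed
  then show ?thesis by (metis bij_betw_same_card)
qed

section \<open>Counting covers\<close>

locale four_point = pade +
  assumes gt1: "1 < e1" "1 < e2"
begin

abbreviation "d \<equiv> e1 + e2 + m"
abbreviation "e3 \<equiv> q + m + 1"
abbreviation "e4 \<equiv> e1 + e2 + m + 1 - q"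

abbreviation marked_cover :: "('a proj_line \<Rightarrow> 'a proj_line) \<Rightarrow>
    'a proj_line \<Rightarrow> 'a proj_line \<Rightarrow> 'a proj_line \<Rightarrow> 'a proj_line \<Rightarrow> bool" where
  "marked_cover \<equiv> marked d e1 e2 e3 e4"

abbreviation normal_cover :: "'a \<Rightarrow> ('a proj_line \<Rightarrow> 'a proj_line) \<Rightarrow> bool" where
  "normal_cover l f \<equiv> marked_cover f (Fin 1) (Fin l) (Fin 0) Infty"

lemma d_pos: "0 < d" and e3_gt: "1 < e3" and e4_gt: "1 < e4"
  using pos by auto

section \<open>Covers in normal form and roots of the determinant\<close>

lemma normal_coverE:
  assumes "normal_cover l f"
  obtains a b where "coprime a b" "f = rat_map a b" "rat_degree a b = d" "l \<noteq> 1" "l \<noteq> 0"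
    "order 0 a = e3" "degree b < q" "order 1 (a - b) = e1" "order l (a - b) = e2" "poly b 0 \<noteq> 0"
proof -
  obtain a b where ab: "coprime a b" "f = rat_map a b"
    using assms by (auto simp: marked_def line_morphism_def)
  have deg: "rat_degree a b = d" using assms ab by (simp add: marked_def morphism_degree_rat_map)
  have f: "f (Fin 1) = Fin 1" "f (Fin l) = Fin 1" "f (Fin 0) = Fin 0" "f Infty = Infty" "l \<noteq> 1"
    using assms by (auto simp: marked_def)
  have r: "ram_index a b (Fin 1) = e1" "ram_index a b (Fin l) = e2" "ram_index a b (Fin 0) = e3"
    "ram_index a b Infty = e4"
    using assms unfolding ab(2) by (auto simp: marked_def ramification_rat_map[OF ab(1)])
  have "order 0 a = e3" "order 1 (a - b) = e1" "order l (a - b) = e2" "d - degree b = e4"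
    using r f unfolding ram_index_eq ab(2) deg by simp_all
  moreover have "l \<noteq> 0" using f by auto
  moreover have "poly b 0 \<noteq> 0" using f(3) ab(2) by (auto split: if_splits)
  moreover have "degree b < q" using \<open>d - degree b = e4\<close> pos by linarith
  ultimately show ?thesis using that[OF ab deg] f(5) by blast
qed

text \<open>Converse of \<open>solutionE\<close>: the ramification over 1 yields the factor
  \<open>F l\<close>, that at 0 and infinity yields the gap.\<close>

lemma normal_cover_kernel:
  assumes ab: "coprime a b" "rat_degree a b = d" "l \<noteq> 1" "order 0 a = e3" "degree b < q"
    "order 1 (a - b) = e1" "order l (a - b) = e2"
  obtains c where "F l * c = a - b" "c \<noteq> 0" "degree c \<le> m" "\<forall>i\<le>m. coeff (F l * c) (q + i) = 0"
    "\<forall>i<q + m + 1. coeff a i = 0" "\<forall>i\<ge>q. coeff b i = 0"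
proof -
  have g: "a - b \<noteq> 0" using fibre_poly_nonzero[of a b "Fin 1"] ab d_pos by simp
  have "[:-1, 1:] ^ e1 dvd a - b" "[:-l, 1:] ^ e2 dvd a - b"
    using order_1[of 1 "a - b"] order_1[of l "a - b"] ab by simp_all
  then have "F l dvd a - b"
    unfolding F_def using ab(3) by (intro linear_power_mult_dvd) (auto simp: poly_power)
  then obtain c where c: "F l * c = a - b" by (metis dvdE)
  then have c0: "c \<noteq> 0" using g by auto
  have "degree (a - b) \<le> d" using ab(2) degree_diff_le_max[of a b] by (simp add: rat_degree_def)
  then have "degree c \<le> m" using c0 by (simp flip: c add: degree_mult_eq degree_F)
  moreover have lo: "coeff a i = 0" if "i < q + m + 1" for i
  proof -
    have "[:-0, 1:] ^ (q + m + 1) dvd a" using order_1[of 0 a] unfolding ab(4) .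
    then have "monom 1 (q + m + 1) dvd a" by (simp only: monom_altdef smult_1_left minus_zero)
    then show ?thesis using that by (auto simp: monom_1_dvd_iff' elim: dvdE)
  qed
  moreover have hi: "coeff b i = 0" if "i \<ge> q" for i using ab(5) that by (simp add: coeff_eq_0)
  moreover have "coeff (F l * c) (q + i) = 0" if "i \<le> m" for i
    unfolding c using lo[of "q + i"] hi[of "q + i"] that by simp
  ultimately show ?thesis using that[OF c c0] by blast
qed

lemma normal_cover_crit:
  assumes "normal_cover l f"
  shows "l \<in> crit"
proof -
  obtain a b where ab: "coprime a b" "f = rat_map a b" "rat_degree a b = d" "l \<noteq> 1" "l \<noteq> 0"
    "order 0 a = e3" "degree b < q" "order 1 (a - b) = e1" "order l (a - b) = e2" "poly b 0 \<noteq> 0"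
    by (rule normal_coverE[OF assms])
  obtain c where "F l * c = a - b" and c: "c \<noteq> 0" "degree c \<le> m" "\<forall>i\<le>m. coeff (F l * c) (q + i) = 0"
    by (rule normal_cover_kernel[OF ab(1,3,4,6-9)])
  then show ?thesis unfolding crit_def using ab(4,5) poly_DD_eq_0_iff by blast
qed

text \<open>The differences \<open>a - b\<close> and \<open>a' - b'\<close> are proportional by
  \<open>kernel_unique\<close>. As the gap separates the exponents of numerator and denominator,
  both are proportional with the same factor.\<close>

lemma normal_cover_unique:
  assumes "normal_cover l f" "normal_cover l f'"
  shows "f = f'"
proof -
  obtain a b where ab: "coprime a b" "f = rat_map a b" "rat_degree a b = d" "l \<noteq> 1" "l \<noteq> 0"
    "order 0 a = e3" "degree b < q" "order 1 (a - b) = e1" "order l (a - b) = e2" "poly b 0 \<noteq> 0"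
    by (rule normal_coverE[OF assms(1)])
  obtain a' b' where ab': "coprime a' b'" "f' = rat_map a' b'" "rat_degree a' b' = d" "l \<noteq> 1" "l \<noteq> 0"
    "order 0 a' = e3" "degree b' < q" "order 1 (a' - b') = e1" "order l (a' - b') = e2" "poly b' 0 \<noteq> 0"
    by (rule normal_coverE[OF assms(2)])
  obtain c where c: "F l * c = a - b" "c \<noteq> 0" "degree c \<le> m" "\<forall>i\<le>m. coeff (F l * c) (q + i) = 0"
    "\<forall>i<q + m + 1. coeff a i = 0" "\<forall>i\<ge>q. coeff b i = 0"
    by (rule normal_cover_kernel[OF ab(1,3,4,6-9)])
  obtain c' where c': "F l * c' = a' - b'" "c' \<noteq> 0" "degree c' \<le> m" "\<forall>i\<le>m. coeff (F l * c') (q + i) = 0"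
    "\<forall>i<q + m + 1. coeff a' i = 0" "\<forall>i\<ge>q. coeff b' i = 0"
    by (rule normal_cover_kernel[OF ab'(1,3,4,6-9)])
  obtain k where k: "c' = smult k c"
    using kernel_unique[OF ab(5,4) c(2,3) _ c'(3)] c(4) c'(4) by blast
  then have k0: "k \<noteq> 0" using c'(2) by auto
  have "a' - b' = smult k (a - b)" using c(1) c'(1) k by (metis mult_smult_right)
  then have *: "coeff a' i - coeff b' i = k * (coeff a i - coeff b i)" for i
    by (metis coeff_diff coeff_smult)
  have "coeff a' i = k * coeff a i \<and> coeff b' i = k * coeff b i" for i
    using *[of i] c(5,6) c'(5,6) by (cases "i < q") (auto simp: not_less)
  then have "a' = smult k a" "b' = smult k b" by (auto simp: poly_eq_iff)
  then show ?thesis using ab(2) ab'(2) rat_map_smult[OF k0] by simp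
qed

lemma crit_normal_cover:
  assumes "l \<in> crit"
  obtains f where "normal_cover l f"
proof -
  have l: "l \<noteq> 0" "l \<noteq> 1" using assms by (auto simp: crit_def)
  obtain c where c: "c \<noteq> 0" "degree c \<le> m" "\<And>i. i \<le> m \<Longrightarrow> coeff (F l * c) (q + i) = 0"
    using assms unfolding crit_def poly_DD_eq_0_iff by blast
  obtain u v where "pade_solution e1 e2 m q K l c u v" by (rule solutionE[OF l c])
  then interpret pade_solution e1 e2 m q K l c u v .
  have cop: "coprime u v" using no_common_root by (simp add: coprime_iff_no_common_root)
  have deg: "rat_degree u v = d" using degree_u degree_v pos by (simp add: rat_degree_def)
  have u0: "poly u 0 = 0" using order_0_u u_nonzero by (simp add: order_root)
  have u1: "poly u 1 = poly v 1" "poly u l = poly v l"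
    using arg_cong[OF eq, of "\<lambda>p. poly p 1"] arg_cong[OF eq, of "\<lambda>p. poly p l"] pos
    by (simp_all add: F_def poly_power zero_power)
  have vd: "coeff v d = 0" using deg_v pos by (intro coeff_eq_0) simp
  have f: "rat_map u v (Fin 0) = Fin 0" "rat_map u v (Fin 1) = Fin 1" "rat_map u v (Fin l) = Fin 1"
    "rat_map u v Infty = Infty"
    using u0 u1 vd poly_v_nonzero by (simp_all add: deg)
  have ord: "order x (F l * c) = order x ([:-1, 1:] ^ e1) + order x ([:-l, 1:] ^ e2) + order x c" for x
    using c_nonzero by (simp add: F_def order_mult)
  have r: "ram_index u v (Fin 0) = e3" "ram_index u v Infty = e4"
    "ram_index u v (Fin 1) = e1" "ram_index u v (Fin l) = e2"
  proof -
    show "ram_index u v (Fin 0) = e3" unfolding ram_index_eq f using order_0_u by simp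
    show "ram_index u v Infty = e4" unfolding ram_index_eq f deg using degree_v pos by simp
    have "order 1 (F l * c) = e1"
      unfolding ord using l poly_c_nonzero order_power_n_n[of "1::'a"] by (simp add: order_0I poly_power)
    then show "ram_index u v (Fin 1) = e1" unfolding ram_index_eq f by (simp add: eq)
    have "order l (F l * c) = e2"
      unfolding ord using l poly_c_nonzero order_power_n_n[of l] by (simp add: order_0I poly_power)
    then show "ram_index u v (Fin l) = e2" unfolding ram_index_eq f by (simp add: eq)
  qed
  have other: "ram_index u v P = 1" if P: "P \<notin> {Fin 1, Fin l, Fin 0, Infty}" for P
  proof -
    obtain x where x: "P = Fin x" "x \<noteq> 0" "x \<noteq> 1" "x \<noteq> l" using P by (cases P) auto
    let ?g = "fibre_poly u v (rat_map u v P)"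
    obtain s t where g: "?g = smult s u + smult t v" "s \<noteq> 0 \<or> t \<noteq> 0"
    proof (cases "rat_map u v P")
      case (Fin y)
      then show ?thesis using that[of 1 "- y"] by simp
    next
      case Infty
      then show ?thesis using that[of 0 1] by simp
    qed
    have g0: "?g \<noteq> 0" using fibre_poly_nonzero[OF cop] deg d_pos by simp
    have "\<not> [:-x, 1:] ^ 2 dvd ?g" using simple_elsewhere[OF x(2-4)] g by metis
    then have "order x ?g < 2" using order_divides[of x 2 ?g] g0 by simp
    moreover have "form_eval d ?g P = 0" using rat_map_eq_iff[OF cop, of P "rat_map u v P"] deg by simp
    then have "0 < order x ?g" using x(1) g0 by (simp add: order_gt_0_iff del: rat_map.simps)
    ultimately show ?thesis unfolding ram_index_eq using x(1) by (simp del: rat_map.simps)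
  qed
  have "normal_cover l (rat_map u v)"
    unfolding marked_def morphism_degree_rat_map[OF cop] ramification_rat_map[OF cop]
    using cop deg f r other l by (auto simp: line_morphism_def simp del: rat_map.simps)
  then show ?thesis using that by blast
qed

definition crit_cover :: "'a \<Rightarrow> 'a proj_line \<Rightarrow> 'a proj_line" where
  "crit_cover l = (SOME f. normal_cover l f)"

lemma crit_cover: "l \<in> crit \<Longrightarrow> normal_cover l (crit_cover l)"
  unfolding crit_cover_def using crit_normal_cover by (metis someI_ex)

section \<open>Isomorphisms between covers in normal form\<close>

lemma marked_normalize:
  assumes m: "marked_cover f P1 P2 P3 P4"
  obtains g l where "moebius g" "normal_cover l (f \<circ> g)"
proof -
  have ne: "P3 \<noteq> P1" "P3 \<noteq> P4" "P1 \<noteq> P4" "P2 \<noteq> P4" using m by (auto simp: marked_def)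
  obtain g where g: "moebius g" "g (Fin 0) = P3" "g (Fin 1) = P1" "g Infty = P4"
    using moebius_three_points[OF ne(1-3)] .
  obtain P where "g P = P2" using moebius_bij[OF g(1)] by (metis bij_pointE)
  then obtain l where "g (Fin l) = P2" using ne g(4) by (cases P) auto
  then have "marked_cover f (g (Fin 1)) (g (Fin l)) (g (Fin 0)) (g Infty)" using m g by simp
  moreover have "line_morphism f" "morphism_degree f = d" using m by (auto simp: marked_def)
  ultimately have "normal_cover l (f \<circ> g)" using marked_comp[OF d_pos g(1)] by simp
  then show ?thesis using that g by blast
qed

lemma normal_cover_comp_iff:
  assumes l: "normal_cover l f" and g: "moebius g"
  shows "normal_cover l' (f \<circ> g) \<longleftrightarrow> marked_cover f (g (Fin 1)) (g (Fin l')) (g (Fin 0)) (g Infty)"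
  using assms by (intro marked_comp[OF d_pos]) (auto simp: marked_def)

text \<open>An isomorphism fixes 0 and infinity, so it is multiplication by some \<open>c\<close>.
  It maps \<open>1\<close> and \<open>l'\<close> to \<open>1\<close> and \<open>l\<close>, in this
  order with \<open>c = 1\<close> or exchanged with \<open>c = l\<close>.\<close>

lemma normal_cover_iso:
  assumes l: "normal_cover l f" and l': "normal_cover l' (f \<circ> g)" and g: "moebius g"
  shows "l' = l \<or> e1 = e2 \<and> l' = 1 / l"
proof -
  have m: "marked_cover f (g (Fin 1)) (g (Fin l')) (g (Fin 0)) (g Infty)"
    using l' normal_cover_comp_iff[OF l g] by simp
  note u = marked_unique[OF l m gt1 e3_gt e4_gt]
  obtain c where c: "c \<noteq> 0" "\<And>x. g (Fin x) = Fin (c * x)"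
    using moebius_fixing_0_infinity[OF g] u(1,2) by metis
  show ?thesis using u(3) c by (auto simp: field_simps)
qed

lemma normal_cover_swap:
  assumes l: "normal_cover l f" and "e1 = e2"
  shows "normal_cover (1 / l) (f \<circ> rat_map [:0, l:] [:1:])"
proof -
  have l0: "l \<noteq> 0" using normal_cover_crit[OF l] by (simp add: crit_def)
  have "marked_cover f (Fin l) (Fin 1) (Fin 0) Infty"
    using l assms(2) unfolding marked_def by auto
  then show ?thesis
    unfolding normal_cover_comp_iff[OF l moebius_scale(1)[OF l0]]
    using l0 by (simp only: moebius_scale(2,3)[OF l0]) simp
qed

lemma crit_inverse: "e1 = e2 \<Longrightarrow> l \<in> crit \<Longrightarrow> 1 / l \<in> crit"
  using crit_cover normal_cover_swap normal_cover_crit by blast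

text \<open>Otherwise the cover for \<open>l = -1\<close> would be an even function with a zero of odd order at \<open>0\<close>.\<close>

lemma minus_1_not_crit:
  assumes "e1 = e2" "odd e3"
  shows "- 1 \<notin> crit"
proof
  assume "- 1 \<in> crit"
  then have n: "normal_cover (- 1) (crit_cover (- 1))" by (rule crit_cover)
  define f where "f = crit_cover (- 1)"
  have fn: "normal_cover (- 1) f" using n by (simp add: f_def)
  have "normal_cover (1 / - 1) (f \<circ> rat_map [:0, - 1:] [:1:])" using normal_cover_swap[OF fn assms(1)] .
  then have "normal_cover (- 1) (f \<circ> rat_map [:0, - 1:] [:1:])" by simp
  then have "f \<circ> rat_map [:0, - 1:] [:1:] = f" using fn by (rule normal_cover_unique)
  then have "f (rat_map [:0, - 1:] [:1:] (Fin x)) = f (Fin x)" for x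
    by (simp add: fun_eq_iff del: rat_map.simps)
  then have even: "f (Fin (- x)) = f (Fin x)" for x by (simp add: moebius_scale(2) del: rat_map.simps)
  obtain a b where ab: "coprime a b" "f = rat_map a b" "order 0 a = e3" "poly b 0 \<noteq> 0" "rat_degree a b = d"
    by (rule normal_coverE[OF fn])
  have a0: "a \<noteq> 0" using fibre_poly_nonzero[OF ab(1), of "Fin 0"] ab(5) d_pos by simp
  obtain h where h: "a = [:0, 1:] ^ e3 * h" "\<not> [:0, 1:] dvd h"
    using order_decomp[OF a0, of 0] ab(3) by auto
  have h0: "poly h 0 \<noteq> 0" using h(2) by (auto simp: poly_eq_0_iff_dvd)
  \<comment> \<open>Evenness of \<open>a / b\<close> after the factor \<open>x ^ e3\<close> is
    cancelled; the sign comes from the odd exponent. At 0 the two sides are opposite, so twice a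
    nonzero value would be 0.\<close>
  have "- (h \<circ>\<^sub>p [:0, - 1:] * b) = h * (b \<circ>\<^sub>p [:0, - 1:])"
  proof (rule poly_eqI_nonzero)
    fix x :: 'a assume x: "x \<noteq> 0"
    have "pt (poly a (- x)) (poly b (- x)) = pt (poly a x) (poly b x)"
      using even[of x] unfolding ab(2) by (simp add: pt_def)
    then have "poly a (- x) * poly b x = poly a x * poly b (- x)"
      using ab(1) by (subst (asm) pt_eq_iff) (auto simp: coprime_iff_no_common_root)
    then have "(- x) ^ e3 * poly h (- x) * poly b x = x ^ e3 * poly h x * poly b (- x)"
      unfolding h(1) by (simp only: poly_mult poly_power poly_pCons poly_0) simp
    moreover have "(- x) ^ e3 = - (x ^ e3)" using assms(2) by (rule power_minus_odd)
    ultimately have "x ^ e3 * - (poly h (- x) * poly b x) = x ^ e3 * (poly h x * poly b (- x))"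
      by (simp only: mult_minus_left mult_minus_right mult.assoc)
    then have "- (poly h (- x) * poly b x) = poly h x * poly b (- x)"
      using x by (metis mult_left_cancel power_not_zero)
    then show "poly (- (h \<circ>\<^sub>p [:0, - 1:] * b)) x = poly (h * (b \<circ>\<^sub>p [:0, - 1:])) x"
      by (simp add: poly_pcompose)
  qed
  then have "poly (- (h \<circ>\<^sub>p [:0, - 1:] * b)) 0 = poly (h * (b \<circ>\<^sub>p [:0, - 1:])) 0" by simp
  then have "- (poly h 0 * poly b 0) = poly h 0 * poly b 0" by (simp add: poly_pcompose)
  then have "poly h 0 * poly b 0 + poly h 0 * poly b 0 = 0" by (simp add: eq_neg_iff_add_eq_0 neg_eq_iff_add_eq_0)
  then have "of_nat 2 * (poly h 0 * poly b 0) = 0" by (simp only: of_nat_numeral mult_2)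
  \<comment> \<open>Since \<open>e1\<close> and \<open>e2\<close> exceed 1, the integer 2 lies below
    the degree and is invertible.\<close>
  moreover have "of_nat 2 \<noteq> (0::'a)" using char[of 2] gt1 by simp
  ultimately show False using h0 ab(4) by simp
qed

definition crit_rel :: "('a \<times> 'a) set" where
  "crit_rel = {(l, l'). l \<in> crit \<and> l' \<in> crit \<and> (l' = l \<or> e1 = e2 \<and> l' = 1 / l)}"

lemma equiv_crit_rel: "equiv crit crit_rel"
proof (rule equivI)
  show "refl_on crit crit_rel" by (auto simp: refl_on_def crit_rel_def)
  show "sym crit_rel" by (auto simp: sym_def crit_rel_def)
  show "trans crit_rel" by (auto simp: trans_def crit_rel_def)
qed (auto simp: crit_rel_def)

lemma card_crit_quotient:
  assumes "odd e3"
  shows "(if e1 = e2 then 2 else 1) * card (crit // crit_rel) = card crit"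
proof -
  have "card C = (if e1 = e2 then 2 else 1)" if C: "C \<in> crit // crit_rel" for C
  proof -
    obtain l where l: "l \<in> crit" "C = crit_rel `` {l}" using C by (auto elim: quotientE)
    show ?thesis
    proof (cases "e1 = e2")
      case False
      then have "C = {l}" using l by (auto simp: crit_rel_def)
      then show ?thesis using False by simp
    next
      case True
      have "C = {l, 1 / l}"
        unfolding l(2) crit_rel_def using l(1) True crit_inverse[OF True l(1)] by blast
      moreover have "l \<noteq> 1 / l"
      proof
        assume "l = 1 / l"
        moreover have "l \<noteq> 0" "l \<noteq> 1" using l by (auto simp: crit_def)
        ultimately have "(l - 1) * (l + 1) = 0" by (simp add: field_simps)
        then have "l = - 1" using \<open>l \<noteq> 1\<close> by (simp add: add_eq_0_iff2)
        then show False using l minus_1_not_crit[OF True assms] by simp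
      qed
      ultimately show ?thesis using True by simp
    qed
  qed
  moreover have "finite (crit // crit_rel)"
    using finite_crit by (rule finite_quotient) (auto simp: crit_rel_def)
  ultimately show ?thesis
    using card_partition[of "crit // crit_rel" "if e1 = e2 then 2 else 1"] finite_crit
      Union_quotient[OF equiv_crit_rel] quotient_disj[OF equiv_crit_rel] by metis
qed

lemma hurwitz_number_crit:
  fixes Q1 Q2 Q3 :: "'a proj_line"
  assumes "distinct [Q1, Q2, Q3]" "odd e3"
  shows "(if e1 = e2 then 2 else 1) *
    hurwitz_number d [Q1, Q2, Q3] [two_cycles d e1 e2, one_cycle d e3, one_cycle d e4] = card crit"
proof -
  let ?Qs = "[Q1, Q2, Q3]" and ?Cs = "[two_cycles d e1 e2, one_cycle d e3, one_cycle d e4]"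
  let ?Q0 = "[Fin 1, Fin 0, Infty] :: 'a proj_line list"
  \<comment> \<open>Moves the standard branch points to the given ones, so the count does not depend
    on their position.\<close>
  obtain s where s: "moebius s" "s (Fin 0) = Q2" "s (Fin 1) = Q1" "s Infty = Q3"
    using moebius_three_points[of Q2 Q1 Q3] assms(1) by auto
  obtain t where t: "moebius t" "s \<circ> t = id" "t \<circ> s = id" using moebius_inverse[OF s(1)] .
  have sQ: "map s ?Q0 = ?Qs" using s by simp
  then have tQ: "map t ?Qs = ?Q0" using t(3) by (metis list.map_comp list.map_id)
  have std: "f \<in> covers d ?Q0 ?Cs \<longleftrightarrow> (\<exists>P1 P2 P3 P4. marked_cover f P1 P2 P3 P4)" for f
    by (rule covers_iff_marked[OF d_pos gt1 e3_gt e4_gt])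
  have iso: "(f, g) \<in> cover_iso d ?Qs ?Cs \<longleftrightarrow> f \<in> covers d ?Qs ?Cs \<and> (\<exists>h. moebius h \<and> g = f \<circ> h)" for f g
    by (rule cover_iso_iff[OF d_pos])
  have "card (covers d ?Qs ?Cs // cover_iso d ?Qs ?Cs) = card (crit // crit_rel)"
  proof (rule card_quotient_transfer[OF equiv_cover_iso[OF d_pos] equiv_crit_rel])
    fix l assume l: "l \<in> crit"
    have "crit_cover l \<in> covers d ?Q0 ?Cs" using std crit_cover[OF l] by blast
    then show mem: "s \<circ> crit_cover l \<in> covers d ?Qs ?Cs"
      using moebius_comp_covers[OF _ d_pos s(1)] sQ by metis
    fix l' assume l': "l' \<in> crit"
    show "(s \<circ> crit_cover l, s \<circ> crit_cover l') \<in> cover_iso d ?Qs ?Cs \<longleftrightarrow> (l, l') \<in> crit_rel"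
    proof
      assume "(s \<circ> crit_cover l, s \<circ> crit_cover l') \<in> cover_iso d ?Qs ?Cs"
      then obtain h where h: "moebius h" "s \<circ> crit_cover l' = s \<circ> crit_cover l \<circ> h"
        unfolding iso by blast
      then have "crit_cover l' = crit_cover l \<circ> h" using t(3) by (metis comp_assoc fun.map_id id_comp)
      then show "(l, l') \<in> crit_rel"
        using normal_cover_iso[OF crit_cover[OF l] _ h(1)] crit_cover[OF l'] l l'
        by (simp add: crit_rel_def)
    next
      assume "(l, l') \<in> crit_rel"
      then consider "l' = l" | "e1 = e2" "l' = 1 / l" by (auto simp: crit_rel_def)
      then show "(s \<circ> crit_cover l, s \<circ> crit_cover l') \<in> cover_iso d ?Qs ?Cs"
      proof cases
        case 1
        then show ?thesis using mem equiv_class_self[OF equiv_cover_iso[OF d_pos] mem] by simp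
      next
        case 2
        have "normal_cover l' (crit_cover l \<circ> rat_map [:0, l:] [:1:])"
          using normal_cover_swap[OF crit_cover[OF l] 2(1)] 2(2) by simp
        then have "crit_cover l' = crit_cover l \<circ> rat_map [:0, l:] [:1:]"
          by (rule normal_cover_unique[OF crit_cover[OF l']])
        moreover have "moebius (rat_map [:0, l:] [:1:])"
          using l by (intro moebius_scale(1)) (simp add: crit_def)
        moreover from calculation have "s \<circ> crit_cover l' = s \<circ> crit_cover l \<circ> rat_map [:0, l:] [:1:]"
          by (simp only: comp_assoc)
        ultimately show ?thesis unfolding iso using mem by blast
      qed
    qed
  next
    fix f assume f: "f \<in> covers d ?Qs ?Cs"
    then have "t \<circ> f \<in> covers d ?Q0 ?Cs" using moebius_comp_covers[OF f d_pos t(1)] tQ by metis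
    then obtain P1 P2 P3 P4 where "marked_cover (t \<circ> f) P1 P2 P3 P4" using std by blast
    then obtain g l where g: "moebius g" "normal_cover l (t \<circ> f \<circ> g)" by (rule marked_normalize)
    have l: "l \<in> crit" using normal_cover_crit[OF g(2)] .
    have "crit_cover l = t \<circ> f \<circ> g" using normal_cover_unique[OF crit_cover[OF l] g(2)] .
    then have "s \<circ> crit_cover l = f \<circ> g" using t(2) by (metis comp_assoc id_comp)
    then have "(f, s \<circ> crit_cover l) \<in> cover_iso d ?Qs ?Cs" using iso f g(1) by blast
    then show "\<exists>l\<in>crit. (s \<circ> crit_cover l, f) \<in> cover_iso d ?Qs ?Cs"
      using l equiv_cover_iso[OF d_pos] by (meson equivE symD)
  qed
  then show ?thesis unfolding hurwitz_number_def using card_crit_quotient[OF assms(2)] by simp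
qed

end

theorem theorem1p2:
  fixes p e1 e2 e3 e4 :: nat
    and Q1 Q2 Q3 :: "complex proj_line"
    and R1 R2 R3 :: "'k::alg_closed_field proj_line"
  assumes "prime p"
    and "CHAR('k) = p"
    and "distinct [Q1, Q2, Q3]"
    and "distinct [R1, R2, R3]"
    and "\<And>e. e \<in> {e1, e2, e3, e4} \<Longrightarrow> odd e \<and> 1 < e \<and> e < p"
    and "e1 + e2 \<le> p"
    and "e1 + e2 + e3 + e4 = 2 * p + 2"
  shows "real (hurwitz_number p [R1, R2, R3] [two_cycles p e1 e2, one_cycle p e3, one_cycle p e4]) =
    (if e1 \<noteq> e2
     then real (hurwitz_number p [Q1, Q2, Q3] [two_cycles p e1 e2, one_cycle p e3, one_cycle p e4])
            - (real p + 1 - real e1 - real e2)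
     else real (hurwitz_number p [Q1, Q2, Q3] [two_cycles p e1 e2, one_cycle p e3, one_cycle p e4])
            - (real p + 1 - real e1 - real e2) / 2)"
proof -
  \<comment> \<open>Chosen so that the degree \<open>e1 + e2 + m\<close> is \<open>p\<close> and
    infinity has index \<open>p + 1 - q = e4\<close>. The sum of the indices then yields
    \<open>q + m + 1 = e3\<close>.\<close>
  define m q where "m = p - (e1 + e2)" and "q = p + 1 - e4"
  have e: "1 < e1" "1 < e2" "1 < e3" "1 < e4" "e3 < p" "e4 < p" "odd e3" using assms(5) by auto
  have mq: "e1 + e2 + m = p" "q + m + 1 = e3" "p + 1 - q = e4" "0 < q" "q < e1 + e2"
    using e assms(6,7) by (auto simp: m_def q_def)
  have "of_nat k \<noteq> (0::'k)" if "0 < k" "k < e1 + e2 + m" for k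
    using that mq(1) assms(2) by (auto simp: of_nat_eq_0_iff_char_dvd dest: dvd_imp_le)
  then interpret k: four_point e1 e2 m q "TYPE('k)"
    using e mq by unfold_locales auto
  interpret c: four_point e1 e2 m q "TYPE(complex)"
    using e mq by unfold_locales auto
  have "of_nat (e1 + e2 + m) = (0::'k)" using mq(1) assms(2) by (metis of_nat_CHAR)
  then have "card k.crit + Suc m = k.ncrit" using k.card_crit by simp
  moreover have "of_nat (e1 + e2 + m) \<noteq> (0::complex)" using e by (simp only: of_nat_eq_0_iff)
  then have "card c.crit = c.ncrit" using c.card_crit by simp
  \<comment> \<open>\<open>ncrit\<close> is the same natural number for both fields; the root
    \<open>l = 1\<close> in characteristic \<open>p\<close> accounts for the difference.\<close>
  ultimately have "card k.crit + Suc m = card c.crit" by (simp add: k.ncrit_def c.ncrit_def)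
  moreover have "(if e1 = e2 then 2 else 1) * hurwitz_number p [R1, R2, R3]
      [two_cycles p e1 e2, one_cycle p e3, one_cycle p e4] = card k.crit"
    by (rule k.hurwitz_number_crit[OF assms(4), unfolded mq, OF e(7)])
  moreover have "(if e1 = e2 then 2 else 1) * hurwitz_number p [Q1, Q2, Q3]
      [two_cycles p e1 e2, one_cycle p e3, one_cycle p e4] = card c.crit"
    by (rule c.hurwitz_number_crit[OF assms(3), unfolded mq, OF e(7)])
  moreover have "real (Suc m) = real p + 1 - real e1 - real e2" using mq(1) by simp
  ultimately show ?thesis by (auto simp: field_simps split: if_splits simp flip: of_nat_mult of_nat_add)
qed

end
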